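(* Let problem (P) be as described in the context and suppose (A1) and (A2) hold. Let $\varepsilon>0$ be given and let $y^0\in\mathrm{dom}(h)$. Choose $\nu=\frac{\varepsilon}{2D_y}$, where $D_y=\max_{y_1,y_2\in\mathrm{dom}(h)}\|y_1-y_2\|$. Apply Algorithm A (see context) to produce an $\frac\varepsilon2$-KKT point $(\tilde x,\tilde y)$ of the perturbed problem $$\text{(P}_\nu)\qquad\min_{x\in\mathbb{R}^n}\max_{y\in\mathbb{R}^m}F(x,y)-\frac\nu2\|y-y^0\|^2-h(y)+g(x)\quad\text{s.t. } p(y)\le0,\ c(x)\le0.$$ Then $(\tilde x,\tilde y)$ is an $\varepsilon$-KKT point of (P). In addition, the algorithm needs at most $\tilde{\mathcal O}(\varepsilon^{-1})$ calls to $\nabla_xF$, $J_c$ and $\mathrm{prox}_{\alpha_xg}$ and $\tilde{\mathcal O}(\varepsilon^{-3/2})$ calls to $\nabla_yF$, $J_p$ and $\mathrm{prox}_{\alpha_yh}$.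
   Context: **Problem and assumptions.** The problem is $$\text{(P)}\qquad \min_{x\in\mathbb{R}^n}\max_{y\in\mathbb{R}^m} F(x,y)-h(y)+g(x)\quad\text{s.t. } c(x)\le 0,\ p(y)\le 0,$$ with $c:\mathbb{R}^n\to\mathbb{R}^q$, $p:\mathbb{R}^m\to\mathbb{R}^r$. (A1): $F:\mathbb{R}^n\times\mathbb{R}^m\to\mathbb{R}$ is convex in $x$, concave in $y$, with $L_F$-Lipschitz gradient; $g$ and $h$ are proper closed convex, Lipschitz continuous (on their domains), with compact domains $\mathrm{dom}(g)\subset\mathbb{R}^n$, $\mathrm{dom}(h)\subset\mathbb{R}^m$; every component of $c$ and $p$ is convex and differentiable, and the Jacobians satisfy $\|J_c(x_1)-J_c(x_2)\|_F\le L_c\|x_1-x_2\|$, $\|J_p(y_1)-J_p(y_2)\|_F\le L_p\|y_1-y_2\|$ for all arguments. (A2): there are $x_{\rm feas}\in\mathrm{dom}(g)$, $y_{\rm feas}\in\mathrm{dom}(h)$ with $\min_i(-c_i(x_{\rm feas}))>0$ and $\min_i(-p_i(y_{\rm feas}))>0$. **$\varepsilon$-KKT point.** For a problem of the form (P), $(x,y)$ is an $\varepsilon$-KKT point if there are multipliers $z\ge0$, $u\ge 0$ with $\mathrm{dist}(0,\nabla_xF(x,y)+\partial g(x)+J_c(x)^\top z)\le\varepsilon$, $\|[c(x)]_+\|\le\varepsilon$, $\sum_{i=1}^q|c_i(x)z_i|\le\varepsilon$, $\mathrm{dist}(0,\nabla_yF(x,y)-\partial h(y)-J_p(y)^\top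 u)\le\varepsilon$, $\|[p(y)]_+\|\le\varepsilon$, $\sum_{i=1}^r|p_i(y)u_i|\le\varepsilon$. Here $[a]_+=\max\{a,0\}$ componentwise and $\|\cdot\|$ is the Euclidean norm (operator norm for matrices). For (P$_\nu$), $F$ is replaced by $F_\nu(x,y)=F(x,y)-\frac\nu2\|y-y^0\|^2$. Algorithm A below is described for a problem of the form (P) in which $F(x,\cdot)$ is $\mu_F$-strongly concave for $x\in\mathrm{dom}(g)$; in the theorem it is applied to (P$_\nu$), i.e. with $F$ replaced by $F_\nu$, strong concavity modulus $\mu_F=\nu$, and tolerance $\varepsilon/2$. **Functions.** For a fixed $\beta_y>0$, $Q(x,y,u)=F(x,y)-h(y)-\frac1{2\beta_y}\left(\|[\beta_yp(y)+u]_+\|^2-\|u\|^2\right)$, $\Psi(x,u)=\max_yQ(x,y,u)$. **Subroutine** $\hat v=\mathrm{iAPG}(\psi,\phi;v^0,L_{\min},\mu_\phi,\epsilon,\gamma_u,\gamma_d)$ for minimizing $\psi+\phi$, with $\psi$ convex and smooth, $\phi$ closed $\mu_\phi$-strongly convex, using approximate gradients $\tilde\nabla\psi$. Let $\mathrm{prox}_{\eta\phi}(a)=\arg\min_v\frac1{2\eta}\|v-a\|^2+\phi(v)$. Set $A_0=0$, $\digamma_0(v)=\frac12\|v-v^0\|^2$, $L_0\ge L_{\min}$, $\pi^0=v^0$. For $k=0,1,\dots$: start with $L=L_k$ and repeat the following line-search trial: find $a>0$ with $\frac{a^2}{A_k+a}=\frac{2(1+\mu_\phi A_k)}L$; let $b=\frac{A_kv^k+a\pi^k}{A_k+a}$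 and $\omega=\min\{\frac{\epsilon}8,\frac{\mu_\phi\epsilon}{(k+1)^2\max\{1,A_k+a\}}\}$; obtain $\tilde\nabla\psi(b)$ with $\|\tilde\nabla\psi(b)-\nabla\psi(b)\|\le\omega$; set $d=\mathrm{prox}_{\phi/L}(b-\frac1L\tilde\nabla\psi(b))$; obtain $\tilde\nabla\psi(d)$ with $\|\tilde\nabla\psi(d)-\nabla\psi(d)\|\le\omega$; let $\xi=\tilde\nabla\psi(d)-\tilde\nabla\psi(b)-L(d-b)$; accept if $\langle\xi,b-d\rangle\ge\frac1L\|\xi\|^2-6\omega\|b-d\|-\frac{4\omega^2}L$, otherwise replace $L$ by $\gamma_uL$ and repeat. After acceptance set $v^{k+1}=d$, $L_{k+1}=\max\{L_{\min},L/\gamma_d\}$, $a_{k+1}=a$, $A_{k+1}=A_k+a$, $\digamma_{k+1}(v)=\digamma_k(v)+a_{k+1}(\psi(v^{k+1})+\langle\tilde\nabla\psi(v^{k+1}),v-v^{k+1}\rangle+\phi(v))$, $\pi^{k+1}=\arg\min\digamma_{k+1}$; return $d$ and stop if $\|\tilde\nabla\psi(d)-\tilde\nabla\psi(b)-L(d-b)\|\le\frac{\epsilon}2$. The *exact version* uses $\tilde\nabla\psi=\nabla\psi$. **Algorithm A (adaptive inexact proximal augmented Lagrangian method).** Inputs: tolerance $\varepsilon>0$, $\underline L>0$, $\gamma_u,\gamma_d>1$; $x^0\in\mathrm{dom}(g)$, $y^0\in\mathrm{dom}(h)$, $u^0\ge0$, $z^0\ge0$; $\beta_y,\beta_{x,0},\rho_0,\eta_0>0$;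 $\tau>\sigma>1$. Set $\beta_{x,t}=\beta_{x,0}\sigma^t$, $\rho_t=\rho_0\sigma^{-t}$, $\eta_t=\eta_0\tau^{-t}$. For $t=0,1,\dots$: 1. with $\psi_t(x,u)=\Psi(x,u)+\frac1{2\beta_{x,t}}\|[\beta_{x,t}c(x)+z^t]_+\|^2$ and $\phi_t(x,u)=g(x)+\frac{\rho_t}2(\|x-x^t\|^2+\|u-u^t\|^2)$, let $(x^{t+1},u^{t+1})=\mathrm{iAPG}(\psi_t,\phi_t;(x^t,u^t),\underline L\sigma^t,\rho_t,\eta_t,\gamma_u,\gamma_d)$; 2. with $\bar\psi_t(y)=-F(x^{t+1},y)+\frac1{2\beta_y}\|[\beta_yp(y)+u^{t+1}]_+\|^2-\frac{\mu_F}2\|y\|^2$ and $\bar\phi_t(y)=\frac{\mu_F}2\|y\|^2+h(y)$, let $y^{t+1}=\mathrm{iAPG}(\bar\psi_t,\bar\phi_t;y^t,\underline L,\mu_F,\min\{\varepsilon,\eta_t\}\mu_F,\gamma_u,\gamma_d)$ (exact version); 3. set $z^{t+1}=[\beta_{x,t}c(x^{t+1})+z^t]_+$, $\tilde u^{t+1}=[\beta_yp(y^{t+1})+u^{t+1}]_+$; 4. if $(x^{t+1},y^{t+1})$ is an $\varepsilon$-KKT point with multipliers $z^{t+1},\tilde u^{t+1}$, return $(x^{t+1},y^{t+1},z^{t+1},\tilde u^{t+1})$ and stop. In step 1, the approximate gradient of $\psi_t$ at $(x,u)$ with error at most $\omega$ is $\big[\nabla_xF(x,\tilde y)+J_c(x)^\top[\beta_{x,t}c(x)+z^t]_+,\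 \frac1{\beta_y}(u-[\beta_yp(\tilde y)+u]_+)\big]$, where $\tilde y$ is a $\frac{\omega\mu_F}{L_F+M_p}$-stationary point of $\min_y -Q(x,y,u)$ with $M_p=\max_{y\in\mathrm{dom}(h)}\|J_p(y)\|$, computed by the exact version of iAPG, started at $y^t$, with $L_{\min}=\underline L$, strong convexity parameter $\mu_F$, and the splitting of $-Q(x,\cdot,u)$ (up to a constant) into $-F(x,y)+\frac1{2\beta_y}\|[\beta_yp(y)+u]_+\|^2-\frac{\mu_F}2\|y\|^2$ and $\frac{\mu_F}2\|y\|^2+h(y)$. Calls to $\mathrm{prox}_{\alpha_xg}$, $\mathrm{prox}_{\alpha_yh}$ mean evaluations for arbitrary $\alpha_x,\alpha_y>0$. $\tilde{\mathcal O}$ refers to $\varepsilon\to0$ with problem data and the other parameters fixed, and hides logarithmic factors in $1/\varepsilon$. *)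

theory Defs
  imports "HOL-Analysis.Analysis" "HOL-Library.Monad_Syntax"
begin

section \<open>Convex analysis for extended-real-valued functions\<close>

definition edom :: "('a \<Rightarrow> ereal) \<Rightarrow> 'a set" where
  "edom f = {x. f x < \<infinity>}"

definition proper_closed_convex :: "('a::euclidean_space \<Rightarrow> ereal) \<Rightarrow> bool" where
  "proper_closed_convex f \<longleftrightarrow>
     (\<forall>x. f x \<noteq> -\<infinity>) \<and> edom f \<noteq> {} \<and>
     convex {(x, r::real). f x \<le> ereal r} \<and> closed {(x, r::real). f x \<le> ereal r}"

definition subdiff :: "('a::euclidean_space \<Rightarrow> ereal) \<Rightarrow> 'a \<Rightarrow> 'a set" where
  "subdiff f x = {s. x \<in> edom f \<and> (\<forall>y. f x + ereal (s \<bullet> (y - x)) \<le> f y)}"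

text \<open>The distance from the origin takes values in the extended reals because it must be
  \<open>\<infinity>\<close> for the empty set (the library's \<open>infdist\<close> and \<open>setdist\<close> would give \<open>0\<close>).\<close>

definition dist0 :: "'a::real_normed_vector set \<Rightarrow> ereal" where
  "dist0 S = (INF s\<in>S. ereal (norm s))"

definition grad :: "('a::real_inner \<Rightarrow> real) \<Rightarrow> 'a \<Rightarrow> 'a" where
  "grad f x = (THE D. GDERIV f x :> D)"

definition prox :: "real \<Rightarrow> ('a::real_inner \<Rightarrow> ereal) \<Rightarrow> 'a \<Rightarrow> 'a" where
  "prox \<eta> \<phi> a = arg_min (\<lambda>v. ereal (1 / (2 * \<eta>) * (norm (v - a))\<^sup>2) + \<phi> v) (\<lambda>_. True)"

definition pos :: "real^'k \<Rightarrow> real^'k" where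
  "pos a = (\<chi> i. max (a $ i) 0)"


section \<open>The problem, its assumptions, and KKT points\<close>

text \<open>\<open>min\<^sub>x max\<^sub>y F (x, y) - h y + g x\<close> subject to \<open>c x \<le> 0\<close> and \<open>p y \<le> 0\<close>.\<close>

record ('x, 'y, 'c, 'p) minimax =
  Ffun :: "'x \<times> 'y \<Rightarrow> real"
  gfun :: "'x \<Rightarrow> ereal"
  hfun :: "'y \<Rightarrow> ereal"
  cfun :: "'x \<Rightarrow> 'c"
  pfun :: "'y \<Rightarrow> 'p"

abbreviation Jac :: "(real^'a \<Rightarrow> real^'b) \<Rightarrow> real^'a \<Rightarrow> real^'a^'b" where
  "Jac f x \<equiv> jacobian f (at x)"

definition gradx :: "(real^'n, real^'m, real^'q, real^'r) minimax \<Rightarrow> real^'n \<Rightarrow> real^'m \<Rightarrow> real^'n" where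
  "gradx P x y = grad (\<lambda>x'. Ffun P (x', y)) x"

definition grady :: "(real^'n, real^'m, real^'q, real^'r) minimax \<Rightarrow> real^'n \<Rightarrow> real^'m \<Rightarrow> real^'m" where
  "grady P x y = grad (\<lambda>y'. Ffun P (x, y')) y"

text \<open>The norm of the type \<open>real^'a^'b\<close>, which underlies \<open>lipschitz_on\<close> for the Jacobians,
  is the Frobenius norm.\<close>

definition assumption_A1 ::
  "(real^'n, real^'m, real^'q, real^'r) minimax \<Rightarrow> real \<Rightarrow> real \<Rightarrow> real \<Rightarrow> bool" where
  "assumption_A1 P L_F L_c L_p \<longleftrightarrow>
     (\<forall>y. convex_on UNIV (\<lambda>x. Ffun P (x, y))) \<and>
     (\<forall>x. concave_on UNIV (\<lambda>y. Ffun P (x, y))) \<and>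
     (\<forall>w. Ffun P differentiable (at w)) \<and> L_F-lipschitz_on UNIV (grad (Ffun P)) \<and>
     proper_closed_convex (gfun P) \<and> compact (edom (gfun P)) \<and>
     (\<exists>L. L-lipschitz_on (edom (gfun P)) (\<lambda>x. real_of_ereal (gfun P x))) \<and>
     proper_closed_convex (hfun P) \<and> compact (edom (hfun P)) \<and>
     (\<exists>L. L-lipschitz_on (edom (hfun P)) (\<lambda>y. real_of_ereal (hfun P y))) \<and>
     (\<forall>i. convex_on UNIV (\<lambda>x. cfun P x $ i) \<and> (\<forall>x. (\<lambda>x. cfun P x $ i) differentiable (at x))) \<and>
     (\<forall>i. convex_on UNIV (\<lambda>y. pfun P y $ i) \<and> (\<forall>y. (\<lambda>y. pfun P y $ i) differentiable (at y))) \<and>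
     L_c-lipschitz_on UNIV (Jac (cfun P)) \<and>
     L_p-lipschitz_on UNIV (Jac (pfun P))"

definition assumption_A2 :: "(real^'n, real^'m, real^'q, real^'r) minimax \<Rightarrow> bool" where
  "assumption_A2 P \<longleftrightarrow>
     (\<exists>x \<in> edom (gfun P). \<forall>i. - (cfun P x $ i) > 0) \<and>
     (\<exists>y \<in> edom (hfun P). \<forall>i. - (pfun P y $ i) > 0)"

definition eps_KKT_mult ::
  "real \<Rightarrow> (real^'n, real^'m, real^'q, real^'r) minimax \<Rightarrow>
   real^'n \<Rightarrow> real^'m \<Rightarrow> real^'q \<Rightarrow> real^'r \<Rightarrow> bool" where
  "eps_KKT_mult \<epsilon> P x y z u \<longleftrightarrow>
     (\<forall>i. 0 \<le> z $ i) \<and> (\<forall>i. 0 \<le> u $ i) \<and>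
     dist0 {gradx P x y + s + transpose (Jac (cfun P) x) *v z | s. s \<in> subdiff (gfun P) x}
       \<le> ereal \<epsilon> \<and>
     norm (pos (cfun P x)) \<le> \<epsilon> \<and>
     (\<Sum>i\<in>UNIV. \<bar>cfun P x $ i * z $ i\<bar>) \<le> \<epsilon> \<and>
     dist0 {grady P x y - s - transpose (Jac (pfun P) y) *v u | s. s \<in> subdiff (hfun P) y}
       \<le> ereal \<epsilon> \<and>
     norm (pos (pfun P y)) \<le> \<epsilon> \<and>
     (\<Sum>i\<in>UNIV. \<bar>pfun P y $ i * u $ i\<bar>) \<le> \<epsilon>"

definition eps_KKT ::
  "real \<Rightarrow> (real^'n, real^'m, real^'q, real^'r) minimax \<Rightarrow> real^'n \<Rightarrow> real^'m \<Rightarrow> bool" where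
  "eps_KKT \<epsilon> P x y \<longleftrightarrow> (\<exists>z u. eps_KKT_mult \<epsilon> P x y z u)"

definition perturbed ::
  "(real^'n, real^'m, real^'q, real^'r) minimax \<Rightarrow> real^'m \<Rightarrow> real \<Rightarrow>
   (real^'n, real^'m, real^'q, real^'r) minimax" where
  "perturbed P y0 \<nu> = P\<lparr>Ffun := (\<lambda>(x, y). Ffun P (x, y) - \<nu> / 2 * (norm (y - y0))\<^sup>2)\<rparr>"


section \<open>Computations with call counters\<close>

text \<open>The algorithms below are partial functions in the option monad: a result \<open>None\<close> means that
  the computation does not terminate. They thread through a record counting the calls to
  \<open>\<nabla>\<^sub>xF\<close>, \<open>J\<^sub>c\<close>, \<open>prox\<close> of \<open>g\<close>, \<open>\<nabla>\<^sub>yF\<close>, \<open>J\<^sub>p\<close>, \<open>prox\<close> of \<open>h\<close>, and the number of invocations of iAPG.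
  The latter serves to resolve the free choice \<open>L\<^sub>0 \<ge> L\<^sub>m\<^sub>i\<^sub>n\<close> in iAPG: the \<open>i\<close>-th invocation during
  a run (at any nesting level) uses \<open>L\<^sub>0 = \<Lambda> i * L\<^sub>m\<^sub>i\<^sub>n\<close>, for an arbitrary sequence \<open>\<Lambda>\<close> of
  factors \<open>\<ge> 1\<close>.\<close>

record calls =
  n_gradx :: nat
  n_Jc :: nat
  n_proxg :: nat
  n_grady :: nat
  n_Jp :: nat
  n_proxh :: nat
  n_iapg :: nat

definition no_calls :: calls where
  "no_calls = \<lparr>n_gradx = 0, n_Jc = 0, n_proxg = 0, n_grady = 0, n_Jp = 0, n_proxh = 0, n_iapg = 0\<rparr>"

definition tick_x :: "calls \<Rightarrow> calls" where
  "tick_x s = s\<lparr>n_gradx := n_gradx s + 1, n_Jc := n_Jc s + 1\<rparr>"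

definition tick_y :: "calls \<Rightarrow> calls" where
  "tick_y s = s\<lparr>n_grady := n_grady s + 1, n_Jp := n_Jp s + 1\<rparr>"

definition tick_g :: "calls \<Rightarrow> calls" where
  "tick_g s = s\<lparr>n_proxg := n_proxg s + 1\<rparr>"

definition tick_h :: "calls \<Rightarrow> calls" where
  "tick_h s = s\<lparr>n_proxh := n_proxh s + 1\<rparr>"

text \<open>An approximate-gradient routine maps a point and an accuracy to an approximate gradient.\<close>

type_synonym 'v gradient_routine = "'v \<Rightarrow> real \<Rightarrow> calls \<Rightarrow> ('v \<times> calls) option"

definition exact_gradient :: "('v::real_inner \<Rightarrow> real) \<Rightarrow> (calls \<Rightarrow> calls) \<Rightarrow> 'v gradient_routine" where
  "exact_gradient \<psi> tick v \<omega> s = Some (grad \<psi> v, tick s)"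


section \<open>The subroutine iAPG\<close>

text \<open>The parameter \<open>tick\<close> accounts for one proximal step on the nonsmooth part of \<open>\<phi>\<close>.
  One line search returns the accepted \<open>L\<close>, \<open>a\<close>, \<open>d\<close>, the approximate gradient
  at \<open>d\<close>, and \<open>\<xi>\<close>.\<close>

partial_function (option) line_search ::
  "'v::real_inner gradient_routine \<Rightarrow> ('v \<Rightarrow> ereal) \<Rightarrow> (calls \<Rightarrow> calls) \<Rightarrow> real \<Rightarrow> real \<Rightarrow> real \<Rightarrow>
   nat \<Rightarrow> real \<Rightarrow> 'v \<Rightarrow> 'v \<Rightarrow> real \<Rightarrow> calls \<Rightarrow>
   ((real \<times> real \<times> 'v \<times> 'v \<times> 'v) \<times> calls) option" where
  "line_search orc \<phi> tick \<mu> \<epsilon> \<gamma>u k A v \<pi> L s =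
     (let a = (THE a. 0 < a \<and> a\<^sup>2 / (A + a) = 2 * (1 + \<mu> * A) / L);
          b = (1 / (A + a)) *\<^sub>R (A *\<^sub>R v + a *\<^sub>R \<pi>);
          \<omega> = min (\<epsilon> / 8) (\<mu> * \<epsilon> / ((real k + 1)\<^sup>2 * max 1 (A + a)))
      in do {
        (gb, s1) \<leftarrow> orc b \<omega> s;
        let d = prox (1 / L) \<phi> (b - (1 / L) *\<^sub>R gb);
        (gd, s2) \<leftarrow> orc d \<omega> (tick s1);
        let \<xi> = gd - gb - L *\<^sub>R (d - b);
        if \<xi> \<bullet> (b - d) \<ge> 1 / L * (norm \<xi>)\<^sup>2 - 6 * \<omega> * norm (b - d) - 4 * \<omega>\<^sup>2 / L
        then Some ((L, a, d, gd, \<xi>), s2)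
        else line_search orc \<phi> tick \<mu> \<epsilon> \<gamma>u k A v \<pi> (\<gamma>u * L) s2
      })"

text \<open>\<open>E\<close> is the estimating function; its minimisation costs one further proximal step,
  since \<open>E\<close> is a quadratic with Hessian a multiple of the identity plus a multiple of \<open>\<phi>\<close>.\<close>

partial_function (option) iapg_loop ::
  "'v::real_inner gradient_routine \<Rightarrow> ('v \<Rightarrow> real) \<Rightarrow> ('v \<Rightarrow> ereal) \<Rightarrow> (calls \<Rightarrow> calls) \<Rightarrow>
   real \<Rightarrow> real \<Rightarrow> real \<Rightarrow> real \<Rightarrow> real \<Rightarrow>
   nat \<Rightarrow> real \<Rightarrow> 'v \<Rightarrow> 'v \<Rightarrow> ('v \<Rightarrow> ereal) \<Rightarrow> real \<Rightarrow> calls \<Rightarrow> ('v \<times> calls) option" where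
  "iapg_loop orc \<psi> \<phi> tick Lmin \<mu> \<epsilon> \<gamma>u \<gamma>d k A v \<pi> E L s =
     do {
       ((L', a, d, gd, \<xi>), s') \<leftarrow> line_search orc \<phi> tick \<mu> \<epsilon> \<gamma>u k A v \<pi> L s;
       let E' = (\<lambda>w. E w + ereal a * (ereal (\<psi> d + gd \<bullet> (w - d)) + \<phi> w));
       let \<pi>' = arg_min E' (\<lambda>_. True);
       let s'' = tick s';
       if norm \<xi> \<le> \<epsilon> / 2 then Some (d, s'')
       else iapg_loop orc \<psi> \<phi> tick Lmin \<mu> \<epsilon> \<gamma>u \<gamma>d (k + 1) (A + a) d \<pi>' E' (max Lmin (L' / \<gamma>d)) s''
     }"

definition iapg ::
  "(nat \<Rightarrow> real) \<Rightarrow> 'v::real_inner gradient_routine \<Rightarrow> ('v \<Rightarrow> real) \<Rightarrow> ('v \<Rightarrow> ereal) \<Rightarrow> (calls \<Rightarrow> calls) \<Rightarrow>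
   'v \<Rightarrow> real \<Rightarrow> real \<Rightarrow> real \<Rightarrow> real \<Rightarrow> real \<Rightarrow> calls \<Rightarrow> ('v \<times> calls) option" where
  "iapg \<Lambda> orc \<psi> \<phi> tick v0 Lmin \<mu> \<epsilon> \<gamma>u \<gamma>d s =
     iapg_loop orc \<psi> \<phi> tick Lmin \<mu> \<epsilon> \<gamma>u \<gamma>d 0 0 v0 v0 (\<lambda>w. ereal (1 / 2 * (norm (w - v0))\<^sup>2))
       (\<Lambda> (n_iapg s) * Lmin) (s\<lparr>n_iapg := n_iapg s + 1\<rparr>)"


section \<open>The adaptive inexact proximal augmented Lagrangian method\<close>

record ('x, 'y, 'c, 'p) params =
  Llow :: real
  gamma_u :: real
  gamma_d :: real
  x_init :: 'x
  y_init :: 'y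
  u_init :: 'p
  z_init :: 'c
  beta_y :: real
  beta_x0 :: real
  rho0 :: real
  eta0 :: real
  tau :: real
  sigma :: real

definition admissible ::
  "(real^'n, real^'m, real^'q, real^'r) minimax \<Rightarrow> (real^'n, real^'m, real^'q, real^'r) params \<Rightarrow> bool" where
  "admissible P par \<longleftrightarrow>
     Llow par > 0 \<and> gamma_u par > 1 \<and> gamma_d par > 1 \<and>
     x_init par \<in> edom (gfun P) \<and> y_init par \<in> edom (hfun P) \<and>
     (\<forall>i. 0 \<le> u_init par $ i) \<and> (\<forall>i. 0 \<le> z_init par $ i) \<and>
     beta_y par > 0 \<and> beta_x0 par > 0 \<and> rho0 par > 0 \<and> eta0 par > 0 \<and>
     tau par > sigma par \<and> sigma par > 1"

definition M_p :: "(real^'n, real^'m, real^'q, real^'r) minimax \<Rightarrow> real" where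
  "M_p P = (SUP y\<in>edom (hfun P). onorm ((*v) (Jac (pfun P) y)))"

definition Q_fun ::
  "(real^'n, real^'m, real^'q, real^'r) minimax \<Rightarrow> real \<Rightarrow> real^'n \<Rightarrow> real^'m \<Rightarrow> real^'r \<Rightarrow> ereal" where
  "Q_fun P \<beta>y x y u = ereal (Ffun P (x, y)) - hfun P y -
     ereal (1 / (2 * \<beta>y) * ((norm (pos (\<beta>y *\<^sub>R pfun P y + u)))\<^sup>2 - (norm u)\<^sup>2))"

definition Psi ::
  "(real^'n, real^'m, real^'q, real^'r) minimax \<Rightarrow> real \<Rightarrow> real^'n \<Rightarrow> real^'r \<Rightarrow> real" where
  "Psi P \<beta>y x u = real_of_ereal (SUP y. Q_fun P \<beta>y x y u)"

definition psi_xu ::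
  "(real^'n, real^'m, real^'q, real^'r) minimax \<Rightarrow> real \<Rightarrow> real \<Rightarrow> real^'q \<Rightarrow> (real^'n) \<times> (real^'r) \<Rightarrow> real" where
  "psi_xu P \<beta>y \<beta>x z = (\<lambda>(x, u). Psi P \<beta>y x u + 1 / (2 * \<beta>x) * (norm (pos (\<beta>x *\<^sub>R cfun P x + z)))\<^sup>2)"

definition phi_xu ::
  "(real^'n, real^'m, real^'q, real^'r) minimax \<Rightarrow> real \<Rightarrow> real^'n \<Rightarrow> real^'r \<Rightarrow> (real^'n) \<times> (real^'r) \<Rightarrow> ereal" where
  "phi_xu P \<rho> xt ut = (\<lambda>(x, u). gfun P x + ereal (\<rho> / 2 * ((norm (x - xt))\<^sup>2 + (norm (u - ut))\<^sup>2)))"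

definition psi_y ::
  "(real^'n, real^'m, real^'q, real^'r) minimax \<Rightarrow> real \<Rightarrow> real \<Rightarrow> real^'n \<Rightarrow> real^'r \<Rightarrow> real^'m \<Rightarrow> real" where
  "psi_y P \<beta>y \<mu> x u y = - Ffun P (x, y) + 1 / (2 * \<beta>y) * (norm (pos (\<beta>y *\<^sub>R pfun P y + u)))\<^sup>2
     - \<mu> / 2 * (norm y)\<^sup>2"

definition phi_y ::
  "(real^'n, real^'m, real^'q, real^'r) minimax \<Rightarrow> real \<Rightarrow> real^'m \<Rightarrow> ereal" where
  "phi_y P \<mu> y = ereal (\<mu> / 2 * (norm y)\<^sup>2) + hfun P y"

text \<open>Approximate minimisation of \<open>-Q(x, \<cdot>, u)\<close> by exact iAPG; used both inside the approximate gradient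
  of the \<open>(x, u)\<close>-step and for the \<open>y\<close>-step. A gradient of \<open>psi_y\<close> takes one call to \<open>\<nabla>\<^sub>yF\<close> and
  one to \<open>J\<^sub>p\<close>.\<close>

definition solve_y ::
  "(nat \<Rightarrow> real) \<Rightarrow> (real^'n, real^'m, real^'q, real^'r) minimax \<Rightarrow> (real^'n, real^'m, real^'q, real^'r) params \<Rightarrow>
   real \<Rightarrow> real^'m \<Rightarrow> real^'n \<Rightarrow> real^'r \<Rightarrow> real \<Rightarrow> calls \<Rightarrow> ((real^'m) \<times> calls) option" where
  "solve_y \<Lambda> P par \<mu> yt x u tol s =
     iapg \<Lambda> (exact_gradient (psi_y P (beta_y par) \<mu> x u) tick_y)
       (psi_y P (beta_y par) \<mu> x u) (phi_y P \<mu>) tick_h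
       yt (Llow par) \<mu> tol (gamma_u par) (gamma_d par) s"

text \<open>\<open>\<mu>\<close> is the strong concavity modulus of \<open>F(x, \<cdot>)\<close> and \<open>LF\<close> the Lipschitz constant \<open>L\<^sub>F\<close>
  entering the inner tolerance. For the perturbed problem one may use either the constant of
  \<open>\<nabla>F\<close> or \<open>L\<^sub>F + \<nu>\<close>, which is one for the gradient of the perturbed function; hence \<open>LF\<close> is
  a parameter of its own.\<close>

definition approx_gradient_xu ::
  "(nat \<Rightarrow> real) \<Rightarrow> (real^'n, real^'m, real^'q, real^'r) minimax \<Rightarrow> (real^'n, real^'m, real^'q, real^'r) params \<Rightarrow>
   real \<Rightarrow> real \<Rightarrow> real \<Rightarrow> real^'q \<Rightarrow> real^'m \<Rightarrow> ((real^'n) \<times> (real^'r)) gradient_routine" where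
  "approx_gradient_xu \<Lambda> P par \<mu> LF \<beta>x zt yt = (\<lambda>(x, u) \<omega> s. do {
     (y, s') \<leftarrow> solve_y \<Lambda> P par \<mu> yt x u (\<omega> * \<mu> / (LF + M_p P)) s;
     Some ((gradx P x y + transpose (Jac (cfun P) x) *v pos (\<beta>x *\<^sub>R cfun P x + zt),
            (1 / beta_y par) *\<^sub>R (u - pos (beta_y par *\<^sub>R pfun P y + u))), tick_x s')
   })"

text \<open>The stopping test evaluates \<open>\<nabla>\<^sub>xF\<close>, \<open>J\<^sub>c\<close>, \<open>\<nabla>\<^sub>yF\<close> and \<open>J\<^sub>p\<close> once each.\<close>

partial_function (option) alg_loop ::
  "(nat \<Rightarrow> real) \<Rightarrow> (real^'n, real^'m, real^'q, real^'r) minimax \<Rightarrow> (real^'n, real^'m, real^'q, real^'r) params \<Rightarrow>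
   real \<Rightarrow> real \<Rightarrow> real \<Rightarrow>
   nat \<Rightarrow> real^'n \<Rightarrow> real^'m \<Rightarrow> real^'q \<Rightarrow> real^'r \<Rightarrow> calls \<Rightarrow>
   (((real^'n) \<times> (real^'m) \<times> (real^'q) \<times> (real^'r)) \<times> calls) option" where
  "alg_loop \<Lambda> P par \<mu> LF \<epsilon> t x y z u s =
     (let \<beta>x = beta_x0 par * sigma par ^ t; \<rho> = rho0 par / sigma par ^ t; \<eta> = eta0 par / tau par ^ t
      in do {
        ((x', u'), s1) \<leftarrow> iapg \<Lambda> (approx_gradient_xu \<Lambda> P par \<mu> LF \<beta>x z y)
           (psi_xu P (beta_y par) \<beta>x z) (phi_xu P \<rho> x u) tick_g
           (x, u) (Llow par * sigma par ^ t) \<rho> \<eta> (gamma_u par) (gamma_d par) s;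
        (y', s2) \<leftarrow> solve_y \<Lambda> P par \<mu> y x' u' (min \<epsilon> \<eta> * \<mu>) s1;
        let z' = pos (\<beta>x *\<^sub>R cfun P x' + z);
        let u'' = pos (beta_y par *\<^sub>R pfun P y' + u');
        let s3 = tick_x (tick_y s2);
        if eps_KKT_mult \<epsilon> P x' y' z' u'' then Some ((x', y', z', u''), s3)
        else alg_loop \<Lambda> P par \<mu> LF \<epsilon> (t + 1) x' y' z' u' s3
      })"

definition algorithm_A ::
  "(nat \<Rightarrow> real) \<Rightarrow> (real^'n, real^'m, real^'q, real^'r) minimax \<Rightarrow> (real^'n, real^'m, real^'q, real^'r) params \<Rightarrow>
   real \<Rightarrow> real \<Rightarrow> real \<Rightarrow>
   (((real^'n) \<times> (real^'m) \<times> (real^'q) \<times> (real^'r)) \<times> calls) option" where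
  "algorithm_A \<Lambda> P par \<mu> LF \<epsilon> =
     alg_loop \<Lambda> P par \<mu> LF \<epsilon> 0 (x_init par) (y_init par) (z_init par) (u_init par) no_calls"

end

theory Submission
  imports Defs
begin

text \<open>
  Subtracting \<open>\<nu>/2 |y - y\<^sup>0|\<^sup>2\<close> from \<open>F\<close> changes \<open>\<nabla>\<^sub>yF\<close> on the domain of \<open>h\<close> by at most \<open>\<nu> D\<^sub>y = \<epsilon>/2\<close>, so an
  \<open>\<epsilon>/2\<close>-KKT point of the perturbed problem is an \<open>\<epsilon>\<close>-KKT point of the original one
  (\<open>eps_KKT_unperturbed\<close>). What remains is to show that the algorithm reaches its stopping test, and
  at which cost.

  The outer loop is a proximal augmented Lagrangian method. Its iterates are not compared with a
  saddle point, whose existence would need a minimax theorem; Slater's condition bounds them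
  directly. The new multiplier \<open>z' = [\<beta>c(x') + z]\<^sub>+\<close> satisfies
  \<open>z' \<bullet> c(x') = z' \<bullet> (z' - z)/\<beta> \<ge> (|z'|\<^sup>2 - |z|\<^sup>2)/(2\<beta>)\<close>, while stationarity of \<open>x'\<close>, tested against the
  Slater point, gives \<open>\<delta> |z'| + z' \<bullet> c(x') \<le> const\<close>; so \<open>|z'|\<close> exceeds \<open>|z|\<close> only as long as it is at
  most \<open>const/\<delta>\<close> (\<open>z_bound\<close>). The same argument bounds the \<open>u\<close>-part of the exact minimiser of the
  \<open>(x, u)\<close>-problem (\<open>exact_u_bound\<close>), and the computed \<open>u\<close> is within \<open>\<eta>\<^sub>t/\<rho>\<^sub>t\<close> of it, which is summable
  because \<open>\<tau> > \<sigma>\<close>. Once all iterates are bounded, every KKT residual is a combination of \<open>\<rho>\<^sub>t\<close>,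
  \<open>1/\<beta>\<^sub>x\<^sub>,\<^sub>t\<close> and \<open>\<eta>\<^sub>t\<close> and hence \<open>O(\<sigma>\<^sup>-\<^sup>t)\<close> (\<open>kkt_residual\<close>), so that \<open>O(log (1/\<epsilon>))\<close> outer iterations suffice.

  A run of iAPG on \<open>\<psi> + \<phi>\<close> is analysed by an estimate sequence in the locale \<open>iapg_problem\<close>; it
  takes \<open>O(sqrt (L/\<mu>) log(...))\<close> iterations when the gradient of \<open>\<psi>\<close> is \<open>1/L\<close>-cocoercive. For the inner
  problem, \<open>L = O(1)\<close> and \<open>\<mu> = \<nu>\<close>, which gives \<open>\<epsilon>\<^sup>-\<^sup>1\<^sup>/\<^sup>2\<close> up to logarithms; for the outer problem,
  \<open>L = O(1/\<nu> + \<beta>\<^sub>x\<^sub>,\<^sub>t) = O(1/\<epsilon>)\<close> and \<open>\<mu> = \<rho>\<^sub>t \<ge> const \<sdot> \<epsilon>\<close>, which gives \<open>\<epsilon>\<^sup>-\<^sup>1\<close>. Their product is the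
  count for \<open>y\<close>, the outer number alone the count for \<open>x\<close>.

  Two features of the outer problem need care. First, \<open>\<Psi>\<close> is a maximum over \<open>y\<close>; instead of its
  differentiability it suffices that it has a Lipschitz selection of subgradients
  (\<open>Psi_above_tangent\<close>, \<open>GPsi_lipschitz\<close>), which is then cocoercive by \<open>cocoercive_of_lipschitz\<close>.
  Second, the smoothness of the inner problem grows with \<open>|u|\<close> and the domain is unbounded in \<open>u\<close>,
  so \<open>u\<close> has to stay bounded during a whole run of iAPG, uniformly in \<open>\<epsilon>\<close>. One step enlarges \<open>|u|\<close> by a
  factor \<open>1 + O(1/L)\<close>, the step sizes satisfy \<open>\<Sum> 1/L \<le> sqrt (2A/L\<^sub>m\<^sub>i\<^sub>n)\<close>, and as soon as \<open>\<mu>A > 1\<close> the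
  potential itself controls the iterates; so the total factor is \<open>exp (O(1/sqrt (\<mu> L\<^sub>m\<^sub>i\<^sub>n)))\<close>. The product
  \<open>\<mu> L\<^sub>m\<^sub>i\<^sub>n\<close> is constant exactly because the algorithm scales \<open>L\<^sub>m\<^sub>i\<^sub>n\<close> by \<open>\<sigma>\<^sup>t\<close> and \<open>\<rho>\<close> by \<open>\<sigma>\<^sup>-\<^sup>t\<close>.
\<close>

section \<open>Strongly convex functions\<close>

text \<open>The modulus \<open>m = 0\<close> is allowed, so that convex and affine parts can be added with
  \<open>strongly_convex_on_add\<close>.\<close>

definition strongly_convex_on :: "'a::real_inner set \<Rightarrow> real \<Rightarrow> ('a \<Rightarrow> real) \<Rightarrow> bool" where
  "strongly_convex_on D m f \<longleftrightarrow> convex D \<and>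
     (\<forall>x\<in>D. \<forall>y\<in>D. \<forall>t. 0 \<le> t \<and> t \<le> 1 \<longrightarrow>
        f ((1 - t) *\<^sub>R x + t *\<^sub>R y) \<le> (1 - t) * f x + t * f y - m / 2 * (t * (1 - t)) * (norm (x - y))\<^sup>2)"

lemma strongly_convex_onD:
  "strongly_convex_on D m f \<Longrightarrow> x \<in> D \<Longrightarrow> y \<in> D \<Longrightarrow> 0 \<le> t \<Longrightarrow> t \<le> 1 \<Longrightarrow>
   f ((1 - t) *\<^sub>R x + t *\<^sub>R y) \<le> (1 - t) * f x + t * f y - m / 2 * (t * (1 - t)) * (norm (x - y))\<^sup>2"
  unfolding strongly_convex_on_def by blast

lemma strongly_convex_on_convex: "strongly_convex_on D m f \<Longrightarrow> convex D"
  unfolding strongly_convex_on_def by blast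

lemma convex_on_imp_strongly_convex_on:
  assumes "convex_on D f"
  shows "strongly_convex_on D 0 f"
  using assms convex_onD[OF assms] unfolding strongly_convex_on_def
  by (auto simp: convex_on_def)

lemma strongly_convex_on_add:
  assumes "strongly_convex_on D m f" "strongly_convex_on D k g"
  shows "strongly_convex_on D (m + k) (\<lambda>v. f v + g v)"
  unfolding strongly_convex_on_def
proof (intro conjI ballI allI impI)
  show "convex D" using assms(1) by (rule strongly_convex_on_convex)
next
  fix x y and t :: real assume H: "x \<in> D" "y \<in> D" "0 \<le> t \<and> t \<le> 1"
  show "f ((1 - t) *\<^sub>R x + t *\<^sub>R y) + g ((1 - t) *\<^sub>R x + t *\<^sub>R y)
      \<le> (1 - t) * (f x + g x) + t * (f y + g y) - (m + k) / 2 * (t * (1 - t)) * (norm (x - y))\<^sup>2"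
    using strongly_convex_onD[OF assms(1) H(1,2), of t] strongly_convex_onD[OF assms(2) H(1,2), of t] H
    by (simp add: algebra_simps add_divide_distrib)
qed

lemma strongly_convex_on_cmult:
  assumes "strongly_convex_on D m f" "0 \<le> c"
  shows "strongly_convex_on D (c * m) (\<lambda>v. c * f v)"
  unfolding strongly_convex_on_def
proof (intro conjI ballI allI impI)
  show "convex D" using assms(1) by (rule strongly_convex_on_convex)
next
  fix x y and t :: real assume H: "x \<in> D" "y \<in> D" "0 \<le> t \<and> t \<le> 1"
  have "c * f ((1 - t) *\<^sub>R x + t *\<^sub>R y)
      \<le> c * ((1 - t) * f x + t * f y - m / 2 * (t * (1 - t)) * (norm (x - y))\<^sup>2)"
    using strongly_convex_onD[OF assms(1) H(1,2), of t] H assms(2) by (intro mult_left_mono) auto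
  then show "c * f ((1 - t) *\<^sub>R x + t *\<^sub>R y)
      \<le> (1 - t) * (c * f x) + t * (c * f y) - c * m / 2 * (t * (1 - t)) * (norm (x - y))\<^sup>2"
    by (simp add: algebra_simps)
qed

lemma norm_sq_convex_combination:
  fixes x y a :: "'a::real_inner"
  shows "(norm ((1 - t) *\<^sub>R x + t *\<^sub>R y - a))\<^sup>2
    = (1 - t) * (norm (x - a))\<^sup>2 + t * (norm (y - a))\<^sup>2 - t * (1 - t) * (norm (x - y))\<^sup>2"
  unfolding power2_norm_eq_inner
  by (simp add: inner_diff_left inner_diff_right inner_add_left inner_add_right inner_commute algebra_simps)

lemma strongly_convex_on_quadratic:
  "convex D \<Longrightarrow> strongly_convex_on D m (\<lambda>v. m / 2 * (norm (v - a))\<^sup>2)"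
  unfolding strongly_convex_on_def norm_sq_convex_combination
  by (auto simp: algebra_simps add_divide_distrib diff_divide_distrib)

lemma strongly_convex_on_affine:
  "convex D \<Longrightarrow> strongly_convex_on D 0 (\<lambda>v. k + s \<bullet> (v - a))"
  unfolding strongly_convex_on_def
  by (auto simp: inner_diff_right inner_add_right algebra_simps)

text \<open>Compare the value at the minimiser \<open>d\<close> with the value at \<open>(1 - t) d + t w\<close>, divide by \<open>t\<close>, and let
  \<open>t\<close> tend to \<open>0\<close>.\<close>

lemma strongly_convex_on_minimum_growth:
  assumes f: "strongly_convex_on D m f" and d: "d \<in> D" "\<And>w. w \<in> D \<Longrightarrow> f d \<le> f w" and w: "w \<in> D"
  shows "f d + m / 2 * (norm (w - d))\<^sup>2 \<le> f w"
proof -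
  have *: "m / 2 * (1 - t) * (norm (w - d))\<^sup>2 \<le> f w - f d" if t: "0 < t" "t < 1" for t
  proof -
    have "(1 - t) *\<^sub>R d + t *\<^sub>R w \<in> D"
      using strongly_convex_on_convex[OF f] d(1) w t by (simp add: convex_def)
    then have "f d \<le> f ((1 - t) *\<^sub>R d + t *\<^sub>R w)" by (rule d(2))
    also have "\<dots> \<le> (1 - t) * f d + t * f w - m / 2 * (t * (1 - t)) * (norm (d - w))\<^sup>2"
      using strongly_convex_onD[OF f d(1) w] t by simp
    finally have "t * (m / 2 * (1 - t) * (norm (w - d))\<^sup>2) \<le> t * (f w - f d)"
      by (simp add: algebra_simps norm_minus_commute)
    then show ?thesis using t by simp
  qed
  have "((\<lambda>t. m / 2 * (1 - t) * (norm (w - d))\<^sup>2) \<longlongrightarrow> m / 2 * (1 - 0) * (norm (w - d))\<^sup>2) (at_right 0)"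
    by (intro tendsto_intros)
  moreover have "\<forall>\<^sub>F t in at_right 0. m / 2 * (1 - t) * (norm (w - d))\<^sup>2 \<le> f w - f d"
    by (rule eventually_mono[OF eventually_at_right_real[OF zero_less_one]]) (rule *, auto)
  ultimately have "m / 2 * (1 - 0) * (norm (w - d))\<^sup>2 \<le> f w - f d"
    by (intro tendsto_upperbound) auto
  then show ?thesis by simp
qed

text \<open>Strong convexity makes \<open>f\<close> coercive: a lower bound of \<open>f\<close> on the unit ball around a point \<open>v0\<close>
  propagates along rays to \<open>f w \<ge> f v0\<close> outside a ball of radius \<open>R\<close>.\<close>

lemma strongly_convex_on_attains_min:
  fixes f :: "'a::euclidean_space \<Rightarrow> real"
  assumes f: "strongly_convex_on D m f" and m: "0 < m"
    and D: "closed D" "D \<noteq> {}" and cont: "continuous_on D f"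
  obtains d where "d \<in> D" "\<And>w. w \<in> D \<Longrightarrow> f d \<le> f w"
proof -
  obtain v0 where v0: "v0 \<in> D" using D(2) by blast
  have compact: "compact (D \<inter> cball v0 r)" for r
    using D(1) by (simp add: closed_Int_compact)
  have attains: "\<exists>d\<in>D \<inter> cball v0 r. \<forall>w\<in>D \<inter> cball v0 r. f d \<le> f w" if "0 \<le> r" for r
    using that v0 compact
    by (intro continuous_attains_inf continuous_on_subset[OF cont]) auto
  obtain q where q: "q \<in> D \<inter> cball v0 1" "\<forall>w\<in>D \<inter> cball v0 1. f q \<le> f w"
    using attains[of 1] by auto
  define R where "R = 1 + 2 * (f v0 - f q) / m"
  have R: "1 \<le> R" using q v0 m by (simp add: R_def)
  obtain d where d: "d \<in> D \<inter> cball v0 R" "\<forall>w\<in>D \<inter> cball v0 R. f d \<le> f w"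
    using attains[of R] R by auto
  have "f d \<le> f w" if w: "w \<in> D" for w
  proof (cases "norm (w - v0) \<le> R")
    case True
    then show ?thesis using d w by (auto simp: dist_norm norm_minus_commute)
  next
    case False
    define r where "r = norm (w - v0)"
    have r: "R < r" "1 < r" using False R by (auto simp: r_def)
    define p where "p = (1 - 1 / r) *\<^sub>R v0 + (1 / r) *\<^sub>R w"
    have "p \<in> D"
      using strongly_convex_on_convex[OF f] v0 w r unfolding p_def by (intro convexD) auto
    moreover have "p - v0 = (1 / r) *\<^sub>R (w - v0)" by (simp add: p_def algebra_simps)
    then have "norm (p - v0) = 1" using r by (simp add: r_def[symmetric])
    ultimately have "f q \<le> f p" using q by (simp add: dist_norm norm_minus_commute)
    also have "f p \<le> (1 - 1 / r) * f v0 + 1 / r * f w - m / 2 * (1 / r * (1 - 1 / r)) * (norm (v0 - w))\<^sup>2"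
      unfolding p_def by (rule strongly_convex_onD[OF f v0 w]) (use r in auto)
    also have "m / 2 * (1 / r * (1 - 1 / r)) * (norm (v0 - w))\<^sup>2 = m / 2 * (r - 1)"
      using r by (simp add: norm_minus_commute[of v0 w] r_def[symmetric] power2_eq_square field_simps)
    finally have "r * f q \<le> r * ((1 - 1 / r) * f v0 + 1 / r * f w - m / 2 * (r - 1))"
      using r by (intro mult_left_mono) auto
    also have "\<dots> = (r - 1) * f v0 + f w - r * (m / 2 * (r - 1))"
      using r by (simp add: field_simps)
    finally have "r * (m / 2 * (r - 1) - (f v0 - f q)) + f v0 \<le> f w" by (simp add: algebra_simps)
    moreover have "f v0 - f q \<le> m / 2 * (r - 1)"
      using r m by (simp add: R_def field_simps)
    ultimately have "f v0 \<le> f w" using r by (smt (verit) mult_nonneg_nonneg)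
    moreover have "f d \<le> f v0" using d v0 R by simp
    ultimately show ?thesis by linarith
  qed
  then show ?thesis using d that by blast
qed

text \<open>Transfers the \<open>arg_min\<close> of the algorithms, which is taken over extended-real functions and is
  meaningful only if a minimiser exists, to a real function on its domain.\<close>

lemma arg_min_ereal:
  assumes E: "\<And>w. w \<in> D \<Longrightarrow> E w = ereal (q w)" "\<And>w. w \<notin> D \<Longrightarrow> E w = \<infinity>"
    and d: "d \<in> D" "\<And>w. w \<in> D \<Longrightarrow> q d \<le> q w"
  shows "arg_min E (\<lambda>_. True) \<in> D" and "w \<in> D \<Longrightarrow> q (arg_min E (\<lambda>_. True)) \<le> q w"
proof -
  let ?a = "arg_min E (\<lambda>_. True)"
  have "is_arg_min E (\<lambda>_. True) d"
    unfolding is_arg_min_linorder using E d by (metis ereal_less_eq(1,3))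
  then have "is_arg_min E (\<lambda>_. True) ?a" unfolding arg_min_def by (rule someI)
  then have min: "E ?a \<le> E w" for w unfolding is_arg_min_linorder by blast
  show a: "?a \<in> D"
    using min[of d] E d(1) by force
  show "q ?a \<le> q w" if "w \<in> D" using min[of w] E(1) a that by simp
qed

text \<open>Adding the quadratic raises the modulus of growth at the minimiser to \<open>L + m\<close>; expanding the
  quadratic around \<open>d\<close> cancels the part \<open>L\<close> and leaves a subgradient inequality that retains \<open>m\<close>.\<close>

lemma proximal_subgradient:
  fixes f :: "'a::euclidean_space \<Rightarrow> real"
  assumes f: "strongly_convex_on D m f" and L: "0 < L"
    and d: "d \<in> D" "\<And>w. w \<in> D \<Longrightarrow> L / 2 * (norm (d - a))\<^sup>2 + f d \<le> L / 2 * (norm (w - a))\<^sup>2 + f w"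
    and w: "w \<in> D"
  shows "f d + (L *\<^sub>R (a - d)) \<bullet> (w - d) + m / 2 * (norm (w - d))\<^sup>2 \<le> f w"
proof -
  have "strongly_convex_on D (L + m) (\<lambda>v. L / 2 * (norm (v - a))\<^sup>2 + f v)"
    by (intro strongly_convex_on_add strongly_convex_on_quadratic strongly_convex_on_convex[OF f] f)
  from strongly_convex_on_minimum_growth[OF this d w]
  have "L / 2 * (norm (d - a))\<^sup>2 + f d + (L + m) / 2 * (norm (w - d))\<^sup>2 \<le> L / 2 * (norm (w - a))\<^sup>2 + f w" .
  moreover have "(norm (w - a))\<^sup>2 = (norm (w - d))\<^sup>2 - 2 * ((a - d) \<bullet> (w - d)) + (norm (d - a))\<^sup>2"
    unfolding power2_norm_eq_inner
    by (simp add: inner_diff_left inner_diff_right inner_commute algebra_simps)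
  ultimately show ?thesis by (simp add: algebra_simps add_divide_distrib)
qed

lemma prox_subgradient:
  fixes f :: "'a::euclidean_space \<Rightarrow> real" and a :: "'a"
  assumes f: "strongly_convex_on D m f" "continuous_on D f" and D: "closed D" "D \<noteq> {}"
    and m: "0 \<le> m" and L: "0 < L"
    and \<phi>: "\<And>v. \<phi> v = (if v \<in> D then ereal (f v) else \<infinity>)"
  defines "d \<equiv> prox (1 / L) \<phi> a"
  shows "d \<in> D"
    and "w \<in> D \<Longrightarrow> f d + (L *\<^sub>R (a - d)) \<bullet> (w - d) + m / 2 * (norm (w - d))\<^sup>2 \<le> f w"
proof -
  let ?q = "\<lambda>v. L / 2 * (norm (v - a))\<^sup>2 + f v"
  let ?E = "\<lambda>v. ereal (1 / (2 * (1 / L)) * (norm (v - a))\<^sup>2) + \<phi> v"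
  have sc: "strongly_convex_on D (L + m) ?q"
    by (intro strongly_convex_on_add strongly_convex_on_quadratic strongly_convex_on_convex[OF f(1)] f)
  have "continuous_on D ?q" using f(2) by (intro continuous_intros) auto
  then obtain d0 where d0: "d0 \<in> D" "\<And>w. w \<in> D \<Longrightarrow> ?q d0 \<le> ?q w"
    using strongly_convex_on_attains_min[OF sc _ D] m L by auto
  have E: "\<And>w. w \<in> D \<Longrightarrow> ?E w = ereal (?q w)" "\<And>w. w \<notin> D \<Longrightarrow> ?E w = \<infinity>"
    using \<phi> by auto
  have d_eq: "d = arg_min ?E (\<lambda>_. True)" by (simp add: d_def prox_def)
  show d: "d \<in> D" unfolding d_eq by (rule arg_min_ereal(1)[where E = ?E and q = ?q, OF E d0])
  have "?q d \<le> ?q w" if "w \<in> D" for w unfolding d_eq by (rule arg_min_ereal(2)[where E = ?E and q = ?q, OF E d0 that])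
  from proximal_subgradient[OF f(1) L d this]
  show "w \<in> D \<Longrightarrow> f d + (L *\<^sub>R (a - d)) \<bullet> (w - d) + m / 2 * (norm (w - d))\<^sup>2 \<le> f w" by blast
qed

section \<open>The accelerated proximal gradient method\<close>

text \<open>The coefficient \<open>a\<close> of a line-search trial, written as there.\<close>

definition momentum :: "real \<Rightarrow> real \<Rightarrow> real \<Rightarrow> real" where
  "momentum \<mu> L A = (THE a. 0 < a \<and> a\<^sup>2 / (A + a) = 2 * (1 + \<mu> * A) / L)"

lemma momentum:
  assumes "0 \<le> A" "0 < \<mu>" "0 < L"
  shows "0 < momentum \<mu> L A" and "(momentum \<mu> L A)\<^sup>2 = (A + momentum \<mu> L A) * (2 * (1 + \<mu> * A) / L)"
proof -
  define c where "c = 2 * (1 + \<mu> * A) / L"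
  have c: "0 < c" using assms by (simp add: c_def add_pos_nonneg)
  have eq: "a\<^sup>2 / (A + a) = c \<longleftrightarrow> a\<^sup>2 = (A + a) * c" if "0 < a" for a
    using that assms by (simp add: field_simps)
  let ?r = "(c + sqrt (c\<^sup>2 + 4 * c * A)) / 2"
  have sq: "(sqrt (c\<^sup>2 + 4 * c * A))\<^sup>2 = c\<^sup>2 + 4 * c * A" using c assms by simp
  have r: "0 < ?r" using c by (smt (verit) assms(1) mult_nonneg_nonneg real_sqrt_ge_zero zero_le_power2 divide_pos_pos)
  have "?r\<^sup>2 = (A + ?r) * c"
    using sq by (simp add: power2_eq_square field_simps)
  with r have ex: "0 < ?r \<and> ?r\<^sup>2 / (A + ?r) = c" using eq by blast
  have uniq: "a = b" if "0 < a \<and> a\<^sup>2 / (A + a) = c" "0 < b \<and> b\<^sup>2 / (A + b) = c" for a b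
  proof -
    have ab: "a\<^sup>2 = (A + a) * c" "b\<^sup>2 = (A + b) * c" "0 < a" "0 < b" using that eq by auto
    have "c \<le> a" using ab(1,3) c assms(1) by (simp add: power2_eq_square distrib_right)
        (smt (verit, best) mult_le_cancel_left_pos mult.commute mult_nonneg_nonneg)
    moreover have "(a - b) * (a + b - c) = 0" using ab by (simp add: power2_eq_square algebra_simps)
    ultimately show ?thesis using ab by auto
  qed
  have "0 < momentum \<mu> L A \<and> (momentum \<mu> L A)\<^sup>2 / (A + momentum \<mu> L A) = c"
    unfolding momentum_def c_def[symmetric] by (rule theI[of _ ?r]) (use ex uniq in blast)+
  then show "0 < momentum \<mu> L A" "(momentum \<mu> L A)\<^sup>2 = (A + momentum \<mu> L A) * (2 * (1 + \<mu> * A) / L)"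
    using eq unfolding c_def by auto
qed

text \<open>Keeps \<open>A\<close>, and with it the requested gradient accuracies, polynomially bounded.\<close>

lemma quadratic_step_bound:
  fixes a A c :: real
  assumes "0 < a" "0 \<le> A" "a\<^sup>2 = (A + a) * c" "0 \<le> c"
  shows "a \<le> A + 2 * c"
proof (rule ccontr)
  assume "\<not> a \<le> A + 2 * c"
  then have "A + a < 2 * a" "2 * c < a" using assms by auto
  then have "(A + a) * (2 * c) \<le> (A + a) * a" using assms by (intro mult_left_mono) auto
  moreover have "(A + a) * a < 2 * a * a" using \<open>A + a < 2 * a\<close> assms by simp
  ultimately have "(A + a) * c < a\<^sup>2" by (simp add: power2_eq_square)
  with assms show False by simp
qed

text \<open>Here \<open>\<Delta>\<close> is a difference of gradients at points that differ by \<open>e\<close>, and \<open>\<Delta>'\<close> its approximation.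
  Without errors, the acceptance test is equivalent to \<open>|\<Delta>|\<^sup>2 \<le> L (\<Delta> \<bullet> e)\<close>; the two slack terms absorb
  an error of size \<open>2\<omega>\<close>, because \<open>|\<Delta>| \<le> L |e|\<close>.\<close>

lemma acceptance:
  fixes G g :: "'v::real_inner"
  assumes coco: "(norm \<Delta>)\<^sup>2 \<le> Lbar * (\<Delta> \<bullet> e)" and L: "Lbar \<le> L" "0 < Lbar"
    and err: "norm (\<Delta>' - \<Delta>) \<le> 2 * \<omega>"
  shows "(\<Delta>' - L *\<^sub>R e) \<bullet> (- e) \<ge> 1 / L * (norm (\<Delta>' - L *\<^sub>R e))\<^sup>2 - 6 * \<omega> * norm e - 4 * \<omega>\<^sup>2 / L"
proof -
  have Lp: "0 < L" using L by simp
  have \<omega>: "0 \<le> \<omega>" using err norm_ge_zero[of "\<Delta>' - \<Delta>"] by linarith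
  define \<delta> where "\<delta> = \<Delta>' - \<Delta>"
  have \<Delta>': "\<Delta>' = \<Delta> + \<delta>" by (simp add: \<delta>_def)
  have pos: "0 \<le> \<Delta> \<bullet> e" using coco L(2) by (smt (verit) zero_le_power2 mult_less_0_iff zero_less_mult_pos)
  have coco': "(norm \<Delta>)\<^sup>2 \<le> L * (\<Delta> \<bullet> e)"
    using coco mult_right_mono[OF L(1) pos] by linarith
  have n: "norm \<Delta> \<le> L * norm e"
  proof -
    have "norm \<Delta> * norm \<Delta> \<le> L * (norm \<Delta> * norm e)"
      using coco' mult_left_mono[OF norm_cauchy_schwarz[of \<Delta> e], of L] Lp
      unfolding power2_eq_square by linarith
    then show ?thesis
      by (cases "norm \<Delta> = 0") (use Lp in \<open>auto simp: mult.left_commute\<close>)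
  qed
  have "(norm \<Delta>')\<^sup>2 = (norm \<Delta>)\<^sup>2 + 2 * (\<Delta> \<bullet> \<delta>) + (norm \<delta>)\<^sup>2"
    unfolding \<Delta>' power2_norm_eq_inner by (simp add: inner_add_left inner_add_right inner_commute)
  also have "\<Delta> \<bullet> \<delta> \<le> (L * norm e) * (2 * \<omega>)"
    using norm_cauchy_schwarz[of \<Delta> \<delta>] mult_mono[OF n err] Lp by (simp add: \<delta>_def)
  also have "(norm \<delta>)\<^sup>2 \<le> (2 * \<omega>)\<^sup>2" using err by (intro power_mono) (auto simp: \<delta>_def)
  finally have "(norm \<Delta>')\<^sup>2 \<le> L * (\<Delta> \<bullet> e) + 4 * L * \<omega> * norm e + 4 * \<omega>\<^sup>2"
    using coco' by (simp add: power2_eq_square algebra_simps)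
  moreover have "- (\<delta> \<bullet> e) \<le> 2 * \<omega> * norm e"
    using norm_cauchy_schwarz[of "-\<delta>" e] mult_right_mono[OF err, of "norm e"] by (simp add: \<delta>_def[symmetric])
  then have "- L * (\<delta> \<bullet> e) \<le> 2 * L * \<omega> * norm e"
    using Lp by (simp add: minus_le_iff mult_left_mono[of _ _ L, simplified] algebra_simps)
      (smt (verit, del_insts) mult_left_mono mult.left_commute mult_minus_right)
  ultimately have main: "(norm \<Delta>')\<^sup>2 \<le> L * (\<Delta>' \<bullet> e) + 6 * L * \<omega> * norm e + 4 * \<omega>\<^sup>2"
    unfolding \<Delta>' by (simp add: inner_add_left algebra_simps)
  have "(norm (\<Delta>' - L *\<^sub>R e))\<^sup>2 = (norm \<Delta>')\<^sup>2 - 2 * L * (\<Delta>' \<bullet> e) + L * (L * (norm e)\<^sup>2)"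
    unfolding power2_norm_eq_inner by (simp add: inner_diff_left inner_diff_right inner_commute)
  also have "\<dots> \<le> L * ((\<Delta>' - L *\<^sub>R e) \<bullet> (- e)) + 6 * L * \<omega> * norm e + 4 * \<omega>\<^sup>2"
    using main by (simp add: inner_diff_left power2_norm_eq_inner algebra_simps)
  finally have "1 / L * (norm (\<Delta>' - L *\<^sub>R e))\<^sup>2
      \<le> 1 / L * (L * ((\<Delta>' - L *\<^sub>R e) \<bullet> (- e)) + 6 * L * \<omega> * norm e + 4 * \<omega>\<^sup>2)"
    using Lp by (intro mult_left_mono) auto
  also have "\<dots> = (\<Delta>' - L *\<^sub>R e) \<bullet> (- e) + 6 * \<omega> * norm e + 4 * \<omega>\<^sup>2 / L"
    using Lp by (simp add: field_simps)
  finally show ?thesis by simp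
qed

text \<open>One run of iAPG. The gradient routine is assumed to be reliable only where \<open>N v + c \<le> Nmax\<close>:
  \<open>N\<close> is a seminorm-like gauge of the unbounded directions (\<open>|u|\<close> for the outer problem, \<open>0\<close> for
  the inner one), \<open>D\<close> being bounded in the other directions (assumption \<open>M\<close>). By \<open>N_grow\<close> a proximal
  step with parameter \<open>L\<close> increases the gauge at most by the factor \<open>1 + C2/L\<close>. The point \<open>vs\<close> is the
  minimiser. The constants \<open>X\<close>, \<open>M\<close> and \<open>R\<close> are interdependent: \<open>R\<close> bounds distances to \<open>vs\<close>, the inexactness
  contributes to it in proportion to the diameter \<open>M\<close> of the region visited, and that region is determined by
  the bound \<open>X\<close> on the gauge, which in turn involves \<open>R\<close>. \<open>Lbar\<close> is the cocoercivity constant, \<open>Lmax\<close> bounds all accepted step parameters, and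
  \<open>K\<close>, \<open>J\<close> are iteration counts for the main loop and the line search. The function \<open>m\<close> is any
  counter of calls, increased by at most \<open>Nc\<close> per gradient and \<open>ct\<close> per proximal step.\<close>

locale iapg_problem =
  fixes \<psi> f :: "'v::euclidean_space \<Rightarrow> real" and \<phi> :: "'v \<Rightarrow> ereal" and G :: "'v \<Rightarrow> 'v" and D :: "'v set"
    and \<mu> \<epsilon> Lmin \<gamma>u \<gamma>d Lbar :: real
    and orc :: "'v gradient_routine" and tick :: "calls \<Rightarrow> calls"
    and N :: "'v \<Rightarrow> real" and c C2 X M :: real
    and vs v0 :: 'v and R Lmax :: real and K J :: nat
    and m :: "calls \<Rightarrow> nat" and Nc ct :: nat
  fixes Xbar Nmax A1 Atop \<omega>low :: real
  defines "Xbar \<equiv> X * exp (C2 * sqrt (2 / (\<mu> * Lmin)))"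
    and "Nmax \<equiv> (1 + C2 / Lmin) * Xbar"
    and "A1 \<equiv> 2 * (14 * R * Lmax / \<epsilon>)\<^sup>2 / \<mu> + 4 * (1 + (14 * R * Lmax / \<epsilon>)\<^sup>2) / Lmin"
    and "Atop \<equiv> 2 * A1 + 4 * (1 + \<mu> * A1) / Lmin"
    and "\<omega>low \<equiv> min (\<epsilon> / 8) (\<mu> * \<epsilon> / ((real K + 2)\<^sup>2 * max 1 Atop))"
  assumes D: "closed D" and v0: "v0 \<in> D" and vs: "vs \<in> D"
    and f: "strongly_convex_on D \<mu> f" "continuous_on D f"
    and \<phi>: "\<And>v. \<phi> v = (if v \<in> D then ereal (f v) else \<infinity>)"
    and subgrad: "\<And>v w. v \<in> D \<Longrightarrow> w \<in> D \<Longrightarrow> \<psi> v + G v \<bullet> (w - v) \<le> \<psi> w"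
    and coco: "\<And>v w. v \<in> D \<Longrightarrow> w \<in> D \<Longrightarrow> (norm (G v - G w))\<^sup>2 \<le> Lbar * ((G v - G w) \<bullet> (v - w))"
    and params: "0 < \<mu>" "0 < \<epsilon>" "0 < Lmin" "1 < \<gamma>u" "1 < \<gamma>d" "0 < Lbar" "0 \<le> c" "0 \<le> C2" "0 < R"
    and N_nonneg: "\<And>v. 0 \<le> N v"
    and N_convex: "\<And>v w t. 0 \<le> t \<Longrightarrow> t \<le> 1 \<Longrightarrow> N ((1 - t) *\<^sub>R v + t *\<^sub>R w) \<le> max (N v) (N w)"
    and N_grow: "\<And>b d g L. b \<in> D \<Longrightarrow> d \<in> D \<Longrightarrow> Lmin \<le> L \<Longrightarrow> norm (g - G b) \<le> \<epsilon> / 8 \<Longrightarrow>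
        (\<And>w. w \<in> D \<Longrightarrow> f d + (L *\<^sub>R (b - d) - g) \<bullet> (w - d) + \<mu> / 2 * (norm (w - d))\<^sup>2 \<le> f w) \<Longrightarrow>
        N d + c \<le> (1 + C2 / L) * (N b + c)"
    and N_vs: "\<And>v. N v \<le> N vs + norm (v - vs)"
    and X: "N v0 + c \<le> X" "N vs + R + c \<le> X"
    and M: "\<And>v w. v \<in> D \<Longrightarrow> w \<in> D \<Longrightarrow> N v + c \<le> Nmax \<Longrightarrow> N w + c \<le> Nmax \<Longrightarrow> norm (v - w) \<le> M"
    and R: "(norm (v0 - vs))\<^sup>2 + 4 * (\<mu> * \<epsilon> * (8 * M + \<epsilon> / (2 * Lmin))) \<le> R\<^sup>2"
    and vs_min: "\<And>w. w \<in> D \<Longrightarrow> \<psi> vs + f vs + \<mu> / 2 * (norm (w - vs))\<^sup>2 \<le> \<psi> w + f w"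
    and Lmax: "\<gamma>u * Lbar \<le> Lmax" "Lmin \<le> Lmax"
    and K: "(14 * R * Lmax / \<epsilon>)\<^sup>2 \<le> 2 * \<mu> / Lmax * (1 + sqrt (2 * \<mu> / Lmax)) ^ K"
    and J: "Lbar \<le> Lmin * \<gamma>u ^ J"
    and orc: "\<And>v \<omega> s. v \<in> D \<Longrightarrow> N v + c \<le> Nmax \<Longrightarrow> \<omega>low \<le> \<omega> \<Longrightarrow>
        \<exists>g s'. orc v \<omega> s = Some (g, s') \<and> norm (g - G v) \<le> \<omega> \<and> m s' \<le> m s + Nc"
    and tick: "\<And>s. m (tick s) \<le> m s + ct"
begin

text \<open>What the analysis needs to know about an accepted line-search step; \<open>b\<close> is the extrapolated point
  and \<open>\<xi> - gd\<close> the subgradient of \<open>f\<close> at \<open>d\<close> supplied by the proximal step.\<close>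

definition good_step :: "nat \<Rightarrow> real \<Rightarrow> 'v \<Rightarrow> 'v \<Rightarrow> real \<Rightarrow> real \<Rightarrow> 'v \<Rightarrow> 'v \<Rightarrow> 'v \<Rightarrow> bool" where
  "good_step k A v \<pi> L a d gd \<xi> \<longleftrightarrow>
     0 < a \<and> a\<^sup>2 = (A + a) * (2 * (1 + \<mu> * A) / L) \<and> d \<in> D \<and>
     (\<forall>w\<in>D. f d + (\<xi> - gd) \<bullet> (w - d) + \<mu> / 2 * (norm (w - d))\<^sup>2 \<le> f w) \<and>
     (\<exists>b \<omega>. b = (1 / (A + a)) *\<^sub>R (A *\<^sub>R v + a *\<^sub>R \<pi>) \<and> b \<in> D \<and> N b \<le> max (N v) (N \<pi>) \<and>
        0 \<le> \<omega> \<and> \<omega> \<le> \<epsilon> / 8 \<and> (A + a) * \<omega> \<le> \<mu> * \<epsilon> / (real k + 1)\<^sup>2 \<and>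
        N d + c \<le> (1 + C2 / L) * (N b + c) \<and> norm (gd - G d) \<le> \<omega> \<and>
        \<xi> \<bullet> (b - d) \<ge> 1 / L * (norm \<xi>)\<^sup>2 - 6 * \<omega> * norm (b - d) - 4 * \<omega>\<^sup>2 / L)"

lemma X_le_Xbar: "0 \<le> X" "X \<le> Xbar" "Xbar \<le> Nmax" "0 \<le> Xbar"
proof -
  show X0: "0 \<le> X" using X(1) N_nonneg[of v0] params by linarith
  have "1 \<le> exp (C2 * sqrt (2 / (\<mu> * Lmin)))" using params by simp
  from mult_left_mono[OF this X0] show XX: "X \<le> Xbar" by (simp add: Xbar_def)
  then show X1: "0 \<le> Xbar" using X0 by simp
  have "1 \<le> 1 + C2 / Lmin" using params by simp
  from mult_right_mono[OF this X1] show "Xbar \<le> Nmax" by (simp add: Nmax_def)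
qed

lemma le_R: "x\<^sup>2 \<le> R\<^sup>2 \<Longrightarrow> x \<le> R"
  using power2_le_imp_le params by (meson less_imp_le)

lemma Lmax_pos: "0 < Lmax" using Lmax params by linarith

lemma A1_nonneg: "0 \<le> A1"
  using params unfolding A1_def by (intro add_nonneg_nonneg divide_nonneg_nonneg mult_nonneg_nonneg) auto

text \<open>A trial either is accepted or leads to the next trial, and it is accepted for sure once \<open>L \<ge> Lbar\<close>.
  The oracle may be called at \<open>d\<close> because the gauge grows only by the factor \<open>1 + C2/L \<le> 1 + C2/Lmin\<close>.\<close>

lemma line_search_trial:
  assumes A: "0 \<le> A" "A \<le> A1" and k: "k \<le> K + 1" and v: "v \<in> D" "\<pi> \<in> D"
    and Nv: "N v + c \<le> Xbar" "N \<pi> + c \<le> Xbar" and L: "Lmin \<le> L"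
  obtains a d gd \<xi> s' P where
    "line_search orc \<phi> tick \<mu> \<epsilon> \<gamma>u k A v \<pi> L s =
       (if P then Some ((L, a, d, gd, \<xi>), s') else line_search orc \<phi> tick \<mu> \<epsilon> \<gamma>u k A v \<pi> (\<gamma>u * L) s')"
    "P \<longrightarrow> good_step k A v \<pi> L a d gd \<xi>" "Lbar \<le> L \<longrightarrow> P" "m s' \<le> m s + (2 * Nc + ct)"
proof -
  have Lp: "0 < L" using L params by simp
  define a where "a = momentum \<mu> L A"
  note a = momentum[OF A(1) params(1) Lp, folded a_def]
  define b where "b = (1 / (A + a)) *\<^sub>R (A *\<^sub>R v + a *\<^sub>R \<pi>)"
  define \<omega> where "\<omega> = min (\<epsilon> / 8) (\<mu> * \<epsilon> / ((real k + 1)\<^sup>2 * max 1 (A + a)))"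
  have b_conv: "b = (1 - a / (A + a)) *\<^sub>R v + (a / (A + a)) *\<^sub>R \<pi>"
    using a(1) A(1) by (simp add: b_def field_simps scaleR_add_right)
  have t: "0 \<le> a / (A + a)" "a / (A + a) \<le> 1" using a(1) A(1) by auto
  have bD: "b \<in> D" unfolding b_conv
    using strongly_convex_on_convex[OF f(1)] v t by (intro convexD) auto
  have Nb: "N b \<le> max (N v) (N \<pi>)" unfolding b_conv by (rule N_convex[OF t])
  then have Nb': "N b + c \<le> Xbar" using Nv by linarith
  have \<omega>_low: "\<omega>low \<le> \<omega>"
  proof -
    have "2 * (1 + \<mu> * A) / L \<le> 2 * (1 + \<mu> * A1) / Lmin"
      using A params L by (intro frac_le) (auto intro: mult_nonneg_nonneg add_nonneg_nonneg)
    then have "a \<le> A + 2 * (2 * (1 + \<mu> * A1) / Lmin)"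
      using quadratic_step_bound[OF a(1) A(1) a(2)] A params Lp
      by (smt (verit) divide_nonneg_nonneg mult_nonneg_nonneg)
    then have "A + a \<le> Atop" using A unfolding Atop_def by simp
    then have "\<mu> * \<epsilon> / ((real K + 2)\<^sup>2 * max 1 Atop) \<le> \<mu> * \<epsilon> / ((real k + 1)\<^sup>2 * max 1 (A + a))"
      using params k by (intro divide_left_mono mult_mono mult_pos_pos power_mono) auto
    then show ?thesis unfolding \<omega>low_def \<omega>_def by linarith
  qed
  have \<omega>_nonneg: "0 \<le> \<omega>" using params unfolding \<omega>_def by simp
  have \<omega>_le: "\<omega> \<le> \<epsilon> / 8" unfolding \<omega>_def by (rule min.cobounded1)
  have \<omega>_A: "(A + a) * \<omega> \<le> \<mu> * \<epsilon> / (real k + 1)\<^sup>2"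
  proof -
    have "(A + a) * \<omega> \<le> max 1 (A + a) * (\<mu> * \<epsilon> / ((real k + 1)\<^sup>2 * max 1 (A + a)))"
      using \<omega>_nonneg by (intro mult_mono) (auto simp: \<omega>_def)
    also have "\<dots> = \<mu> * \<epsilon> / (real k + 1)\<^sup>2" by (simp add: max_def)
    finally show ?thesis .
  qed
  obtain gb s1 where gb: "orc b \<omega> s = Some (gb, s1)" "norm (gb - G b) \<le> \<omega>" "m s1 \<le> m s + Nc"
    using orc[OF bD _ \<omega>_low] Nb' X_le_Xbar by (meson order_trans)
  define d where "d = prox (1 / L) \<phi> (b - (1 / L) *\<^sub>R gb)"
  note pr = prox_subgradient[OF f D _ _ Lp \<phi>, where a = "b - (1 / L) *\<^sub>R gb", folded d_def]
  have dD: "d \<in> D" using pr(1) v0 params by auto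
  have pr2: "f d + (L *\<^sub>R (b - d) - gb) \<bullet> (w - d) + \<mu> / 2 * (norm (w - d))\<^sup>2 \<le> f w" if "w \<in> D" for w
  proof -
    have "L *\<^sub>R (b - (1 / L) *\<^sub>R gb - d) = L *\<^sub>R (b - d) - gb" using Lp by (simp add: algebra_simps)
    then show ?thesis using pr(2)[OF _ _ that] v0 params by auto
  qed
  have Nd: "N d + c \<le> (1 + C2 / L) * (N b + c)"
    using N_grow[OF bD dD L _ pr2] gb(2) \<omega>_le by auto
  also have "\<dots> \<le> Nmax" unfolding Nmax_def
    using params L Lp Nb' N_nonneg[of b] by (intro mult_mono add_left_mono divide_left_mono) auto
  finally have Nd': "N d + c \<le> Nmax" .
  obtain gd s2 where gd: "orc d \<omega> (tick s1) = Some (gd, s2)" "norm (gd - G d) \<le> \<omega>" "m s2 \<le> m (tick s1) + Nc"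
    using orc[OF dD Nd' \<omega>_low] by blast
  define \<xi> where "\<xi> = gd - gb - L *\<^sub>R (d - b)"
  define P where "P \<longleftrightarrow> \<xi> \<bullet> (b - d) \<ge> 1 / L * (norm \<xi>)\<^sup>2 - 6 * \<omega> * norm (b - d) - 4 * \<omega>\<^sup>2 / L"
  show thesis
  proof (rule that[of P a d gd \<xi> s2])
    show "line_search orc \<phi> tick \<mu> \<epsilon> \<gamma>u k A v \<pi> L s =
       (if P then Some ((L, a, d, gd, \<xi>), s2) else line_search orc \<phi> tick \<mu> \<epsilon> \<gamma>u k A v \<pi> (\<gamma>u * L) s2)"
      by (subst line_search.simps)
        (simp only: Let_def Option.bind.bind_lunit prod.case momentum_def[symmetric] a_def[symmetric] b_def[symmetric] \<omega>_def[symmetric] gb(1)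
          d_def[symmetric] gd(1) \<xi>_def[symmetric] P_def[symmetric])
    show "P \<longrightarrow> good_step k A v \<pi> L a d gd \<xi>"
    proof
      assume that: P
      have "\<xi> - gd = L *\<^sub>R (b - d) - gb" by (simp add: \<xi>_def algebra_simps)
      then show "good_step k A v \<pi> L a d gd \<xi>" unfolding good_step_def
        using a dD pr2 bD Nb \<omega>_nonneg \<omega>_le \<omega>_A Nd gd(2) that[unfolded P_def] b_def by auto
    qed
    show "Lbar \<le> L \<longrightarrow> P"
    proof
      assume that: "Lbar \<le> L"
      have "norm (gd - gb - (G d - G b)) \<le> norm (gd - G d) + norm (gb - G b)"
        using norm_triangle_ineq4[of "gd - G d" "gb - G b"] by (simp add: algebra_simps)
      then have "norm (gd - gb - (G d - G b)) \<le> 2 * \<omega>" using gd(2) gb(2) by simp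
      from acceptance[OF coco[OF dD bD] that params(6) this]
      show P unfolding P_def \<xi>_def by (simp add: norm_minus_commute)
    qed
    show "m s2 \<le> m s + (2 * Nc + ct)" using gb(3) gd(3) tick[of s1] by linarith
  qed
qed

lemma line_search_terminates:
  assumes A: "0 \<le> A" "A \<le> A1" and k: "k \<le> K + 1" and v: "v \<in> D" "\<pi> \<in> D"
    and Nv: "N v + c \<le> Xbar" "N \<pi> + c \<le> Xbar"
  shows "Lmin \<le> L \<Longrightarrow> L \<le> Lmax \<Longrightarrow> Lbar \<le> L * \<gamma>u ^ j \<Longrightarrow>
    \<exists>L' a d gd \<xi> s'. line_search orc \<phi> tick \<mu> \<epsilon> \<gamma>u k A v \<pi> L s = Some ((L', a, d, gd, \<xi>), s') \<and>
      L \<le> L' \<and> L' \<le> Lmax \<and> good_step k A v \<pi> L' a d gd \<xi> \<and> m s' \<le> m s + (j + 1) * (2 * Nc + ct)"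
proof (induction j arbitrary: L s)
  case (0 L s)
  obtain a d gd \<xi> s' P where
    "line_search orc \<phi> tick \<mu> \<epsilon> \<gamma>u k A v \<pi> L s =
       (if P then Some ((L, a, d, gd, \<xi>), s') else line_search orc \<phi> tick \<mu> \<epsilon> \<gamma>u k A v \<pi> (\<gamma>u * L) s')"
    "P \<longrightarrow> good_step k A v \<pi> L a d gd \<xi>" "Lbar \<le> L \<longrightarrow> P" "m s' \<le> m s + (2 * Nc + ct)"
    by (rule line_search_trial[OF A k v Nv 0(1), of s])
  then show ?case using 0 by auto
next
  case (Suc j L s)
  obtain a d gd \<xi> s' P where *:
    "line_search orc \<phi> tick \<mu> \<epsilon> \<gamma>u k A v \<pi> L s =
       (if P then Some ((L, a, d, gd, \<xi>), s') else line_search orc \<phi> tick \<mu> \<epsilon> \<gamma>u k A v \<pi> (\<gamma>u * L) s')"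
    "P \<longrightarrow> good_step k A v \<pi> L a d gd \<xi>" "Lbar \<le> L \<longrightarrow> P" "m s' \<le> m s + (2 * Nc + ct)"
    by (rule line_search_trial[OF A k v Nv Suc.prems(1), of s])
  show ?case
  proof (cases P)
    case True
    then show ?thesis using * Suc.prems by auto
  next
    case False
    then have "L < Lbar" using *(3) by force
    then have "\<gamma>u * L \<le> Lmax"
      using params Lmax(1) by (smt (verit) mult_less_cancel_left_pos)
    moreover have LL: "L \<le> \<gamma>u * L"
      using params Suc.prems(1) by simp
    ultimately have "\<exists>L' a d gd \<xi> s''. line_search orc \<phi> tick \<mu> \<epsilon> \<gamma>u k A v \<pi> (\<gamma>u * L) s' = Some ((L', a, d, gd, \<xi>), s'') \<and>
      \<gamma>u * L \<le> L' \<and> L' \<le> Lmax \<and> good_step k A v \<pi> L' a d gd \<xi> \<and> m s'' \<le> m s' + (j + 1) * (2 * Nc + ct)"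
      using Suc.prems by (intro Suc.IH) (auto simp: algebra_simps)
    then obtain L' a' d' gd' \<xi>' s'' where
      "line_search orc \<phi> tick \<mu> \<epsilon> \<gamma>u k A v \<pi> (\<gamma>u * L) s' = Some ((L', a', d', gd', \<xi>'), s'')"
      "\<gamma>u * L \<le> L'" "L' \<le> Lmax" "good_step k A v \<pi> L' a' d' gd' \<xi>'" "m s'' \<le> m s' + (j + 1) * (2 * Nc + ct)"
      by blast
    then show ?thesis using *(1,4) False LL by force
  qed
qed

text \<open>A bound for the accumulated effect of inexact gradients. The increment in step \<open>k\<close> is
  \<open>(8M + \<epsilon>/(2 Lmin)) \<mu>\<epsilon>/(k + 1)\<^sup>2\<close>, and \<open>2 - 2/(2k + 1)\<close> majorises the partial sums of \<open>1/(k + 1)\<^sup>2\<close> telescopically.\<close>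

definition err :: "nat \<Rightarrow> real" where
  "err k = \<mu> * \<epsilon> * (8 * M + \<epsilon> / (2 * Lmin)) * (2 - 2 / (2 * real k + 1))"

text \<open>The invariant of the main loop. \<open>F\<close> is the estimating function, squeezed between
  \<open>A (\<psi> + f) v\<close> plus a parabola at its minimiser \<open>\<pi>\<close>, and its upper bound at the reference point \<open>vs\<close>.
  The other clauses record the geometric growth of \<open>A\<close> and the growth of the gauge \<open>N\<close>.\<close>

definition Inv :: "nat \<Rightarrow> real \<Rightarrow> 'v \<Rightarrow> 'v \<Rightarrow> ('v \<Rightarrow> ereal) \<Rightarrow> bool" where
  "Inv k A v \<pi> E \<longleftrightarrow> 0 \<le> A \<and> v \<in> D \<and> \<pi> \<in> D \<and>
     (0 < k \<longrightarrow> 2 * \<mu> / Lmax * (1 + sqrt (2 * \<mu> / Lmax)) ^ (k - 1) \<le> \<mu> * A) \<and>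
     N v + c \<le> X * exp (C2 * sqrt (2 * A / Lmin)) \<and>
     (\<exists>F e1 e2. (\<forall>w\<in>D. E w = ereal (F w)) \<and> (\<forall>w. w \<notin> D \<longrightarrow> E w \<noteq> - \<infinity>) \<and>
        strongly_convex_on D (1 + \<mu> * A) F \<and> continuous_on D F \<and>
        (\<forall>w\<in>D. A * (\<psi> v + f v) - e1 + (1 + \<mu> * A) / 2 * (norm (w - \<pi>))\<^sup>2 \<le> F w) \<and>
        F vs \<le> (norm (v0 - vs))\<^sup>2 / 2 + A * (\<psi> vs + f vs) + e2 \<and> e1 + e2 \<le> err k)"

lemma M_nonneg: "0 \<le> M"
  using M[OF v0 v0] X(1) X_le_Xbar by simp

text \<open>The squeeze of \<open>Inv\<close> at \<open>vs\<close>, combined with quadratic growth at the minimiser. This is the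
  convergence statement: both distances decay like \<open>1 / (\<mu> A)\<close>.\<close>

lemma Inv_distance:
  assumes "Inv k A v \<pi> E"
  shows "(1 + \<mu> * A) * (norm (\<pi> - vs))\<^sup>2 + \<mu> * A * (norm (v - vs))\<^sup>2 \<le> R\<^sup>2"
proof -
  from assms obtain F e1 e2 where *: "0 \<le> A" "v \<in> D"
    "A * (\<psi> v + f v) - e1 + (1 + \<mu> * A) / 2 * (norm (vs - \<pi>))\<^sup>2 \<le> F vs"
    "F vs \<le> (norm (v0 - vs))\<^sup>2 / 2 + A * (\<psi> vs + f vs) + e2" "e1 + e2 \<le> err k"
    using vs unfolding Inv_def by metis
  have "A * (\<psi> vs + f vs + \<mu> / 2 * (norm (v - vs))\<^sup>2) \<le> A * (\<psi> v + f v)"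
    using vs_min * by (intro mult_left_mono) auto
  moreover have "err k \<le> 2 * (\<mu> * \<epsilon> * (8 * M + \<epsilon> / (2 * Lmin)))"
  proof -
    have "0 \<le> \<mu> * \<epsilon> * (8 * M + \<epsilon> / (2 * Lmin))" using params M_nonneg by simp
    from mult_left_mono[OF _ this, of "2 - 2 / (2 * real k + 1)" 2]
    show ?thesis unfolding err_def by simp
  qed
  ultimately show ?thesis using * R
    unfolding norm_minus_commute[of vs \<pi>]
    by (simp only: distrib_left[of A] times_divide_eq_left times_divide_eq_right mult.assoc[of \<mu> A]
      mult.left_commute[of A \<mu>])
qed

text \<open>While \<open>\<mu>A \<le> 1\<close> the exponential bound of \<open>Inv\<close> is at most \<open>Xbar\<close>; afterwards \<open>v\<close> is within \<open>R\<close> of \<open>vs\<close>.\<close>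

lemma Inv_N:
  assumes "Inv k A v \<pi> E"
  shows "N v + c \<le> Xbar" "N \<pi> + c \<le> Xbar"
proof -
  note d = Inv_distance[OF assms]
  have A: "0 \<le> A" using assms by (simp add: Inv_def)
  have muA: "0 \<le> \<mu> * A" using A params by simp
  have "(norm (\<pi> - vs))\<^sup>2 \<le> (1 + \<mu> * A) * (norm (\<pi> - vs))\<^sup>2 + \<mu> * A * (norm (v - vs))\<^sup>2"
    using muA by (simp add: distrib_right)
  then have "norm (\<pi> - vs) \<le> R" using d by (intro le_R) linarith
  then show "N \<pi> + c \<le> Xbar" using N_vs[of \<pi>] X(2) X_le_Xbar by linarith
  show "N v + c \<le> Xbar"
  proof (cases "\<mu> * A \<le> 1")
    case True
    then have "2 * A / Lmin \<le> 2 / (\<mu> * Lmin)" using params by (simp add: field_simps)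
    then have "X * exp (C2 * sqrt (2 * A / Lmin)) \<le> Xbar"
      unfolding Xbar_def using params X_le_Xbar by (intro mult_left_mono) (auto intro: mult_left_mono)
    then show ?thesis using assms unfolding Inv_def by linarith
  next
    case False
    have "1 * (norm (v - vs))\<^sup>2 \<le> \<mu> * A * (norm (v - vs))\<^sup>2"
      using False by (intro mult_right_mono) auto
    moreover have "0 \<le> (1 + \<mu> * A) * (norm (\<pi> - vs))\<^sup>2" using muA by simp
    ultimately have "(norm (v - vs))\<^sup>2 \<le> R\<^sup>2" using d by linarith
    then have "norm (v - vs) \<le> R" by (rule le_R)
    then show ?thesis using N_vs[of v] X(2) X_le_Xbar by linarith
  qed
qed

lemma Inv_initial: "Inv 0 0 v0 v0 (\<lambda>w. ereal (1 / 2 * (norm (w - v0))\<^sup>2))"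
proof -
  have "strongly_convex_on D 1 (\<lambda>w. 1 / 2 * (norm (w - v0))\<^sup>2)"
    by (intro strongly_convex_on_quadratic strongly_convex_on_convex[OF f(1)])
  moreover have "continuous_on D (\<lambda>w. 1 / 2 * (norm (w - v0))\<^sup>2)"
    by (intro continuous_intros)
  ultimately show ?thesis
    using v0 X(1) unfolding Inv_def
    by (intro conjI exI[of _ "\<lambda>w. 1 / 2 * (norm (w - v0))\<^sup>2"] exI[of _ 0])
      (auto simp: err_def norm_minus_commute)
qed

text \<open>The estimate-sequence argument. A lower bound for the new estimating function at its minimiser \<open>\<pi>'\<close>
  comes from convexity at \<open>v\<close>, with weight \<open>A\<close>, and at \<open>\<pi>'\<close>, with weight \<open>a\<close>. Completing the square in
  \<open>\<pi>' - \<pi>\<close> costs \<open>a\<^sup>2 |\<xi>|\<^sup>2 / (2 (1 + \<mu> A))\<close>, which by the choice of \<open>a\<close> is \<open>(A + a) |\<xi>|\<^sup>2 / L\<close>, and this is what the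
  acceptance test makes available.\<close>

lemma Inv_step:
  assumes I: "Inv k A v \<pi> E" and st: "good_step k A v \<pi> L a d gd \<xi>" and L: "Lmin \<le> L" "L \<le> Lmax"
  defines "E' \<equiv> (\<lambda>w. E w + ereal a * (ereal (\<psi> d + gd \<bullet> (w - d)) + \<phi> w))"
  shows "Inv (k + 1) (A + a) d (arg_min E' (\<lambda>_. True)) E'"
proof -
  have Lp: "0 < L" using L params by simp
  from I obtain F e1 e2 where A: "0 \<le> A" and v: "v \<in> D" and \<pi>: "\<pi> \<in> D"
    and growth: "0 < k \<longrightarrow> 2 * \<mu> / Lmax * (1 + sqrt (2 * \<mu> / Lmax)) ^ (k - 1) \<le> \<mu> * A"
    and Nv: "N v + c \<le> X * exp (C2 * sqrt (2 * A / Lmin))"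
    and E: "\<forall>w\<in>D. E w = ereal (F w)" "\<forall>w. w \<notin> D \<longrightarrow> E w \<noteq> - \<infinity>"
    and F: "strongly_convex_on D (1 + \<mu> * A) F" "continuous_on D F"
    and F_low: "\<forall>w\<in>D. A * (\<psi> v + f v) - e1 + (1 + \<mu> * A) / 2 * (norm (w - \<pi>))\<^sup>2 \<le> F w"
    and F_vs: "F vs \<le> (norm (v0 - vs))\<^sup>2 / 2 + A * (\<psi> vs + f vs) + e2"
    and e: "e1 + e2 \<le> err k"
    unfolding Inv_def by metis
  from st obtain b \<omega> where a: "0 < a" "a\<^sup>2 = (A + a) * (2 * (1 + \<mu> * A) / L)" and d: "d \<in> D"
    and sub: "\<forall>w\<in>D. f d + (\<xi> - gd) \<bullet> (w - d) + \<mu> / 2 * (norm (w - d))\<^sup>2 \<le> f w"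
    and b: "b = (1 / (A + a)) *\<^sub>R (A *\<^sub>R v + a *\<^sub>R \<pi>)" "b \<in> D" "N b \<le> max (N v) (N \<pi>)"
    and \<omega>: "0 \<le> \<omega>" "\<omega> \<le> \<epsilon> / 8" "(A + a) * \<omega> \<le> \<mu> * \<epsilon> / (real k + 1)\<^sup>2"
    and Nd: "N d + c \<le> (1 + C2 / L) * (N b + c)" and gd: "norm (gd - G d) \<le> \<omega>"
    and acc: "\<xi> \<bullet> (b - d) \<ge> 1 / L * (norm \<xi>)\<^sup>2 - 6 * \<omega> * norm (b - d) - 4 * \<omega>\<^sup>2 / L"
    unfolding good_step_def by metis
  have sub': "f d + (\<xi> - gd) \<bullet> (w - d) \<le> f w" if "w \<in> D" for w
    using sub that params by (smt (verit) zero_le_power2 mult_nonneg_nonneg divide_nonneg_nonneg)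
  have muA: "0 \<le> \<mu> * A" using A params by simp
  have A'pos: "0 < A + a" using A a by simp
  have Nb': "N b + c \<le> Xbar" using b(3) Inv_N[OF I] by linarith
  have Nd': "N d + c \<le> Nmax"
  proof -
    have "(1 + C2 / L) * (N b + c) \<le> Nmax" unfolding Nmax_def
      using params L Lp Nb' N_nonneg[of b] by (intro mult_mono add_left_mono divide_left_mono) auto
    then show ?thesis using Nd by linarith
  qed
  \<comment> \<open>The increase of \<open>sqrt (2A/Lmin)\<close> pays for the factor \<open>1 + C2/L \<le> exp (C2/L)\<close> of \<open>N_grow\<close>.\<close>
  have sqrt_growth: "1 / L \<le> sqrt (2 * (A + a) / Lmin) - sqrt (2 * A / Lmin)"
  proof -
    let ?s = "sqrt (A + a)" and ?r = "sqrt A"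
    have s: "0 < ?s" "0 \<le> ?r" "?r \<le> ?s" using A a A'pos by auto
    have "(1 / sqrt L) * (1 / sqrt L) \<le> (1 / sqrt Lmin) * (1 / sqrt L)"
      using L Lp params by (intro mult_right_mono divide_left_mono) auto
    then have 1: "1 / L \<le> (1 / sqrt Lmin) * (1 / sqrt L)" using Lp by simp
    have "(A + a) * (2 / L) \<le> (A + a) * (2 * (1 + \<mu> * A) / L)"
      using A'pos Lp muA by (intro mult_left_mono divide_right_mono) auto
    then have "2 * ?s\<^sup>2 * (1 / sqrt L)\<^sup>2 \<le> a\<^sup>2"
      unfolding a(2) using A'pos Lp by (simp add: power_divide mult.commute)
    then have "(sqrt 2 * ?s * (1 / sqrt L))\<^sup>2 \<le> a\<^sup>2" by (simp add: power_mult_distrib power_divide)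
    then have "sqrt 2 * ?s * (1 / sqrt L) \<le> a" by (rule power2_le_imp_le) (use a(1) in linarith)
    also have "a = (?s - ?r) * (?s + ?r)" using A a by (simp add: algebra_simps)
    also have "\<dots> \<le> (?s - ?r) * (2 * ?s)" using s by (intro mult_left_mono) auto
    finally have "?s * (sqrt 2 * (1 / sqrt L)) \<le> ?s * (2 * (?s - ?r))" by (simp add: algebra_simps)
    then have "sqrt 2 * (1 / sqrt L) \<le> 2 * (?s - ?r)"
      using mult_le_cancel_left_pos[OF s(1)] by blast
    then have "sqrt 2 * (1 / sqrt L) \<le> sqrt 2 * (sqrt 2 * (?s - ?r))" by (simp add: mult.assoc[symmetric])
    then have "1 / sqrt L \<le> sqrt 2 * (?s - ?r)" by (subst (asm) mult_le_cancel_left_pos) auto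
    then have "(1 / sqrt Lmin) * (1 / sqrt L) \<le> (1 / sqrt Lmin) * (sqrt 2 * (?s - ?r))"
      using params by (intro mult_left_mono) auto
    also have "\<dots> = sqrt (2 * (A + a) / Lmin) - sqrt (2 * A / Lmin)"
      by (simp add: real_sqrt_divide real_sqrt_mult diff_divide_distrib right_diff_distrib del: distrib_left_numeral)
    finally show ?thesis using 1 by linarith
  qed
  have N_exp: "N d + c \<le> X * exp (C2 * sqrt (2 * (A + a) / Lmin))"
  proof -
    have "N \<pi> + c \<le> X"
    proof -
      have "(norm (\<pi> - vs))\<^sup>2 \<le> (1 + \<mu> * A) * (norm (\<pi> - vs))\<^sup>2 + \<mu> * A * (norm (v - vs))\<^sup>2"
        using muA by (simp add: distrib_right)
      then have "norm (\<pi> - vs) \<le> R" using Inv_distance[OF I] by (intro le_R) linarith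
      then show ?thesis using N_vs[of \<pi>] X(2) by linarith
    qed
    moreover have "X * 1 \<le> X * exp (C2 * sqrt (2 * A / Lmin))"
      using X_le_Xbar params A by (intro mult_left_mono) auto
    ultimately have "N b + c \<le> X * exp (C2 * sqrt (2 * A / Lmin))" using Nv b(3) by linarith
    then have "(1 + C2 / L) * (N b + c) \<le> exp (C2 / L) * (X * exp (C2 * sqrt (2 * A / Lmin)))"
      using N_nonneg[of b] params Lp by (intro mult_mono) auto
    also have "\<dots> = X * exp (C2 * (1 / L + sqrt (2 * A / Lmin)))"
      by (simp add: exp_add[symmetric] algebra_simps)
    also have "\<dots> \<le> X * exp (C2 * sqrt (2 * (A + a) / Lmin))"
      using X_le_Xbar params sqrt_growth by (auto intro!: mult_left_mono)
    finally show ?thesis using Nd by linarith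
  qed
  \<comment> \<open>In the first iteration \<open>A = 0\<close> and \<open>a = 2/L\<close>; later \<open>a\<^sup>2 \<ge> A \<sdot> 2\<mu>A/Lmax\<close>.\<close>
  have growth': "2 * \<mu> / Lmax * (1 + sqrt (2 * \<mu> / Lmax)) ^ (k + 1 - 1) \<le> \<mu> * (A + a)"
  proof (cases "k = 0")
    case True
    have "a * a \<ge> a * (2 / L)"
    proof -
      have "a * (2 / L) \<le> (A + a) * (2 * (1 + \<mu> * A) / L)"
        using A a Lp muA by (intro mult_mono divide_right_mono) auto
      then show ?thesis using a(2) by (simp add: power2_eq_square)
    qed
    then have "2 / L \<le> a" using mult_le_cancel_left_pos[OF a(1)] by blast
    moreover have "2 / Lmax \<le> 2 / L" using L Lp by (intro divide_left_mono) auto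
    ultimately have "\<mu> * (2 / Lmax) \<le> \<mu> * (A + a)" using A params by (intro mult_left_mono) auto
    then show ?thesis using True by (simp add: mult.commute)
  next
    case False
    let ?q = "sqrt (2 * \<mu> / Lmax)"
    have q: "0 \<le> ?q" using params Lmax_pos by simp
    have "(A * ?q)\<^sup>2 = A * (2 * (\<mu> * A) / Lmax)" unfolding power_mult_distrib using params Lmax_pos by (simp add: power2_eq_square[of A])
    also have "\<dots> \<le> (A + a) * (2 * (1 + \<mu> * A) / L)"
      using A a L Lp muA by (intro mult_mono frac_le) auto
    finally have "(A * ?q)\<^sup>2 \<le> a\<^sup>2" using a(2) by simp
    then have "A * ?q \<le> a" by (rule power2_le_imp_le) (use a(1) in linarith)
    then have "\<mu> * A * (1 + ?q) \<le> \<mu> * (A + a)" using params by (simp add: algebra_simps)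
    moreover have "2 * \<mu> / Lmax * (1 + ?q) ^ (k - 1) * (1 + ?q) \<le> \<mu> * A * (1 + ?q)"
      using growth False q by (intro mult_right_mono) auto
    moreover have "(1 + ?q) ^ (k + 1 - 1) = (1 + ?q) ^ (k - 1) * (1 + ?q)"
      using False by (cases k) auto
    ultimately show ?thesis by (simp add: mult.assoc)
  qed
  define F' where "F' w = F w + a * (\<psi> d + gd \<bullet> (w - d) + f w)" for w
  have E': "\<And>w. w \<in> D \<Longrightarrow> E' w = ereal (F' w)" "\<And>w. w \<notin> D \<Longrightarrow> E' w = \<infinity>"
    unfolding E'_def F'_def using E a(1) by (auto simp: \<phi>)
  have "strongly_convex_on D (0 + \<mu>) (\<lambda>w. (\<psi> d + gd \<bullet> (w - d)) + f w)"
    by (intro strongly_convex_on_add strongly_convex_on_affine strongly_convex_on_convex[OF f(1)] f)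
  from strongly_convex_on_add[OF F(1) strongly_convex_on_cmult[OF this, of a]] a(1)
  have "strongly_convex_on D (1 + \<mu> * A + a * (0 + \<mu>)) F'"
    unfolding F'_def[abs_def] by simp
  moreover have "1 + \<mu> * A + a * (0 + \<mu>) = 1 + \<mu> * (A + a)" by (simp add: algebra_simps)
  ultimately have F'_sc: "strongly_convex_on D (1 + \<mu> * (A + a)) F'" by (simp only:)
  have F'_cont: "continuous_on D F'"
    unfolding F'_def using F(2) f(2) by (intro continuous_intros) auto
  have mod_pos: "0 < 1 + \<mu> * (A + a)" using params A'pos by (simp add: add_pos_pos)
  obtain p where p: "p \<in> D" "\<And>w. w \<in> D \<Longrightarrow> F' p \<le> F' w"
    using strongly_convex_on_attains_min[OF F'_sc mod_pos D _ F'_cont] v0 by blast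
  define \<pi>' where "\<pi>' = arg_min E' (\<lambda>_. True)"
  have \<pi>': "\<pi>' \<in> D" unfolding \<pi>'_def by (rule arg_min_ereal(1)[where E = E' and q = F', OF E' p])
  have \<pi>'_min: "F' \<pi>' \<le> F' w" if "w \<in> D" for w
    unfolding \<pi>'_def by (rule arg_min_ereal(2)[where E = E' and q = F', OF E' p that])
  define \<theta> where "\<theta> = \<mu> * \<epsilon> / (real k + 1)\<^sup>2"
  have \<theta>: "0 \<le> \<theta>" using params by (simp add: \<theta>_def)
  have vD: "N v + c \<le> Nmax" "N vs + c \<le> Nmax" "N b + c \<le> Nmax"
    using Inv_N[OF I] X_le_Xbar X(2) Nb' params by linarith+
  have A\<omega>: "A * \<omega> \<le> \<theta>" "a * \<omega> \<le> \<theta>" "(A + a) * \<omega> \<le> \<theta>"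
    using \<omega> A a unfolding \<theta>_def by (auto simp: distrib_right intro: order_trans[rotated])
  have \<Phi>v: "\<psi> d + f d + \<xi> \<bullet> (v - d) - \<omega> * M \<le> \<psi> v + f v"
  proof -
    have "(gd - G d) \<bullet> (v - d) \<le> \<omega> * M"
      using norm_cauchy_schwarz[of "gd - G d" "v - d"] mult_mono[OF gd M[OF v d vD(1) Nd'] \<omega>(1)]
      by simp
    then show ?thesis using subgrad[OF d v] sub'[OF v] by (simp add: inner_diff_left)
  qed
  have low: "(A + a) * (\<psi> d + f d) - (e1 + \<theta> * (7 * M + \<epsilon> / (2 * Lmin))) \<le> F' \<pi>'"
  proof -
    have "A * (\<psi> d + f d + \<xi> \<bullet> (v - d) - \<omega> * M) \<le> A * (\<psi> v + f v)"
      using \<Phi>v A by (intro mult_left_mono)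
    moreover have "a * (f d + (\<xi> - gd) \<bullet> (\<pi>' - d)) \<le> a * f \<pi>'"
      using sub'[OF \<pi>'] a(1) by simp
    ultimately have 1: "(A + a) * (\<psi> d + f d) + \<xi> \<bullet> (A *\<^sub>R (v - d) + a *\<^sub>R (\<pi>' - d)) - (A * \<omega>) * M - e1
        + (1 + \<mu> * A) / 2 * (norm (\<pi>' - \<pi>))\<^sup>2 \<le> F' \<pi>'"
      using F_low[rule_format, OF \<pi>'] unfolding F'_def
      by (simp add: inner_diff_left inner_add_right algebra_simps)
    have 2: "A *\<^sub>R (v - d) + a *\<^sub>R (\<pi>' - d) = (A + a) *\<^sub>R (b - d) + a *\<^sub>R (\<pi>' - \<pi>)"
    proof -
      have "(A + a) *\<^sub>R b = A *\<^sub>R v + a *\<^sub>R \<pi>" using A'pos by (simp add: b(1))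
      then show ?thesis by (simp add: scaleR_diff_right scaleR_add_left)
    qed
    have 3: "- ((A + a) * (1 / L * (norm \<xi>)\<^sup>2)) \<le> a * (\<xi> \<bullet> (\<pi>' - \<pi>)) + (1 + \<mu> * A) / 2 * (norm (\<pi>' - \<pi>))\<^sup>2"
    proof -
      define y where "y = norm (\<pi>' - \<pi>)"
      define B where "B = 1 + \<mu> * A"
      have B: "0 < B" using muA by (simp add: B_def)
      have "- (norm \<xi> * y) \<le> \<xi> \<bullet> (\<pi>' - \<pi>)"
        using norm_cauchy_schwarz[of "-\<xi>" "\<pi>' - \<pi>"] by (simp add: y_def)
      then have "a * (- (norm \<xi> * y)) \<le> a * (\<xi> \<bullet> (\<pi>' - \<pi>))" using a(1) by (intro mult_left_mono) auto
      moreover have "(A + a) * (1 / L * (norm \<xi>)\<^sup>2) = a\<^sup>2 * (norm \<xi>)\<^sup>2 / (2 * B)"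
        unfolding a(2) B_def[symmetric] using B Lp by (simp add: field_simps)
      moreover have "0 \<le> (a * norm \<xi> - B * y)\<^sup>2 / (2 * B)" using B by simp
      then have "0 \<le> a\<^sup>2 * (norm \<xi>)\<^sup>2 / (2 * B) - a * norm \<xi> * y + B / 2 * y\<^sup>2"
        using B by (simp add: power2_diff power_mult_distrib field_simps power2_eq_square)
      ultimately show ?thesis unfolding y_def[symmetric] B_def[symmetric] by (simp add: algebra_simps)
    qed
    have 4: "(A + a) * (1 / L * (norm \<xi>)\<^sup>2) - \<theta> * (6 * M + \<epsilon> / (2 * Lmin)) \<le> (A + a) * (\<xi> \<bullet> (b - d))"
    proof -
      have "6 * \<omega> * norm (b - d) \<le> 6 * \<omega> * M"
        using M[OF b(2) d vD(3) Nd'] \<omega> by (intro mult_left_mono) auto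
      moreover have "4 * \<omega>\<^sup>2 / L \<le> \<omega> * (\<epsilon> / (2 * Lmin))"
      proof -
        have "4 * \<omega>\<^sup>2 / L = \<omega> * (4 * \<omega> / L)" by (simp add: power2_eq_square)
        also have "\<dots> \<le> \<omega> * (4 * (\<epsilon> / 8) / Lmin)"
          using \<omega> L params by (intro mult_left_mono frac_le) auto
        finally show ?thesis by simp
      qed
      ultimately have "1 / L * (norm \<xi>)\<^sup>2 - \<omega> * (6 * M + \<epsilon> / (2 * Lmin)) \<le> \<xi> \<bullet> (b - d)"
        using acc by (simp add: algebra_simps)
      then have "(A + a) * (1 / L * (norm \<xi>)\<^sup>2 - \<omega> * (6 * M + \<epsilon> / (2 * Lmin))) \<le> (A + a) * (\<xi> \<bullet> (b - d))"
        using A'pos by (intro mult_left_mono) auto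
      moreover have "(A + a) * \<omega> * (6 * M + \<epsilon> / (2 * Lmin)) \<le> \<theta> * (6 * M + \<epsilon> / (2 * Lmin))"
        using A\<omega>(3) M_nonneg params by (intro mult_right_mono) auto
      ultimately show ?thesis by (simp add: right_diff_distrib mult.assoc)
    qed
    have 5: "A * \<omega> * M \<le> \<theta> * M" using A\<omega>(1) M_nonneg by (intro mult_right_mono) auto
    have 6: "\<theta> * (7 * M + \<epsilon> / (2 * Lmin)) = \<theta> * (6 * M + \<epsilon> / (2 * Lmin)) + \<theta> * M"
      by (simp add: algebra_simps)
    show ?thesis
      using 1 3 4 5 unfolding 2 6 by (simp only: inner_add_right inner_scaleR_right)
  qed
  have F'_low: "(A + a) * (\<psi> d + f d) - (e1 + \<theta> * (7 * M + \<epsilon> / (2 * Lmin)))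
      + (1 + \<mu> * (A + a)) / 2 * (norm (w - \<pi>'))\<^sup>2 \<le> F' w" if "w \<in> D" for w
    using low strongly_convex_on_minimum_growth[OF F'_sc \<pi>' \<pi>'_min that] by linarith
  have F'_vs: "F' vs \<le> (norm (v0 - vs))\<^sup>2 / 2 + (A + a) * (\<psi> vs + f vs) + (e2 + \<theta> * M)"
  proof -
    have "(gd - G d) \<bullet> (vs - d) \<le> \<omega> * M"
      using norm_cauchy_schwarz[of "gd - G d" "vs - d"] mult_mono[OF gd M[OF vs d vD(2) Nd'] \<omega>(1)]
      by simp
    then have "\<psi> d + gd \<bullet> (vs - d) + f vs \<le> \<psi> vs + f vs + \<omega> * M"
      using subgrad[OF d vs] by (simp add: inner_diff_left)
    then have "a * (\<psi> d + gd \<bullet> (vs - d) + f vs) \<le> a * (\<psi> vs + f vs) + a * \<omega> * M"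
      using a(1) by (subst distrib_left[symmetric] mult.assoc)+ (auto intro: mult_left_mono)
    moreover have "a * \<omega> * M \<le> \<theta> * M" using A\<omega>(2) M_nonneg by (intro mult_right_mono) auto
    ultimately show ?thesis using F_vs unfolding F'_def by (simp add: distrib_right)
  qed
  have err': "(e1 + \<theta> * (7 * M + \<epsilon> / (2 * Lmin))) + (e2 + \<theta> * M) \<le> err (k + 1)"
  proof -
    let ?C = "\<mu> * \<epsilon> * (8 * M + \<epsilon> / (2 * Lmin))"
    have C: "0 \<le> ?C" using params M_nonneg by simp
    have "1 / (real k + 1)\<^sup>2 = 4 / (4 * (real k + 1)\<^sup>2)" by simp
    also have "\<dots> \<le> 4 / ((2 * real k + 1) * (2 * real k + 3))"
      by (intro frac_le mult_pos_pos) (auto simp: power2_eq_square algebra_simps)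
    also have "\<dots> = 2 / (2 * real k + 1) - 2 / (2 * real k + 3)"
      by (simp add: field_simps)
    finally have "1 / (real k + 1)\<^sup>2 \<le> 2 / (2 * real k + 1) - 2 / (2 * real k + 3)" .
    from mult_left_mono[OF this C]
    have "\<theta> * (8 * M + \<epsilon> / (2 * Lmin)) \<le> ?C * (2 / (2 * real k + 1) - 2 / (2 * real k + 3))"
      by (simp add: \<theta>_def mult.commute mult.left_commute)
    then have "err k + \<theta> * (8 * M + \<epsilon> / (2 * Lmin)) \<le> err (k + 1)"
      unfolding err_def by (simp add: right_diff_distrib add.commute)
    moreover have "\<theta> * (7 * M + \<epsilon> / (2 * Lmin)) + \<theta> * M = \<theta> * (8 * M + \<epsilon> / (2 * Lmin))"
      by (simp add: algebra_simps)
    ultimately show ?thesis using e by linarith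
  qed
  show ?thesis unfolding \<pi>'_def[symmetric] Inv_def
  proof (intro conjI)
    show "\<exists>F e1 e2. (\<forall>w\<in>D. E' w = ereal (F w)) \<and> (\<forall>w. w \<notin> D \<longrightarrow> E' w \<noteq> - \<infinity>) \<and>
        strongly_convex_on D (1 + \<mu> * (A + a)) F \<and> continuous_on D F \<and>
        (\<forall>w\<in>D. (A + a) * (\<psi> d + f d) - e1 + (1 + \<mu> * (A + a)) / 2 * (norm (w - \<pi>'))\<^sup>2 \<le> F w) \<and>
        F vs \<le> (norm (v0 - vs))\<^sup>2 / 2 + (A + a) * (\<psi> vs + f vs) + e2 \<and> e1 + e2 \<le> err (k + 1)"
      using E' F'_sc F'_cont F'_low F'_vs err'
      by (intro exI[of _ F'] exI[of _ "e1 + \<theta> * (7 * M + \<epsilon> / (2 * Lmin))"] exI[of _ "e2 + \<theta> * M"]) auto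
  qed (use A a d \<pi>' growth' N_exp in auto)
qed

text \<open>If the stopping test fails, then the acceptance test forces \<open>\<epsilon>/2 < |\<xi>| \<le> 10/3 L |b - d|\<close>, whereas
  \<open>|b - d| \<le> 2R / sqrt (\<mu>A)\<close> by \<open>Inv_distance\<close>. So \<open>\<mu>A\<close> is still small.\<close>

lemma continue_bound:
  assumes I: "Inv k A v \<pi> E" and st: "good_step k A v \<pi> L a d gd \<xi>" and L: "Lmin \<le> L" "L \<le> Lmax"
    and cont: "\<epsilon> / 2 < norm \<xi>"
  shows "\<mu> * A < (14 * R * Lmax / \<epsilon>)\<^sup>2" and "A + a \<le> A1"
proof -
  have Lp: "0 < L" using L params by simp
  have A: "0 \<le> A" using I by (simp add: Inv_def)
  then have muA: "0 \<le> \<mu> * A" using params by simp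
  from st obtain b \<omega> where a: "0 < a" "a\<^sup>2 = (A + a) * (2 * (1 + \<mu> * A) / L)"
    and b: "b = (1 / (A + a)) *\<^sub>R (A *\<^sub>R v + a *\<^sub>R \<pi>)"
    and \<omega>: "0 \<le> \<omega>" "\<omega> \<le> \<epsilon> / 8"
    and acc: "\<xi> \<bullet> (b - d) \<ge> 1 / L * (norm \<xi>)\<^sup>2 - 6 * \<omega> * norm (b - d) - 4 * \<omega>\<^sup>2 / L"
    unfolding good_step_def by metis
  define h where "h = sqrt (\<mu> * A)"
  have h: "0 \<le> h" "h\<^sup>2 = \<mu> * A" using muA by (auto simp: h_def)
  have hd: "h * norm (d - vs) \<le> R"
  proof (rule le_R)
    have "(1 + \<mu> * (A + a)) * (norm (arg_min (\<lambda>w. E w + ereal a * (ereal (\<psi> d + gd \<bullet> (w - d)) + \<phi> w)) (\<lambda>_. True) - vs))\<^sup>2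
      + \<mu> * (A + a) * (norm (d - vs))\<^sup>2 \<le> R\<^sup>2"
      by (rule Inv_distance[OF Inv_step[OF I st L]])
    moreover have "\<mu> * A * (norm (d - vs))\<^sup>2 \<le> \<mu> * (A + a) * (norm (d - vs))\<^sup>2"
      using a params by (intro mult_right_mono) auto
    moreover have "0 \<le> (1 + \<mu> * (A + a)) * x\<^sup>2" for x :: real using a(1) A params by simp
    ultimately show "(h * norm (d - vs))\<^sup>2 \<le> R\<^sup>2" unfolding power_mult_distrib h(2) by (smt (verit))
  qed
  have hb: "h * norm (b - vs) \<le> R"
  proof (rule le_R)
    note dist = Inv_distance[OF I]
    have v: "\<mu> * A * (norm (v - vs))\<^sup>2 \<le> R\<^sup>2"
    proof -
      have "0 \<le> (1 + \<mu> * A) * (norm (\<pi> - vs))\<^sup>2" using muA by simp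
      then show ?thesis using dist by linarith
    qed
    have p: "\<mu> * A * (norm (\<pi> - vs))\<^sup>2 \<le> R\<^sup>2"
    proof -
      have "0 \<le> \<mu> * A * (norm (v - vs))\<^sup>2" using muA by simp
      then show ?thesis using dist by (simp add: distrib_right) (smt (verit) zero_le_power2)
    qed
    define t where "t = a / (A + a)"
    have t: "0 \<le> t" "t \<le> 1" using a A by (auto simp: t_def)
    have bt: "b = (1 - t) *\<^sub>R v + t *\<^sub>R \<pi>" using a(1) A unfolding b t_def by (simp add: field_simps scaleR_add_right)
    have "(norm (b - vs))\<^sup>2 \<le> (1 - t) * (norm (v - vs))\<^sup>2 + t * (norm (\<pi> - vs))\<^sup>2"
      unfolding bt norm_sq_convex_combination using t by simp
    then have "\<mu> * A * (norm (b - vs))\<^sup>2 \<le> \<mu> * A * ((1 - t) * (norm (v - vs))\<^sup>2 + t * (norm (\<pi> - vs))\<^sup>2)"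
      using muA by (rule mult_left_mono)
    also have "\<dots> = (1 - t) * (\<mu> * A * (norm (v - vs))\<^sup>2) + t * (\<mu> * A * (norm (\<pi> - vs))\<^sup>2)"
      by (simp add: algebra_simps)
    also have "\<dots> \<le> (1 - t) * R\<^sup>2 + t * R\<^sup>2" using t v p by (intro add_mono mult_left_mono) auto
    finally show "(h * norm (b - vs))\<^sup>2 \<le> R\<^sup>2" unfolding power_mult_distrib h(2) by (simp add: algebra_simps)
  qed
  define n where "n = norm \<xi>"
  define y where "y = norm (b - d)"
  have y: "0 \<le> y" "h * y \<le> 2 * R"
  proof -
    have "y \<le> norm (b - vs) + norm (d - vs)"
      unfolding y_def using norm_triangle_ineq4[of "b - vs" "d - vs"] by simp
    then have "h * y \<le> h * norm (b - vs) + h * norm (d - vs)"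
      using h(1) by (subst distrib_left[symmetric]) (rule mult_left_mono)
    then show "h * y \<le> 2 * R" using hb hd by simp
  qed (simp add: y_def)
  have n: "\<epsilon> / 2 < n" "0 < n" "4 * \<omega> \<le> n" using cont params \<omega> by (auto simp: n_def)
  have "1 / L * n\<^sup>2 \<le> n * y + 6 * \<omega> * y + 4 * \<omega>\<^sup>2 / L"
    using acc norm_cauchy_schwarz[of \<xi> "b - d"] unfolding n_def y_def by linarith
  from mult_left_mono[OF this, of L] Lp
  have "n\<^sup>2 \<le> L * n * y + L * (6 * \<omega> * y) + 4 * \<omega>\<^sup>2" by (simp add: distrib_left)
  also have "L * (6 * \<omega> * y) \<le> L * (6 * (n / 4) * y)"
    using n y Lp by (intro mult_left_mono mult_right_mono) auto
  also have "4 * \<omega>\<^sup>2 \<le> 4 * (n / 4)\<^sup>2" using n \<omega> by (intro mult_left_mono power_mono) auto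
  finally have "n * n \<le> n * (10 / 3 * L * y)" by (simp add: power2_eq_square algebra_simps)
  then have "n \<le> 10 / 3 * L * y" using n by simp
  then have "h * n \<le> h * (10 / 3 * L * y)" using h(1) by (rule mult_left_mono)
  also have "\<dots> = 10 / 3 * L * (h * y)" by simp
  also have "\<dots> \<le> 10 / 3 * Lmax * (2 * R)"
    by (rule mult_mono[OF _ y(2)]) (use y L Lp h params in auto)
  finally have hn: "h * n \<le> 20 / 3 * Lmax * R" by simp
  have RL: "0 < Lmax * R" using Lmax_pos params by simp
  have "h * (\<epsilon> / 2) \<le> h * n" using h n by (intro mult_left_mono) auto
  then have "h * (\<epsilon> / 2) < 7 * (Lmax * R)" using hn RL by (simp add: mult.assoc)
  then have "h < 14 * R * Lmax / \<epsilon>" using params by (simp add: field_simps)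
  then have "h\<^sup>2 < (14 * R * Lmax / \<epsilon>)\<^sup>2" using h(1) by (intro power_strict_mono) auto
  then show X0: "\<mu> * A < (14 * R * Lmax / \<epsilon>)\<^sup>2" by (simp add: h(2))
  have "2 * (1 + \<mu> * A) / L \<le> 2 * (1 + (14 * R * Lmax / \<epsilon>)\<^sup>2) / Lmin"
    using X0 L Lp params muA by (intro frac_le mult_left_mono) auto
  moreover have "a \<le> A + 2 * (2 * (1 + \<mu> * A) / L)"
    using quadratic_step_bound[OF a(1) A a(2)] muA Lp by simp
  moreover have "A \<le> (14 * R * Lmax / \<epsilon>)\<^sup>2 / \<mu>" using X0 params by (simp add: field_simps)
  ultimately show "A + a \<le> A1" unfolding A1_def by (simp add: add_divide_distrib)
qed

lemma good_step_stationary: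
  assumes st: "good_step k A v \<pi> L a d gd \<xi>" and stop: "norm \<xi> \<le> \<epsilon> / 2"
  shows "d \<in> D" and
    "\<exists>sg. (\<forall>w\<in>D. f d + sg \<bullet> (w - d) + \<mu> / 2 * (norm (w - d))\<^sup>2 \<le> f w) \<and> norm (G d + sg) \<le> \<epsilon>"
proof -
  have "norm (G d + (\<xi> - gd)) \<le> norm \<xi> + norm (gd - G d)"
    using norm_triangle_ineq4[of \<xi> "gd - G d"] by (simp add: algebra_simps)
  then have "norm (G d + (\<xi> - gd)) \<le> \<epsilon>" using st stop params unfolding good_step_def by fastforce
  then show "\<exists>sg. (\<forall>w\<in>D. f d + sg \<bullet> (w - d) + \<mu> / 2 * (norm (w - d))\<^sup>2 \<le> f w) \<and> norm (G d + sg) \<le> \<epsilon>"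
    using st unfolding good_step_def by blast
qed (use st in \<open>simp add: good_step_def\<close>)

lemma iapg_loop_terminates:
  assumes "k + j = K + 1" "Inv k A v \<pi> E" "A \<le> A1" "Lmin \<le> L" "L \<le> Lmax"
  shows "\<exists>d s'. iapg_loop orc \<psi> \<phi> tick Lmin \<mu> \<epsilon> \<gamma>u \<gamma>d k A v \<pi> E L s = Some (d, s') \<and> d \<in> D \<and>
    (\<exists>sg. (\<forall>w\<in>D. f d + sg \<bullet> (w - d) + \<mu> / 2 * (norm (w - d))\<^sup>2 \<le> f w) \<and> norm (G d + sg) \<le> \<epsilon>) \<and>
    m s' \<le> m s + (j + 1) * ((J + 1) * (2 * Nc + ct) + ct)"
  using assms
proof (induction j arbitrary: k A v \<pi> E L s)
  case (0 k A v \<pi> E L s)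
  have k: "k = K + 1" using 0 by simp
  then have kK: "k \<le> K + 1" by simp
  have A0: "0 \<le> A" "v \<in> D" "\<pi> \<in> D" using 0(2) by (auto simp: Inv_def)
  have "Lbar \<le> L * \<gamma>u ^ J"
    using J mult_right_mono[OF 0(4), of "\<gamma>u ^ J"] params by (smt (verit) zero_le_power)
  then obtain L' a d gd \<xi> s' where
    ls: "line_search orc \<phi> tick \<mu> \<epsilon> \<gamma>u k A v \<pi> L s = Some ((L', a, d, gd, \<xi>), s')"
      "L \<le> L'" "L' \<le> Lmax" "good_step k A v \<pi> L' a d gd \<xi>" "m s' \<le> m s + (J + 1) * (2 * Nc + ct)"
    using line_search_terminates[OF A0(1) 0(3) kK A0(2,3) Inv_N[OF 0(2)] 0(4,5), where j = J and s = s] by blast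
  have stop: "norm \<xi> \<le> \<epsilon> / 2"
  proof (rule ccontr)
    assume "\<not> norm \<xi> \<le> \<epsilon> / 2"
    then have "\<mu> * A < (14 * R * Lmax / \<epsilon>)\<^sup>2"
      using continue_bound(1)[OF 0(2) ls(4) _ ls(3)] 0(4) ls(2) by simp
    moreover have "2 * \<mu> / Lmax * (1 + sqrt (2 * \<mu> / Lmax)) ^ K \<le> \<mu> * A"
      using 0(2) k unfolding Inv_def by simp
    ultimately show False using K by linarith
  qed
  have "iapg_loop orc \<psi> \<phi> tick Lmin \<mu> \<epsilon> \<gamma>u \<gamma>d k A v \<pi> E L s = Some (d, tick s')"
    using stop by (subst iapg_loop.simps) (simp add: ls(1) Let_def)
  then show ?case using good_step_stationary[OF ls(4) stop] ls(5) tick[of s'] by auto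
next
  case (Suc j k A v \<pi> E L s)
  have k: "k + j = K" using Suc by simp
  then have kK: "k \<le> K + 1" by simp
  have A0: "0 \<le> A" "v \<in> D" "\<pi> \<in> D" using Suc.prems(2) by (auto simp: Inv_def)
  have "Lbar \<le> L * \<gamma>u ^ J"
    using J mult_right_mono[OF Suc.prems(4), of "\<gamma>u ^ J"] params by (smt (verit) zero_le_power)
  then obtain L' a d gd \<xi> s' where
    ls: "line_search orc \<phi> tick \<mu> \<epsilon> \<gamma>u k A v \<pi> L s = Some ((L', a, d, gd, \<xi>), s')"
      "L \<le> L'" "L' \<le> Lmax" "good_step k A v \<pi> L' a d gd \<xi>" "m s' \<le> m s + (J + 1) * (2 * Nc + ct)"
    using line_search_terminates[OF A0(1) Suc.prems(3) kK A0(2,3) Inv_N[OF Suc.prems(2)] Suc.prems(4,5), where j = J and s = s] by blast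
  show ?case
  proof (cases "norm \<xi> \<le> \<epsilon> / 2")
    case True
    have "iapg_loop orc \<psi> \<phi> tick Lmin \<mu> \<epsilon> \<gamma>u \<gamma>d k A v \<pi> E L s = Some (d, tick s')"
      using True by (subst iapg_loop.simps) (simp add: ls(1) Let_def)
    then show ?thesis using good_step_stationary[OF ls(4) True] ls(5) tick[of s'] by auto
  next
    case False
    have L': "Lmin \<le> L'" using Suc.prems(4) ls(2) by simp
    define E' where "E' = (\<lambda>w. E w + ereal a * (ereal (\<psi> d + gd \<bullet> (w - d)) + \<phi> w))"
    define \<pi>' where "\<pi>' = arg_min E' (\<lambda>_. True)"
    have I': "Inv (k + 1) (A + a) d \<pi>' E'"
      unfolding \<pi>'_def E'_def by (rule Inv_step[OF Suc.prems(2) ls(4) L' ls(3)])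
    have A': "A + a \<le> A1"
      using continue_bound(2)[OF Suc.prems(2) ls(4) L' ls(3)] False by simp
    have "L' / \<gamma>d \<le> L'" using params L' by (simp add: divide_le_eq)
    then have L'': "Lmin \<le> max Lmin (L' / \<gamma>d)" "max Lmin (L' / \<gamma>d) \<le> Lmax"
      using ls(3) Lmax by auto
    have "k + 1 + j = K + 1" using k by simp
    from Suc.IH[OF this I' A' L'', of "tick s'"] obtain d' s'' where
      rec: "iapg_loop orc \<psi> \<phi> tick Lmin \<mu> \<epsilon> \<gamma>u \<gamma>d (k + 1) (A + a) d \<pi>' E' (max Lmin (L' / \<gamma>d)) (tick s') = Some (d', s'')"
      "d' \<in> D"
      "\<exists>sg. (\<forall>w\<in>D. f d' + sg \<bullet> (w - d') + \<mu> / 2 * (norm (w - d'))\<^sup>2 \<le> f w) \<and> norm (G d' + sg) \<le> \<epsilon>"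
      "m s'' \<le> m (tick s') + (j + 1) * ((J + 1) * (2 * Nc + ct) + ct)"
      by blast
    have "iapg_loop orc \<psi> \<phi> tick Lmin \<mu> \<epsilon> \<gamma>u \<gamma>d k A v \<pi> E L s = Some (d', s'')"
      using False by (subst iapg_loop.simps)
        (simp add: ls(1) E'_def[symmetric] \<pi>'_def[symmetric] Let_def rec(1)[simplified])
    moreover have "m s'' \<le> m s + (Suc j + 1) * ((J + 1) * (2 * Nc + ct) + ct)"
      using rec(4) ls(5) tick[of s'] by simp
    ultimately show ?thesis using rec(2,3) by blast
  qed
qed

text \<open>The iterations are numbered from \<open>0\<close> to at most \<open>K + 1\<close>. Each has at most \<open>J + 1\<close> trials with two
  gradients and one proximal step, and one further proximal step for the estimating function.\<close>

theorem iapg_terminates: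
  assumes \<Lambda>: "1 \<le> \<Lambda> (n_iapg s)" "\<Lambda> (n_iapg s) * Lmin \<le> Lmax"
    and m: "m (s\<lparr>n_iapg := n_iapg s + 1\<rparr>) = m s"
  shows "\<exists>d s'. iapg \<Lambda> orc \<psi> \<phi> tick v0 Lmin \<mu> \<epsilon> \<gamma>u \<gamma>d s = Some (d, s') \<and> d \<in> D \<and>
    (\<exists>sg. (\<forall>w\<in>D. f d + sg \<bullet> (w - d) + \<mu> / 2 * (norm (w - d))\<^sup>2 \<le> f w) \<and> norm (G d + sg) \<le> \<epsilon>) \<and>
    m s' \<le> m s + (K + 2) * ((J + 1) * (2 * Nc + ct) + ct)"
proof -
  have "Lmin \<le> \<Lambda> (n_iapg s) * Lmin" using \<Lambda>(1) params by simp
  from iapg_loop_terminates[OF _ Inv_initial A1_nonneg this \<Lambda>(2), of "K + 1" "s\<lparr>n_iapg := n_iapg s + 1\<rparr>"]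
  show ?thesis unfolding iapg_def m by simp
qed

end

section \<open>Cocoercive gradients and the quadratic penalty\<close>

lemma grad_eq: "GDERIV f x :> D \<Longrightarrow> grad f x = D"
proof -
  assume D: "GDERIV f x :> D"
  have "D' = D" if "GDERIV f x :> D'" for D'
    using has_derivative_unique[OF that[unfolded gderiv_def] D[unfolded gderiv_def]]
    by (metis inner_commute vector_eq_rdot)
  then show ?thesis unfolding grad_def using D by (intro the_equality)
qed

lemma GDERIV_grad:
  fixes f :: "'a::euclidean_space \<Rightarrow> real"
  assumes "f differentiable (at x)"
  shows "GDERIV f x :> grad f x"
proof -
  obtain f' where f': "(f has_derivative f') (at x)" using assms by (auto simp: differentiable_def)
  have lin: "linear f'" using f' by (rule has_derivative_linear)
  have "f' h = h \<bullet> (\<Sum>b\<in>Basis. f' b *\<^sub>R b)" for h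
  proof -
    have "f' h = f' (\<Sum>b\<in>Basis. (h \<bullet> b) *\<^sub>R b)" by (simp add: euclidean_representation)
    also have "\<dots> = h \<bullet> (\<Sum>b\<in>Basis. f' b *\<^sub>R b)"
      by (simp add: linear_sum[OF lin] linear_scale[OF lin] inner_sum_right mult.commute)
    finally show ?thesis .
  qed
  then have "f' = (\<lambda>h. h \<bullet> (\<Sum>b\<in>Basis. f' b *\<^sub>R b))" by (rule ext)
  with f' have "GDERIV f x :> (\<Sum>b\<in>Basis. f' b *\<^sub>R b)" unfolding gderiv_def by (rule back_subst)
  with grad_eq[OF this] show ?thesis by simp
qed

text \<open>The difference quotients along the segment from \<open>x\<close> to \<open>w\<close> are bounded by \<open>f w - f x\<close>.\<close>

lemma convex_on_above_tangent:
  fixes f :: "'a::real_normed_vector \<Rightarrow> real"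
  assumes cvx: "convex_on UNIV f" and f': "(f has_derivative f') (at x)"
  shows "f x + f' (w - x) \<le> f w"
proof -
  let ?e = "w - x"
  have "((\<lambda>t. f (x + t *\<^sub>R ?e)) has_derivative (\<lambda>t. f' (t *\<^sub>R ?e))) (at (0::real))"
    by (rule has_derivative_compose[where g = f]) (use f' in \<open>auto intro!: derivative_eq_intros\<close>)
  also have "(\<lambda>t. f' (t *\<^sub>R ?e)) = (*) (f' ?e)"
    using linear_scale[OF has_derivative_linear[OF f']] by (auto simp: mult.commute)
  finally have "((\<lambda>h. (f (x + h *\<^sub>R ?e) - f x) / h) \<longlongrightarrow> f' ?e) (at 0)"
    by (simp add: has_field_derivative_def[symmetric] DERIV_def)
  then have lim: "((\<lambda>h. (f (x + h *\<^sub>R ?e) - f x) / h) \<longlongrightarrow> f' ?e) (at_right 0)"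
    by (rule tendsto_mono[rotated]) (simp add: at_le)
  have le: "(f (x + h *\<^sub>R ?e) - f x) / h \<le> f w - f x" if h: "0 < h" "h < 1" for h
  proof -
    have "f ((1 - h) *\<^sub>R x + h *\<^sub>R w) \<le> (1 - h) * f x + h * f w"
      using h by (intro convex_onD[OF cvx]) auto
    then have "f (x + h *\<^sub>R ?e) - f x \<le> (f w - f x) * h" by (simp add: algebra_simps)
    then show ?thesis using h by (simp add: divide_le_eq)
  qed
  have "\<forall>\<^sub>F h in at_right 0. (f (x + h *\<^sub>R ?e) - f x) / h \<le> f w - f x"
    by (rule eventually_mono[OF eventually_at_right_real[OF zero_less_one]]) (rule le, auto)
  from tendsto_upperbound[OF lim this] show ?thesis by simp
qed

text \<open>The Baillon--Haddad argument: apply the descent inequality at \<open>y\<close> and the tangent at \<open>x\<close> to the point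
  reached from \<open>y\<close> by a gradient step for \<open>\<psi> - G x\<close>. The constant is \<open>2L\<close> rather than \<open>L\<close> because the descent
  inequality is derived from the tangents alone, without integrating \<open>G\<close>; in return \<open>G\<close> may be any selection
  of subgradients.\<close>

lemma cocoercive_of_lipschitz:
  fixes \<psi> :: "'a::real_inner \<Rightarrow> real" and G :: "'a \<Rightarrow> 'a"
  assumes sub: "\<And>v w. v \<in> S \<Longrightarrow> w \<in> S \<Longrightarrow> \<psi> v + G v \<bullet> (w - v) \<le> \<psi> w"
    and lip: "\<And>v w. v \<in> S \<Longrightarrow> w \<in> S \<Longrightarrow> norm (G v - G w) \<le> L * norm (v - w)" and L: "0 < L"
    and S: "x \<in> S" "y \<in> S" "y - (1 / (2 * L)) *\<^sub>R (G y - G x) \<in> S" "x - (1 / (2 * L)) *\<^sub>R (G x - G y) \<in> S"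
  shows "(norm (G x - G y))\<^sup>2 \<le> 2 * L * ((G x - G y) \<bullet> (x - y))"
proof -
  have half: "\<psi> x + G x \<bullet> (y - x) + (norm (G x - G y))\<^sup>2 / (4 * L) \<le> \<psi> y"
    if xy: "x \<in> S" "y \<in> S" "y - (1 / (2 * L)) *\<^sub>R (G y - G x) \<in> S" for x y
  proof -
    define \<Delta> where "\<Delta> = G y - G x"
    define p where "p = y - (1 / (2 * L)) *\<^sub>R \<Delta>"
    have p: "p \<in> S" using xy by (simp add: p_def \<Delta>_def)
    have py: "p - y = - (1 / (2 * L)) *\<^sub>R \<Delta>" by (simp add: p_def)
    have "\<psi> p \<le> \<psi> y + G p \<bullet> (p - y)" using sub[OF p xy(2)] by (simp add: inner_diff_right)
    also have "\<dots> = \<psi> y + G y \<bullet> (p - y) + (G p - G y) \<bullet> (p - y)" by (simp add: inner_diff_left)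
    also have "(G p - G y) \<bullet> (p - y) \<le> L * norm (p - y) * norm (p - y)"
      using norm_cauchy_schwarz[of "G p - G y" "p - y"]
        mult_right_mono[OF lip[OF p xy(2)], of "norm (p - y)"] by simp
    also have "L * norm (p - y) * norm (p - y) = (norm \<Delta>)\<^sup>2 / (4 * L)"
      unfolding py using L by (simp add: power2_eq_square field_simps)
    finally have "\<psi> x + G x \<bullet> (p - x) \<le> \<psi> y + G y \<bullet> (p - y) + (norm \<Delta>)\<^sup>2 / (4 * L)"
      using sub[OF xy(1) p] by linarith
    moreover have "G x \<bullet> (p - x) = G x \<bullet> (y - x) + G y \<bullet> (p - y) - \<Delta> \<bullet> (p - y)"
      by (simp add: \<Delta>_def inner_diff_left inner_diff_right)
    moreover have "\<Delta> \<bullet> (p - y) = - (norm \<Delta>)\<^sup>2 / (2 * L)"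
      unfolding py by (simp add: power2_norm_eq_inner)
    moreover have "(norm \<Delta>)\<^sup>2 / (2 * L) = 2 * ((norm \<Delta>)\<^sup>2 / (4 * L))" by simp
    ultimately show ?thesis by (simp add: \<Delta>_def norm_minus_commute)
  qed
  from half[OF S(1,2,3)] half[OF S(2,1,4)]
  have "(norm (G x - G y))\<^sup>2 / (2 * L) \<le> (G x - G y) \<bullet> (x - y)"
    by (simp add: inner_diff_left inner_diff_right norm_minus_commute[of "G y"] field_simps)
  then show ?thesis using L by (simp add: field_simps)
qed

text \<open>For data that are Lipschitz only on bounded sets. The auxiliary points of
  \<open>cocoercive_of_lipschitz\<close> are within \<open>|x - y|/2 \<le> r\<close> of \<open>x\<close> or \<open>y\<close>, so doubling the ball is enough.\<close>

lemma cocoercive_on_cball: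
  fixes \<psi> :: "'a::real_inner \<Rightarrow> real" and G :: "'a \<Rightarrow> 'a"
  assumes sub: "\<And>v w. \<psi> v + G v \<bullet> (w - v) \<le> \<psi> w"
    and lip: "\<And>v w. v \<in> cball a (2 * r) \<Longrightarrow> w \<in> cball a (2 * r) \<Longrightarrow> norm (G v - G w) \<le> L * norm (v - w)"
    and L: "0 < L" and xy: "x \<in> cball a r" "y \<in> cball a r"
  shows "(norm (G x - G y))\<^sup>2 \<le> 2 * L * ((G x - G y) \<bullet> (x - y))"
proof (rule cocoercive_of_lipschitz[where S = "cball a (2 * r)" and \<psi> = \<psi>])
  have r: "0 \<le> r" using xy(1) by (metis mem_cball zero_le_dist order_trans)
  then show big: "x \<in> cball a (2 * r)" "y \<in> cball a (2 * r)" using xy by auto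
  have step: "y - (1 / (2 * L)) *\<^sub>R (G y - G x) \<in> cball a (2 * r)" if "x \<in> cball a r" "y \<in> cball a r" for x y
  proof -
    have big: "x \<in> cball a (2 * r)" "y \<in> cball a (2 * r)" using that r by auto
    have n: "norm (y - a) \<le> r" "norm (x - a) \<le> r" using that by (auto simp: dist_norm norm_minus_commute)
    have "norm (y - x) \<le> 2 * r"
      using norm_triangle_ineq4[of "y - a" "x - a"] n by simp
    then have "norm (G y - G x) \<le> L * (2 * r)"
      using lip[OF big(2,1)] mult_left_mono[of "norm (y - x)" "2 * r" L] L by linarith
    then have "norm ((1 / (2 * L)) *\<^sub>R (G y - G x)) \<le> r"
      unfolding norm_scaleR using L by (simp add: divide_le_eq mult_ac)
    then have "norm (y - a - (1 / (2 * L)) *\<^sub>R (G y - G x)) \<le> 2 * r"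
      using n(1) norm_triangle_ineq4[of "y - a" "(1 / (2 * L)) *\<^sub>R (G y - G x)"] by linarith
    then show ?thesis by (simp add: dist_norm norm_minus_commute algebra_simps)
  qed
  show "y - (1 / (2 * L)) *\<^sub>R (G y - G x) \<in> cball a (2 * r)" "x - (1 / (2 * L)) *\<^sub>R (G x - G y) \<in> cball a (2 * r)"
    using step xy by auto
qed (use sub lip L in auto)

lemma cocoercive_add:
  fixes d e :: "'a::real_inner"
  assumes "(norm d)\<^sup>2 \<le> L * (d \<bullet> v)" "(norm e)\<^sup>2 \<le> M * (e \<bullet> v)" "0 < L" "0 < M"
  shows "(norm (d + e))\<^sup>2 \<le> (L + M) * ((d + e) \<bullet> v)"
proof -
  have "0 \<le> (norm (M *\<^sub>R d - L *\<^sub>R e))\<^sup>2 / (L * M)" using assms by simp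
  also have "\<dots> = M / L * (norm d)\<^sup>2 + L / M * (norm e)\<^sup>2 - 2 * (d \<bullet> e)"
    using assms(3,4) unfolding power2_norm_eq_inner
    by (simp add: inner_diff_left inner_diff_right inner_commute field_simps)
  finally have "(norm (d + e))\<^sup>2 \<le> (L + M) * ((norm d)\<^sup>2 / L) + (L + M) * ((norm e)\<^sup>2 / M)"
    using assms(3,4) unfolding power2_norm_eq_inner
    by (simp add: inner_add_left inner_add_right inner_commute field_simps)
  also have "\<dots> \<le> (L + M) * (d \<bullet> v) + (L + M) * (e \<bullet> v)"
    using assms by (intro add_mono mult_left_mono) (auto simp: divide_le_eq mult.commute)
  finally show ?thesis by (simp add: inner_add_left algebra_simps)
qed

lemma norm_matrix_vector_le:
  fixes A :: "real^'a^'b"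
  shows "norm (A *v x) \<le> norm A * norm x"
proof -
  have "norm (A *v x) \<le> L2_set (\<lambda>i. norm (A $ i) * norm x) UNIV"
    unfolding norm_vec_def[of "A *v x"]
    by (intro L2_set_mono) (auto simp: matrix_vector_mul_component Cauchy_Schwarz_ineq2)
  also have "\<dots> = norm A * norm x"
    unfolding norm_vec_def[of A] by (simp add: L2_set_left_distrib)
  finally show ?thesis .
qed

lemma inner_transpose_mult:
  fixes A :: "real^'a^'b"
  shows "(transpose A *v y) \<bullet> x = y \<bullet> (A *v x)"
  by (simp add: dot_lmul_matrix)

lemma norm_transpose_mult_le:
  fixes A :: "real^'a^'b"
  shows "norm (transpose A *v y) \<le> norm A * norm y"
proof -
  let ?t = "transpose A *v y"
  have "norm ?t * norm ?t = y \<bullet> (A *v ?t)"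
    by (metis inner_transpose_mult power2_norm_eq_inner power2_eq_square)
  also have "\<dots> \<le> norm y * (norm A * norm ?t)"
    using norm_cauchy_schwarz[of y "A *v ?t"] mult_left_mono[OF norm_matrix_vector_le[of A ?t], of "norm y"] norm_ge_zero[of y]
    by linarith
  also have "\<dots> = (norm A * norm y) * norm ?t" by (simp only: mult_ac)
  finally show ?thesis
    by (cases "norm ?t = 0") (simp, metis mult_right_le_imp_le norm_ge_zero order_le_less)
qed

lemma pos_nth [simp]: "pos a $ i = max (a $ i) 0"
  by (simp add: pos_def)

lemma norm_pos_diff_le: "norm (pos a - pos b) \<le> norm (a - b)"
  by (intro norm_le_componentwise_cart) auto

lemma norm_pos_le: "norm (pos a) \<le> norm a"
  by (intro norm_le_componentwise_cart) auto

lemma half_sq_pos_above_tangent: "(max r 0)\<^sup>2 / 2 + max r 0 * (s - r) \<le> (max s 0)\<^sup>2 / (2::real)"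
proof -
  have "0 \<le> (r - s)\<^sup>2" "0 \<le> r\<^sup>2" by simp_all
  moreover have "0 < r \<Longrightarrow> s \<le> 0 \<Longrightarrow> r * s \<le> 0" by (simp add: mult_nonneg_nonpos)
  ultimately show ?thesis
    by (cases "r \<le> 0"; cases "s \<le> 0") (auto simp: max_def power2_eq_square algebra_simps)
qed

lemma norm_sq_cart: "(norm (a::real^'k))\<^sup>2 = (\<Sum>i\<in>UNIV. (a $ i)\<^sup>2)"
  unfolding power2_norm_eq_inner inner_vec_def by (simp add: power2_eq_square)

lemma inner_le_pos_mult: "(\<Sum>i\<in>UNIV. \<bar>(a::real^'k) $ i * b $ i\<bar>) \<le> norm a * norm b"
proof -
  have "(\<Sum>i\<in>UNIV. \<bar>a $ i * b $ i\<bar>) = (\<chi> i. \<bar>a $ i\<bar>) \<bullet> (\<chi> i. \<bar>b $ i\<bar>)"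
    by (simp add: inner_vec_def abs_mult)
  also have "\<dots> \<le> norm (\<chi> i. \<bar>a $ i\<bar>) * norm (\<chi> i. \<bar>b $ i\<bar>)" by (rule norm_cauchy_schwarz)
  also have "\<dots> = norm a * norm b" by (simp add: norm_vec_def)
  finally show ?thesis .
qed

text \<open>One system of convex inequality constraints; it is instantiated for \<open>c\<close> and for \<open>p\<close>.\<close>

locale convex_constraint =
  fixes c :: "real^'n \<Rightarrow> real^'q" and Lc :: real
  assumes cvx: "\<And>i. convex_on UNIV (\<lambda>x. c x $ i)"
    and diff: "\<And>i x. (\<lambda>x. c x $ i) differentiable (at x)"
    and lip: "Lc-lipschitz_on UNIV (Jac c)"
begin

definition pen :: "real \<Rightarrow> real^'q \<Rightarrow> real^'n \<Rightarrow> real" where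
  "pen \<beta> z x = 1 / (2 * \<beta>) * (norm (pos (\<beta> *\<^sub>R c x + z)))\<^sup>2"

definition pen_grad :: "real \<Rightarrow> real^'q \<Rightarrow> real^'n \<Rightarrow> real^'n" where
  "pen_grad \<beta> z x = transpose (Jac c x) *v pos (\<beta> *\<^sub>R c x + z)"

lemma has_derivative: "(c has_derivative (\<lambda>h. Jac c x *v h)) (at x)"
proof -
  have "c differentiable (at x)"
    using diff by (subst differentiable_componentwise_within)
      (auto simp: Basis_vec_def inner_axis)
  then show ?thesis by (simp add: jacobian_works)
qed

lemma has_derivative_nth: "((\<lambda>x. c x $ i) has_derivative (\<lambda>h. (Jac c x *v h) $ i)) (at x)"
  using has_derivative[of x] bounded_linear.has_derivative[OF bounded_linear_vec_nth] by blast

lemma above_tangent: "c x $ i + (Jac c x *v (w - x)) $ i \<le> c w $ i"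
  by (rule convex_on_above_tangent[OF cvx has_derivative_nth])

lemma continuous_c: "continuous_on S c"
  using has_derivative has_derivative_continuous
  by (blast intro: continuous_at_imp_continuous_on)

text \<open>The scalar inequality for \<open>r \<mapsto> max r 0\<^sup>2 / 2\<close> is combined with convexity of the components, the
  slope \<open>max r 0\<close> being nonnegative.\<close>

lemma pen_above_tangent:
  assumes "0 < \<beta>"
  shows "pen \<beta> z x + pen_grad \<beta> z x \<bullet> (w - x) \<le> pen \<beta> z w"
proof -
  let ?r = "\<lambda>i. \<beta> * c x $ i + z $ i" and ?s = "\<lambda>i. \<beta> * c w $ i + z $ i"
  have *: "(max (?r i) 0)\<^sup>2 / 2 + \<beta> * (max (?r i) 0 * (Jac c x *v (w - x)) $ i) \<le> (max (?s i) 0)\<^sup>2 / 2" for i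
  proof -
    have "\<beta> * (Jac c x *v (w - x)) $ i \<le> ?s i - ?r i"
      using mult_left_mono[OF above_tangent[of x i w], of \<beta>] assms by (simp add: algebra_simps)
    then have "max (?r i) 0 * (\<beta> * (Jac c x *v (w - x)) $ i) \<le> max (?r i) 0 * (?s i - ?r i)"
      by (intro mult_left_mono) auto
    then show ?thesis using half_sq_pos_above_tangent[of "?r i" "?s i"] by (simp add: mult.left_commute)
  qed
  have "(\<Sum>i\<in>UNIV. (max (?r i) 0)\<^sup>2 / 2 + \<beta> * (max (?r i) 0 * (Jac c x *v (w - x)) $ i))
      \<le> (\<Sum>i\<in>UNIV. (max (?s i) 0)\<^sup>2 / 2)"
    by (intro sum_mono *)
  then have "(norm (pos (\<beta> *\<^sub>R c x + z)))\<^sup>2 / 2 + \<beta> * (pos (\<beta> *\<^sub>R c x + z) \<bullet> (Jac c x *v (w - x)))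
      \<le> (norm (pos (\<beta> *\<^sub>R c w + z)))\<^sup>2 / 2"
    unfolding norm_sq_cart inner_vec_def by (simp add: sum.distrib sum_distrib_left sum_divide_distrib)
  from mult_left_mono[OF this, of "1 / \<beta>"] assms
  show ?thesis unfolding pen_def pen_grad_def inner_transpose_mult by (simp add: distrib_left)
qed

lemma GDERIV_pen:
  assumes "0 < \<beta>"
  shows "GDERIV (pen \<beta> z) x :> pen_grad \<beta> z x"
proof -
  have pos_deriv: "((\<lambda>r. (max r 0)\<^sup>2) has_real_derivative 2 * max r 0) (at r)" for r :: real
  proof (cases "r = 0")
    case True
    have "((\<lambda>h. (max h 0)\<^sup>2 / h) \<longlongrightarrow> 0) (at (0::real))"
    proof (rule tendsto_rabs_zero_cancel, rule tendsto_sandwich[of "\<lambda>_. 0" _ _ "\<lambda>h. \<bar>h\<bar>"])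
      show "\<forall>\<^sub>F h in at (0::real). \<bar>(max h 0)\<^sup>2 / h\<bar> \<le> \<bar>h\<bar>"
        by (auto simp: max_def power2_eq_square)
      show "((\<lambda>h. \<bar>h\<bar>) \<longlongrightarrow> 0) (at (0::real))" by (rule tendsto_rabs_zero) (rule tendsto_ident_at)
    qed auto
    then show ?thesis by (simp add: True DERIV_def)
  next
    case False
    show ?thesis
    proof (cases "0 < r")
      case True
      have "((\<lambda>r. r\<^sup>2) has_real_derivative 2 * r) (at r)" by (auto intro!: derivative_eq_intros)
      from has_field_derivative_transform_within_open[OF this open_greaterThan[of 0]] True
      show ?thesis by auto
    next
      case F2: False
      with False have r: "r < 0" by simp
      have "((\<lambda>r. 0) has_real_derivative 0) (at r)" by simp
      from has_field_derivative_transform_within_open[OF this open_lessThan[of 0]] r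
      show ?thesis by auto
    qed
  qed
  have "((\<lambda>x. (max (\<beta> * c x $ i + z $ i) 0)\<^sup>2) has_derivative
      (\<lambda>h. 2 * max (\<beta> * c x $ i + z $ i) 0 * (\<beta> * (Jac c x *v h) $ i))) (at x)" for i
  proof -
    have "((\<lambda>x. \<beta> * c x $ i + z $ i) has_derivative (\<lambda>h. \<beta> * (Jac c x *v h) $ i)) (at x)"
      by (auto intro!: derivative_eq_intros has_derivative_nth)
    from has_derivative_compose[OF this pos_deriv[unfolded has_field_derivative_def]]
    show ?thesis .
  qed
  then have "((\<lambda>x. 1 / (2 * \<beta>) * (\<Sum>i\<in>UNIV. (max (\<beta> * c x $ i + z $ i) 0)\<^sup>2)) has_derivative
      (\<lambda>h. 1 / (2 * \<beta>) * (\<Sum>i\<in>UNIV. 2 * max (\<beta> * c x $ i + z $ i) 0 * (\<beta> * (Jac c x *v h) $ i)))) (at x)"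
    by (intro has_derivative_mult_right has_derivative_sum)
  moreover have "(\<lambda>x. 1 / (2 * \<beta>) * (\<Sum>i\<in>UNIV. (max (\<beta> * c x $ i + z $ i) 0)\<^sup>2)) = pen \<beta> z"
    unfolding pen_def norm_sq_cart by simp
  moreover have "1 / (2 * \<beta>) * (\<Sum>i\<in>UNIV. 2 * max (\<beta> * c x $ i + z $ i) 0 * (\<beta> * (Jac c x *v h) $ i))
      = h \<bullet> pen_grad \<beta> z x" for h
  proof -
    have "h \<bullet> pen_grad \<beta> z x = (\<Sum>i\<in>UNIV. max (\<beta> * c x $ i + z $ i) 0 * (Jac c x *v h) $ i)"
      unfolding pen_grad_def inner_commute[of h] inner_transpose_mult by (simp add: inner_vec_def)
    moreover have "(\<Sum>i\<in>UNIV. 2 * max (\<beta> * c x $ i + z $ i) 0 * (\<beta> * (Jac c x *v h) $ i))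
      = 2 * \<beta> * (\<Sum>i\<in>UNIV. max (\<beta> * c x $ i + z $ i) 0 * (Jac c x *v h) $ i)"
      by (simp add: sum_distrib_left mult_ac)
    ultimately show ?thesis using assms by simp
  qed
  ultimately show ?thesis unfolding gderiv_def by simp
qed

lemma bounded_on_compact:
  assumes "compact S"
  obtains B where "0 < B" "\<And>x. x \<in> S \<Longrightarrow> norm (c x) \<le> B" "\<And>x. x \<in> S \<Longrightarrow> norm (Jac c x) \<le> B"
proof -
  have "continuous_on S (Jac c)"
    using lipschitz_on_continuous_on[OF lip] continuous_on_subset by blast
  then have "bounded (Jac c ` S)" "bounded (c ` S)"
    using assms continuous_c by (auto intro: compact_imp_bounded compact_continuous_image)
  then obtain B1 B2 where "\<forall>x\<in>S. norm (Jac c x) \<le> B1" "\<forall>x\<in>S. norm (c x) \<le> B2"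
    unfolding bounded_iff by auto
  then show ?thesis
    by (intro that[of "max 1 (max B1 B2)"]) auto
qed

lemma c_lipschitz:
  assumes S: "convex S" "\<And>x. x \<in> S \<Longrightarrow> norm (Jac c x) \<le> B" and xw: "x \<in> S" "w \<in> S"
  shows "norm (c x - c w) \<le> B * norm (x - w)"
proof (rule differentiable_bound[OF S(1) has_derivative_at_withinI[OF has_derivative]])
  show "onorm ((*v) (Jac c v)) \<le> B" if "v \<in> S" for v
    by (rule onorm_le) (use S(2)[OF that] norm_matrix_vector_le mult_right_mono norm_ge_zero order_trans in meson)
qed (use xw in auto)

lemma pen_grad_lipschitz:
  assumes S: "convex S" "\<And>x. x \<in> S \<Longrightarrow> norm (Jac c x) \<le> B" "\<And>x. x \<in> S \<Longrightarrow> norm (c x) \<le> B"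
    and xw: "x \<in> S" "w \<in> S" and \<beta>: "0 \<le> \<beta>" and z: "norm z \<le> Z"
  shows "norm (pen_grad \<beta> z x - pen_grad \<beta> z w) \<le> (Lc * (\<beta> * B + Z) + \<beta> * B\<^sup>2) * norm (x - w)"
proof -
  define p where "p v = pos (\<beta> *\<^sub>R c v + z)" for v
  have B: "0 \<le> B" using S(2)[OF xw(1)] norm_ge_zero order_trans by blast
  have Lc: "0 \<le> Lc" using lip by (rule lipschitz_on_nonneg)
  have p: "norm (p x) \<le> \<beta> * B + Z"
  proof -
    have "norm (p x) \<le> norm (\<beta> *\<^sub>R c x) + norm z" unfolding p_def
      using norm_pos_le norm_triangle_ineq order_trans by blast
    also have "norm (\<beta> *\<^sub>R c x) \<le> \<beta> * B" using S(3)[OF xw(1)] \<beta> by (simp add: mult_left_mono)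
    finally show ?thesis using z by simp
  qed
  have dp: "norm (p x - p w) \<le> \<beta> * (B * norm (x - w))"
  proof -
    have "norm (p x - p w) \<le> norm ((\<beta> *\<^sub>R c x + z) - (\<beta> *\<^sub>R c w + z))"
      unfolding p_def by (rule norm_pos_diff_le)
    also have "\<dots> = \<beta> * norm (c x - c w)" using \<beta> by (simp add: scaleR_diff_right[symmetric])
    also have "\<dots> \<le> \<beta> * (B * norm (x - w))" using c_lipschitz[OF S(1,2) xw] \<beta> by (intro mult_left_mono) auto
    finally show ?thesis .
  qed
  have "pen_grad \<beta> z x - pen_grad \<beta> z w
      = transpose (Jac c x - Jac c w) *v p x + transpose (Jac c w) *v (p x - p w)"
  proof -
    have "(transpose A *v y) $ j = (\<Sum>i\<in>UNIV. A $ i $ j * y $ i)" for A :: "real^'n^'q" and y j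
      by (simp only: matrix_vector_mult_def transpose_def vec_lambda_beta)
    then show ?thesis
      unfolding pen_grad_def p_def[symmetric] vec_eq_iff
      by (simp only: vector_minus_component vector_add_component sum_subtractf[symmetric] sum.distrib[symmetric])
        (intro allI sum.cong refl, simp add: algebra_simps)
  qed
  then have "norm (pen_grad \<beta> z x - pen_grad \<beta> z w)
      \<le> norm (transpose (Jac c x - Jac c w) *v p x) + norm (transpose (Jac c w) *v (p x - p w))"
    by (simp only: norm_triangle_ineq)
  also have "\<dots> \<le> norm (Jac c x - Jac c w) * norm (p x) + norm (Jac c w) * norm (p x - p w)"
    by (intro add_mono norm_transpose_mult_le)
  also have "norm (Jac c x - Jac c w) * norm (p x) \<le> (Lc * norm (x - w)) * (\<beta> * B + Z)"
    using lipschitz_on_normD[OF lip] p Lc by (intro mult_mono) auto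
  also have "norm (Jac c w) * norm (p x - p w) \<le> B * (\<beta> * (B * norm (x - w)))"
    using S(2)[OF xw(2)] dp B by (intro mult_mono) auto
  finally show ?thesis by (simp add: power2_eq_square algebra_simps)
qed

lemma pen_cocoercive:
  assumes B: "\<And>x. x \<in> cball a (2 * r) \<Longrightarrow> norm (Jac c x) \<le> B" "\<And>x. x \<in> cball a (2 * r) \<Longrightarrow> norm (c x) \<le> B"
    and xw: "x \<in> cball a r" "w \<in> cball a r" and \<beta>: "0 < \<beta>" and z: "norm z \<le> Z"
  shows "(norm (pen_grad \<beta> z x - pen_grad \<beta> z w))\<^sup>2
    \<le> 2 * (Lc * (\<beta> * B + Z) + \<beta> * B\<^sup>2 + 1) * ((pen_grad \<beta> z x - pen_grad \<beta> z w) \<bullet> (x - w))"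
proof (rule cocoercive_on_cball[where \<psi> = "pen \<beta> z"])
  have "0 \<le> r" using xw(1) by (metis mem_cball zero_le_dist order_trans)
  then have "x \<in> cball a (2 * r)" using xw by auto
  then have "0 \<le> B" using B(1) norm_ge_zero order_trans by blast
  moreover have "0 \<le> Z" using z norm_ge_zero order_trans by blast
  moreover have "0 \<le> Lc" using lip by (rule lipschitz_on_nonneg)
  ultimately show pos: "0 < Lc * (\<beta> * B + Z) + \<beta> * B\<^sup>2 + 1"
    using \<beta> by (simp add: add_nonneg_pos)
  show "norm (pen_grad \<beta> z v - pen_grad \<beta> z w) \<le> (Lc * (\<beta> * B + Z) + \<beta> * B\<^sup>2 + 1) * norm (v - w)"
    if "v \<in> cball a (2 * r)" "w \<in> cball a (2 * r)" for v w
    using pen_grad_lipschitz[OF convex_cball B that less_imp_le[OF \<beta>] z] by (simp add: distrib_right add_increasing2)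
qed (use xw pen_above_tangent[OF \<beta>] in auto)

end

section \<open>Composite convex minimisation\<close>

lemma norm_le_of_cocoercive:
  fixes d e :: "'a::real_inner"
  assumes "(norm d)\<^sup>2 \<le> L * (d \<bullet> e)" "0 \<le> L"
  shows "norm d \<le> L * norm e"
proof -
  have "norm d * norm d \<le> (L * norm e) * norm d"
    using assms mult_left_mono[OF norm_cauchy_schwarz[of d e] assms(2)]
    by (simp add: power2_eq_square mult_ac)
  then show ?thesis
    using assms(2) by (cases "d = 0") (simp_all only: norm_zero mult_nonneg_nonneg norm_ge_zero
      mult_le_cancel_right_pos zero_less_norm_iff not_False_eq_True)
qed

text \<open>The common shape of the inner and the outer problem. \<open>G\<close> is a selection of subgradients of \<open>\<psi>\<close>, not
  necessarily a gradient; cocoercivity replaces smoothness.\<close>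

locale composite_problem =
  fixes \<psi> f :: "'v::euclidean_space \<Rightarrow> real" and G :: "'v \<Rightarrow> 'v" and D :: "'v set" and \<mu> Lbar :: real
  assumes D: "closed D" "D \<noteq> {}"
    and f: "strongly_convex_on D \<mu> f" "continuous_on D f"
    and subgrad: "\<And>v w. v \<in> D \<Longrightarrow> w \<in> D \<Longrightarrow> \<psi> v + G v \<bullet> (w - v) \<le> \<psi> w"
    and coco: "\<And>v w. v \<in> D \<Longrightarrow> w \<in> D \<Longrightarrow> (norm (G v - G w))\<^sup>2 \<le> Lbar * ((G v - G w) \<bullet> (v - w))"
    and pos: "0 < \<mu>" "0 < Lbar"
begin

lemma descent:
  assumes "v \<in> D" "w \<in> D"
  shows "\<psi> w \<le> \<psi> v + G v \<bullet> (w - v) + Lbar * (norm (w - v))\<^sup>2"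
proof -
  have "\<psi> w \<le> \<psi> v + G v \<bullet> (w - v) + (G w - G v) \<bullet> (w - v)"
    using subgrad[OF assms(2,1)] by (simp add: inner_diff_left inner_diff_right)
  also have "(G w - G v) \<bullet> (w - v) \<le> Lbar * norm (w - v) * norm (w - v)"
    using norm_cauchy_schwarz[of "G w - G v" "w - v"] pos
      mult_right_mono[OF norm_le_of_cocoercive[OF coco[OF assms(2,1)]], of "norm (w - v)"] by simp
  finally show ?thesis by (simp add: power2_eq_square)
qed

lemma continuous: "continuous_on D \<psi>"
  unfolding continuous_on_def
proof
  fix v assume v: "v \<in> D"
  show "(\<psi> \<longlongrightarrow> \<psi> v) (at v within D)"
  proof (rule tendsto_sandwich)
    show "\<forall>\<^sub>F w in at v within D. \<psi> v + G v \<bullet> (w - v) \<le> \<psi> w"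
      using subgrad[OF v] by (auto simp: eventually_at_filter)
    show "\<forall>\<^sub>F w in at v within D. \<psi> w \<le> \<psi> v + G v \<bullet> (w - v) + Lbar * (norm (w - v))\<^sup>2"
      using descent[OF v] by (auto simp: eventually_at_filter)
    have "((\<lambda>w. \<psi> v + G v \<bullet> (w - v)) \<longlongrightarrow> \<psi> v + G v \<bullet> (v - v)) (at v within D)"
      by (intro tendsto_intros)
    then show "((\<lambda>w. \<psi> v + G v \<bullet> (w - v)) \<longlongrightarrow> \<psi> v) (at v within D)" by simp
    have "((\<lambda>w. \<psi> v + G v \<bullet> (w - v) + Lbar * (norm (w - v))\<^sup>2)
        \<longlongrightarrow> \<psi> v + G v \<bullet> (v - v) + Lbar * (norm (v - v))\<^sup>2) (at v within D)"
      by (intro tendsto_intros)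
    then show "((\<lambda>w. \<psi> v + G v \<bullet> (w - v) + Lbar * (norm (w - v))\<^sup>2) \<longlongrightarrow> \<psi> v) (at v within D)"
      by simp
  qed
qed

text \<open>First-order optimality without differentiability of \<open>\<psi>\<close>: by \<open>descent\<close> the slope \<open>G vs\<close> is exact up to
  a term of second order in \<open>t\<close> along \<open>(1 - t) vs + t w\<close>.\<close>

lemma minimizer_stationary:
  assumes vs: "vs \<in> D" "\<And>w. w \<in> D \<Longrightarrow> \<psi> vs + f vs \<le> \<psi> w + f w" and w: "w \<in> D"
  shows "f vs + (- G vs) \<bullet> (w - vs) + \<mu> / 2 * (norm (w - vs))\<^sup>2 \<le> f w"
proof -
  define n where "n = (norm (w - vs))\<^sup>2"
  have *: "\<mu> / 2 * (1 - t) * n - Lbar * t * n \<le> f w - f vs + G vs \<bullet> (w - vs)" if t: "0 < t" "t < 1" for t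
  proof -
    let ?p = "(1 - t) *\<^sub>R vs + t *\<^sub>R w"
    have p: "?p \<in> D"
      using strongly_convex_on_convex[OF f(1)] vs(1) w t by (simp add: convex_def)
    have pv: "?p - vs = t *\<^sub>R (w - vs)" by (simp add: algebra_simps)
    have "\<psi> ?p \<le> \<psi> vs + t * (G vs \<bullet> (w - vs)) + Lbar * (t * t * n)"
      using descent[OF vs(1) p] unfolding pv n_def by (simp add: power2_eq_square mult_ac)
    moreover have "f ?p \<le> (1 - t) * f vs + t * f w - \<mu> / 2 * (t * (1 - t)) * n"
      using strongly_convex_onD[OF f(1) vs(1) w, of t] t by (simp add: n_def norm_minus_commute)
    ultimately have "0 \<le> t * (G vs \<bullet> (w - vs)) + Lbar * (t * t * n) - t * f vs + t * f w - \<mu> / 2 * (t * (1 - t)) * n"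
      using vs(2)[OF p] by (simp add: algebra_simps)
    also have "\<dots> = t * (G vs \<bullet> (w - vs) + Lbar * t * n - f vs + f w - \<mu> / 2 * (1 - t) * n)"
      by (simp add: algebra_simps)
    finally show ?thesis using t by (simp add: zero_le_mult_iff)
  qed
  have "((\<lambda>t. \<mu> / 2 * (1 - t) * n - Lbar * t * n) \<longlongrightarrow> \<mu> / 2 * (1 - 0) * n - Lbar * 0 * n) (at_right 0)"
    by (intro tendsto_intros)
  moreover have "\<forall>\<^sub>F t in at_right 0. \<mu> / 2 * (1 - t) * n - Lbar * t * n \<le> f w - f vs + G vs \<bullet> (w - vs)"
    by (rule eventually_mono[OF eventually_at_right_real[OF zero_less_one]]) (rule *, auto)
  ultimately have "\<mu> / 2 * (1 - 0) * n - Lbar * 0 * n \<le> f w - f vs + G vs \<bullet> (w - vs)"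
    by (intro tendsto_upperbound) auto
  then show ?thesis by (simp add: n_def)
qed

lemma minimizer_exists:
  "\<exists>vs\<in>D. (\<forall>w\<in>D. \<psi> vs + f vs + \<mu> / 2 * (norm (w - vs))\<^sup>2 \<le> \<psi> w + f w) \<and>
     (\<forall>w\<in>D. f vs + (- G vs) \<bullet> (w - vs) + \<mu> / 2 * (norm (w - vs))\<^sup>2 \<le> f w)"
proof -
  have \<psi>: "strongly_convex_on D 0 \<psi>"
    unfolding strongly_convex_on_def
  proof (intro conjI ballI allI impI)
    show cD: "convex D" using f(1) by (rule strongly_convex_on_convex)
    fix x y and t :: real assume H: "x \<in> D" "y \<in> D" "0 \<le> t \<and> t \<le> 1"
    let ?p = "(1 - t) *\<^sub>R x + t *\<^sub>R y"
    have p: "?p \<in> D" using cD H by (simp add: convex_def)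
    have "(1 - t) * (\<psi> ?p + G ?p \<bullet> (x - ?p)) + t * (\<psi> ?p + G ?p \<bullet> (y - ?p)) \<le> (1 - t) * \<psi> x + t * \<psi> y"
      using H subgrad[OF p] by (intro add_mono mult_left_mono) auto
    moreover have "(1 - t) * (\<psi> ?p + G ?p \<bullet> (x - ?p)) + t * (\<psi> ?p + G ?p \<bullet> (y - ?p)) = \<psi> ?p"
      by (simp add: inner_diff_right inner_add_right algebra_simps)
    ultimately show "\<psi> ?p \<le> (1 - t) * \<psi> x + t * \<psi> y - 0 / 2 * (t * (1 - t)) * (norm (x - y))\<^sup>2" by simp
  qed
  then have sc: "strongly_convex_on D (0 + \<mu>) (\<lambda>w. \<psi> w + f w)" by (rule strongly_convex_on_add[OF _ f(1)])
  have cont: "continuous_on D (\<lambda>w. \<psi> w + f w)" using continuous f(2) by (rule continuous_on_add)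
  obtain vs where vs: "vs \<in> D" "\<And>w. w \<in> D \<Longrightarrow> \<psi> vs + f vs \<le> \<psi> w + f w"
    using strongly_convex_on_attains_min[OF sc _ D cont] pos by auto
  then show ?thesis
    using minimizer_stationary[OF vs] strongly_convex_on_minimum_growth[OF sc vs] by auto
qed

text \<open>Strong monotonicity of \<open>G + \<partial>f\<close>: an \<open>\<eta>\<close>-stationary point is within \<open>\<eta>/\<mu>\<close> of the minimiser.\<close>

lemma stationary_distance:
  assumes "vs \<in> D" "\<forall>w\<in>D. f vs + (- G vs) \<bullet> (w - vs) + \<mu> / 2 * (norm (w - vs))\<^sup>2 \<le> f w"
    and "d \<in> D" "\<forall>w\<in>D. f d + sg \<bullet> (w - d) + \<mu> / 2 * (norm (w - d))\<^sup>2 \<le> f w" "norm (G d + sg) \<le> \<eta>"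
  shows "\<mu> * norm (d - vs) \<le> \<eta>"
proof -
  let ?n = "norm (d - vs)"
  have "\<mu> / 2 * ?n\<^sup>2 + \<mu> / 2 * ?n\<^sup>2 \<le> G vs \<bullet> (d - vs) - sg \<bullet> (vs - d)"
    using assms(2)[rule_format, OF assms(3)] assms(4)[rule_format, OF assms(1)]
    by (simp add: norm_minus_commute[of vs d])
  also have "\<dots> = (G d + sg) \<bullet> (d - vs) - (G d - G vs) \<bullet> (d - vs)"
    by (simp add: inner_add_left inner_diff_left inner_diff_right)
  also have "\<dots> \<le> (G d + sg) \<bullet> (d - vs)"
    using subgrad[OF assms(1,3)] subgrad[OF assms(3,1)] by (simp add: inner_diff_left inner_diff_right)
  also have "\<dots> \<le> \<eta> * ?n"
    using norm_cauchy_schwarz[of "G d + sg" "d - vs"] mult_right_mono[OF assms(5), of ?n] by simp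
  finally have "(\<mu> * ?n) * ?n \<le> \<eta> * ?n" by (simp add: power2_eq_square)
  moreover have "0 \<le> \<eta>" using assms(5) norm_ge_zero order_trans by blast
  ultimately show ?thesis
    by (cases "?n = 0") (simp, metis mult_right_le_imp_le norm_ge_zero order_le_less)
qed

end

lemma proper_closed_convex_real:
  assumes "proper_closed_convex f"
  shows "f x = (if x \<in> edom f then ereal (real_of_ereal (f x)) else \<infinity>)"
    and "convex_on (edom f) (\<lambda>x. real_of_ereal (f x))"
proof -
  have ninf: "f x \<noteq> - \<infinity>" for x using assms by (simp add: proper_closed_convex_def)
  show fin: "f x = (if x \<in> edom f then ereal (real_of_ereal (f x)) else \<infinity>)" for x
    using ninf[of x] by (cases "f x") (auto simp: edom_def)
  let ?r = "\<lambda>x. real_of_ereal (f x)"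
  have epi: "convex {(x, r::real). f x \<le> ereal r}" using assms by (simp add: proper_closed_convex_def)
  have *: "u *\<^sub>R x + v *\<^sub>R y \<in> edom f \<and> ?r (u *\<^sub>R x + v *\<^sub>R y) \<le> u * ?r x + v * ?r y"
    if "x \<in> edom f" "y \<in> edom f" "0 \<le> u" "0 \<le> v" "u + v = 1" for x y u v
  proof -
    have "(x, ?r x) \<in> {(x, r::real). f x \<le> ereal r}" "(y, ?r y) \<in> {(x, r::real). f x \<le> ereal r}"
      using fin[of x] fin[of y] that by auto
    from convexD[OF epi this that(3,4,5)]
    have le: "f (u *\<^sub>R x + v *\<^sub>R y) \<le> ereal (u * ?r x + v * ?r y)" by simp
    then have "u *\<^sub>R x + v *\<^sub>R y \<in> edom f" by (auto simp: edom_def)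
    moreover from this have "f (u *\<^sub>R x + v *\<^sub>R y) = ereal (?r (u *\<^sub>R x + v *\<^sub>R y))"
      using ninf[of "u *\<^sub>R x + v *\<^sub>R y"] by (cases "f (u *\<^sub>R x + v *\<^sub>R y)") (auto simp: edom_def)
    ultimately show ?thesis using le by (metis ereal_less_eq(3))
  qed
  show "convex_on (edom f) (\<lambda>x. real_of_ereal (f x))"
    unfolding convex_on_def convex_def using * by blast
qed

section \<open>The data of the minimax problem\<close>

lemma norm_fst_snd_le: "norm (fst w) \<le> norm w" "norm (snd w) \<le> norm w"
  using norm_fst_le[of "fst w" "snd w"] norm_snd_le[of "snd w" "fst w"] by auto

locale minimax =
  fixes P :: "(real^'n, real^'m, real^'q, real^'r) minimax" and L_F L_c L_p :: real
  assumes A1: "assumption_A1 P L_F L_c L_p"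
begin

abbreviation "X \<equiv> edom (gfun P)"
abbreviation "Y \<equiv> edom (hfun P)"

definition gr :: "real^'n \<Rightarrow> real" where "gr x = real_of_ereal (gfun P x)"
definition hr :: "real^'m \<Rightarrow> real" where "hr y = real_of_ereal (hfun P y)"

sublocale cc: convex_constraint "cfun P" L_c
  by unfold_locales (use A1 in \<open>auto simp: assumption_A1_def\<close>)

sublocale pc: convex_constraint "pfun P" L_p
  by unfold_locales (use A1 in \<open>auto simp: assumption_A1_def\<close>)

lemma g: "gfun P x = (if x \<in> X then ereal (gr x) else \<infinity>)" "convex_on X gr" "compact X" "X \<noteq> {}" "continuous_on X gr"
  and h: "hfun P y = (if y \<in> Y then ereal (hr y) else \<infinity>)" "convex_on Y hr" "compact Y" "Y \<noteq> {}" "continuous_on Y hr"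
proof -
  have g': "proper_closed_convex (gfun P)" and h': "proper_closed_convex (hfun P)"
    using A1 by (auto simp: assumption_A1_def)
  show "gfun P x = (if x \<in> X then ereal (gr x) else \<infinity>)" "convex_on X gr"
    using proper_closed_convex_real[OF g'] unfolding gr_def by blast+
  show "hfun P y = (if y \<in> Y then ereal (hr y) else \<infinity>)" "convex_on Y hr"
    using proper_closed_convex_real[OF h'] unfolding hr_def by blast+
  show "compact X" "compact Y" "X \<noteq> {}" "Y \<noteq> {}"
    using A1 by (auto simp: assumption_A1_def proper_closed_convex_def)
  show "continuous_on X gr" "continuous_on Y hr"
    using A1 unfolding assumption_A1_def gr_def hr_def by (blast intro: lipschitz_on_continuous_on)+
qed

lemma convex_X: "convex X" and convex_Y: "convex Y"
  using g(2) h(2) by (auto simp: convex_on_def)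

lemma L_F_nonneg: "0 \<le> L_F"
  using A1 by (auto simp: assumption_A1_def lipschitz_on_def)

lemma F_gderiv: "GDERIV (Ffun P) w :> grad (Ffun P) w"
  using A1 by (intro GDERIV_grad) (cases w, simp add: assumption_A1_def)

lemma GDERIV_x: "GDERIV (\<lambda>x'. Ffun P (x', y)) x :> fst (grad (Ffun P) (x, y))"
proof -
  have "((\<lambda>x'. (x', y)) has_derivative (\<lambda>h. (h, 0))) (at x)"
    by (auto intro!: derivative_eq_intros)
  from has_derivative_compose[OF this F_gderiv[unfolded gderiv_def]]
  show ?thesis unfolding gderiv_def by (simp add: inner_prod_def)
qed

lemma GDERIV_y: "GDERIV (\<lambda>y'. Ffun P (x, y')) y :> snd (grad (Ffun P) (x, y))"
proof -
  have "((\<lambda>y'. (x, y')) has_derivative (\<lambda>h. (0, h))) (at y)"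
    by (auto intro!: derivative_eq_intros)
  from has_derivative_compose[OF this F_gderiv[unfolded gderiv_def]]
  show ?thesis unfolding gderiv_def by (simp add: inner_prod_def)
qed

lemma gradx_eq: "gradx P x y = fst (grad (Ffun P) (x, y))"
  unfolding gradx_def by (rule grad_eq[OF GDERIV_x])

lemma grady_eq: "grady P x y = snd (grad (Ffun P) (x, y))"
  unfolding grady_def by (rule grad_eq[OF GDERIV_y])

lemma grad_lipschitz:
  "norm (gradx P x y - gradx P x' y') \<le> L_F * (norm (x - x') + norm (y - y'))"
  "norm (grady P x y - grady P x' y') \<le> L_F * (norm (x - x') + norm (y - y'))"
proof -
  let ?d = "grad (Ffun P) (x, y) - grad (Ffun P) (x', y')"
  have lip: "L_F-lipschitz_on UNIV (grad (Ffun P))" using A1 by (simp add: assumption_A1_def)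
  have "norm ?d \<le> L_F * norm ((x, y) - (x', y'))"
    using lipschitz_on_normD[OF lip] by blast
  also have "\<dots> \<le> L_F * (norm (x - x') + norm (y - y'))"
    using L_F_nonneg by (intro mult_left_mono) (auto simp: norm_Pair intro: sqrt_sum_squares_le_sum)
  finally have d: "norm ?d \<le> L_F * (norm (x - x') + norm (y - y'))" .
  have "norm (fst ?d) \<le> norm ?d" "norm (snd ?d) \<le> norm ?d"
    by (rule norm_fst_snd_le)+
  then show "norm (gradx P x y - gradx P x' y') \<le> L_F * (norm (x - x') + norm (y - y'))"
    "norm (grady P x y - grady P x' y') \<le> L_F * (norm (x - x') + norm (y - y'))"
    using d unfolding gradx_eq grady_eq by auto
qed

lemma F_convex_x: "Ffun P (x, y) + gradx P x y \<bullet> (x' - x) \<le> Ffun P (x', y)"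
proof -
  have "convex_on UNIV (\<lambda>x. Ffun P (x, y))" using A1 by (simp add: assumption_A1_def)
  from convex_on_above_tangent[OF this GDERIV_x[unfolded gderiv_def]]
  show ?thesis unfolding gradx_eq by (simp add: inner_commute)
qed

lemma F_concave_y: "Ffun P (x, y') \<le> Ffun P (x, y) + grady P x y \<bullet> (y' - y)"
proof -
  have "convex_on UNIV (\<lambda>y. - Ffun P (x, y))" using A1 by (simp add: assumption_A1_def concave_on_def)
  from convex_on_above_tangent[OF this GDERIV_minus[OF GDERIV_y, unfolded gderiv_def], of y y']
  show ?thesis unfolding grady_eq by (simp add: inner_commute)
qed

end

text \<open>The constraints are bounded on the doubled ball as required by \<open>cocoercive_on_cball\<close>.\<close>

locale minimax_bounds = minimax P L_F L_c L_p
  for P :: "(real^'n, real^'m, real^'q, real^'r) minimax" and L_F L_c L_p :: real +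
  fixes r B \<delta> :: real and xf :: "real^'n" and yf :: "real^'m"
  assumes dom: "X \<subseteq> cball 0 r" "Y \<subseteq> cball 0 r"
    and pos: "0 < B" "0 < \<delta>"
    and c_bound: "\<And>x. x \<in> cball 0 (2 * r) \<Longrightarrow> norm (cfun P x) \<le> B" "\<And>x. x \<in> cball 0 (2 * r) \<Longrightarrow> norm (Jac (cfun P) x) \<le> B"
    and p_bound: "\<And>y. y \<in> cball 0 (2 * r) \<Longrightarrow> norm (pfun P y) \<le> B" "\<And>y. y \<in> cball 0 (2 * r) \<Longrightarrow> norm (Jac (pfun P) y) \<le> B"
    and grad_bound: "\<And>x y. x \<in> X \<Longrightarrow> y \<in> Y \<Longrightarrow> norm (gradx P x y) \<le> B"
      "\<And>x y. x \<in> X \<Longrightarrow> y \<in> Y \<Longrightarrow> norm (grady P x y) \<le> B"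
    and gh_bound: "\<And>x. x \<in> X \<Longrightarrow> \<bar>gr x\<bar> \<le> B" "\<And>y. y \<in> Y \<Longrightarrow> \<bar>hr y\<bar> \<le> B"
    and slater_x: "xf \<in> X" "\<And>i. cfun P xf $ i \<le> - \<delta>"
    and slater_y: "yf \<in> Y" "\<And>i. pfun P yf $ i \<le> - \<delta>"

lemma (in minimax) bounds_exist:
  assumes A2: "assumption_A2 P"
  obtains r B \<delta> xf yf where "minimax_bounds P L_F L_c L_p r B \<delta> xf yf"
proof -
  obtain xf where xf: "xf \<in> X" "\<And>i. 0 < - (cfun P xf $ i)" using A2 by (auto simp: assumption_A2_def)
  obtain yf where yf: "yf \<in> Y" "\<And>i. 0 < - (pfun P yf $ i)" using A2 by (auto simp: assumption_A2_def)
  define \<delta> where "\<delta> = min (Min (range (\<lambda>i. - (cfun P xf $ i)))) (Min (range (\<lambda>i. - (pfun P yf $ i))))"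
  have \<delta>: "0 < \<delta>" using xf(2) yf(2) by (simp add: \<delta>_def)
  have \<delta>x: "cfun P xf $ i \<le> - \<delta>" for i
  proof -
    have "Min (range (\<lambda>i. - (cfun P xf $ i))) \<le> - (cfun P xf $ i)" by (intro Min_le) auto
    then show ?thesis unfolding \<delta>_def by linarith
  qed
  have \<delta>y: "pfun P yf $ i \<le> - \<delta>" for i
  proof -
    have "Min (range (\<lambda>i. - (pfun P yf $ i))) \<le> - (pfun P yf $ i)" by (intro Min_le) auto
    then show ?thesis unfolding \<delta>_def by linarith
  qed
  obtain r1 where r1: "\<And>x. x \<in> X \<Longrightarrow> norm x \<le> r1" using compact_imp_bounded[OF g(3)] by (auto simp: bounded_iff)
  obtain r2 where r2: "\<And>y. y \<in> Y \<Longrightarrow> norm y \<le> r2" using compact_imp_bounded[OF h(3)] by (auto simp: bounded_iff)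
  define r where "r = max r1 r2"
  have dom: "X \<subseteq> cball 0 r" "Y \<subseteq> cball 0 r" using r1 r2 by (force simp: r_def)+
  obtain B1 where B1: "\<And>x. x \<in> cball 0 (2 * r) \<Longrightarrow> norm (cfun P x) \<le> B1" "\<And>x. x \<in> cball 0 (2 * r) \<Longrightarrow> norm (Jac (cfun P) x) \<le> B1"
    using cc.bounded_on_compact[OF compact_cball] by metis
  obtain B2 where B2: "\<And>x. x \<in> cball 0 (2 * r) \<Longrightarrow> norm (pfun P x) \<le> B2" "\<And>x. x \<in> cball 0 (2 * r) \<Longrightarrow> norm (Jac (pfun P) x) \<le> B2"
    using pc.bounded_on_compact[OF compact_cball] by metis
  have lip: "L_F-lipschitz_on UNIV (grad (Ffun P))" using A1 by (simp add: assumption_A1_def)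
  have "bounded (grad (Ffun P) ` (X \<times> Y))"
    by (intro compact_imp_bounded compact_continuous_image compact_Times g h
        continuous_on_subset[OF lipschitz_on_continuous_on[OF lip]]) auto
  then obtain B3 where "\<forall>w\<in>X \<times> Y. norm (grad (Ffun P) w) \<le> B3" unfolding bounded_iff by auto
  then have B3: "norm (gradx P x y) \<le> B3" "norm (grady P x y) \<le> B3" if "x \<in> X" "y \<in> Y" for x y
    unfolding gradx_eq grady_eq using that order_trans[OF norm_fst_snd_le(1)] order_trans[OF norm_fst_snd_le(2)] by blast+
  have "bounded (gr ` X)" "bounded (hr ` Y)"
    by (intro compact_imp_bounded compact_continuous_image g h)+
  then obtain B4 B5 where B4: "\<And>x. x \<in> X \<Longrightarrow> \<bar>gr x\<bar> \<le> B4" and B5: "\<And>y. y \<in> Y \<Longrightarrow> \<bar>hr y\<bar> \<le> B5"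
    unfolding bounded_iff by auto
  define B where "B = Max {1, B1, B2, B3, B4, B5}"
  have BB: "1 \<le> B" "B1 \<le> B" "B2 \<le> B" "B3 \<le> B" "B4 \<le> B" "B5 \<le> B" by (simp_all add: B_def)
  have "minimax_bounds P L_F L_c L_p r B \<delta> xf yf"
  proof unfold_locales
    show "norm (cfun P x) \<le> B" "norm (Jac (cfun P) x) \<le> B" if "x \<in> cball 0 (2 * r)" for x
      using B1[OF that] BB by linarith+
    show "norm (pfun P x) \<le> B" "norm (Jac (pfun P) x) \<le> B" if "x \<in> cball 0 (2 * r)" for x
      using B2[OF that] BB by linarith+
    show "norm (gradx P x y) \<le> B" "norm (grady P x y) \<le> B" if "x \<in> X" "y \<in> Y" for x y
      using B3[OF that] BB by linarith+
    show "\<bar>gr x\<bar> \<le> B" if "x \<in> X" for x using B4[OF that] BB by linarith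
    show "\<bar>hr y\<bar> \<le> B" if "y \<in> Y" for y using B5[OF that] BB by linarith
  qed (use dom \<delta> \<delta>x \<delta>y xf yf BB in auto)
  then show thesis by (rule that)
qed

context minimax_bounds
begin

lemma dom2: "x \<in> X \<Longrightarrow> x \<in> cball 0 (2 * r)" "y \<in> Y \<Longrightarrow> y \<in> cball 0 (2 * r)"
  using dom by (auto simp: subset_iff intro: order_trans) (smt (verit) norm_ge_zero)+

lemma p_lipschitz: "y \<in> Y \<Longrightarrow> y' \<in> Y \<Longrightarrow> norm (pfun P y - pfun P y') \<le> B * norm (y - y')"
  by (rule pc.c_lipschitz[OF convex_Y]) (use dom2 p_bound in auto)

lemma M_p: "0 \<le> M_p P" "y \<in> Y \<Longrightarrow> y' \<in> Y \<Longrightarrow> norm (pfun P y - pfun P y') \<le> M_p P * norm (y - y')"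
proof -
  have ons: "onorm ((*v) (Jac (pfun P) y)) \<le> B" if "y \<in> Y" for y
  proof (rule onorm_le)
    fix v :: "real^'m"
    show "norm (Jac (pfun P) y *v v) \<le> B * norm v"
      using norm_matrix_vector_le[of "Jac (pfun P) y" v] mult_right_mono[OF p_bound(2)[OF dom2(2)[OF that]], of "norm v"]
      by simp
  qed
  have bdd: "bdd_above ((\<lambda>y. onorm ((*v) (Jac (pfun P) y))) ` Y)"
    using ons by (auto simp: bdd_above_def)
  have le: "onorm ((*v) (Jac (pfun P) y)) \<le> M_p P" if "y \<in> Y" for y
    unfolding M_p_def by (rule cSUP_upper[OF that bdd])
  show "0 \<le> M_p P"
    using le[OF slater_y(1)] onorm_pos_le[OF matrix_vector_mul_bounded_linear, of "Jac (pfun P) yf"] by linarith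
  show "y \<in> Y \<Longrightarrow> y' \<in> Y \<Longrightarrow> norm (pfun P y - pfun P y') \<le> M_p P * norm (y - y')"
    by (rule differentiable_bound[OF convex_Y has_derivative_at_withinI[OF pc.has_derivative] le])
qed

end

section \<open>The inner problem\<close>

text \<open>The least number \<open>K\<close> of iterations allowed by the assumption \<open>K\<close> of \<open>iapg_problem\<close>.\<close>

definition iter_bound :: "real \<Rightarrow> real \<Rightarrow> real \<Rightarrow> real \<Rightarrow> nat" where
  "iter_bound Lmax \<mu> R \<epsilon> =
     nat \<lceil>ln (max 1 ((14 * R * Lmax / \<epsilon>)\<^sup>2 * (Lmax / (2 * \<mu>)))) / ln (1 + sqrt (2 * \<mu> / Lmax))\<rceil>"

definition trial_bound :: "real \<Rightarrow> real \<Rightarrow> real \<Rightarrow> nat" where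
  "trial_bound \<gamma> Lbar Lmin = nat \<lceil>ln (max 1 (Lbar / Lmin)) / ln \<gamma>\<rceil>"

lemma le_power_nat_ceiling:
  assumes "1 < (q::real)" "1 \<le> Z"
  shows "Z \<le> q ^ nat \<lceil>ln Z / ln q\<rceil>"
proof -
  have q: "0 < ln q" using assms by simp
  have "ln Z / ln q \<le> real (nat \<lceil>ln Z / ln q\<rceil>)" by linarith
  then have "ln Z \<le> real (nat \<lceil>ln Z / ln q\<rceil>) * ln q" using q by (simp add: divide_le_eq)
  also have "\<dots> = ln (q ^ nat \<lceil>ln Z / ln q\<rceil>)" using assms by (simp add: ln_realpow)
  finally show ?thesis using assms by (subst (asm) ln_le_cancel_iff) auto
qed

lemma iter_bound:
  assumes "0 < Lmax" "0 < \<mu>"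
  shows "(14 * R * Lmax / \<epsilon>)\<^sup>2 \<le> 2 * \<mu> / Lmax * (1 + sqrt (2 * \<mu> / Lmax)) ^ iter_bound Lmax \<mu> R \<epsilon>"
proof -
  have "(14 * R * Lmax / \<epsilon>)\<^sup>2 * (Lmax / (2 * \<mu>)) \<le> (1 + sqrt (2 * \<mu> / Lmax)) ^ iter_bound Lmax \<mu> R \<epsilon>"
    unfolding iter_bound_def
    by (rule order_trans[OF max.cobounded2[of _ 1] le_power_nat_ceiling]) (use assms in auto)
  from mult_left_mono[OF this, of "2 * \<mu> / Lmax"] assms show ?thesis by simp
qed

lemma trial_bound:
  assumes "0 < Lmin" "1 < \<gamma>"
  shows "Lbar \<le> Lmin * \<gamma> ^ trial_bound \<gamma> Lbar Lmin"
proof -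
  have "Lbar / Lmin \<le> \<gamma> ^ trial_bound \<gamma> Lbar Lmin"
    unfolding trial_bound_def
    by (rule order_trans[OF max.cobounded2[of _ 1] le_power_nat_ceiling]) (use assms in auto)
  then show ?thesis using assms by (simp add: field_simps)
qed

text \<open>A lower bound for the accuracies \<open>\<omega>\<close> that a run of iAPG passes to its gradient routine. The auxiliary
  value \<open>A1\<close> bounds \<open>A\<close> whenever a line search starts, and \<open>Atop\<close> bounds \<open>A + a\<close> during it.\<close>

definition query_accuracy :: "real \<Rightarrow> real \<Rightarrow> real \<Rightarrow> real \<Rightarrow> real \<Rightarrow> nat \<Rightarrow> real" where
  "query_accuracy Lmin \<mu> \<epsilon> R Lmax K =
    (let A1 = 2 * (14 * R * Lmax / \<epsilon>)\<^sup>2 / \<mu> + 4 * (1 + (14 * R * Lmax / \<epsilon>)\<^sup>2) / Lmin;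
         Atop = 2 * A1 + 4 * (1 + \<mu> * A1) / Lmin
     in min (\<epsilon> / 8) (\<mu> * \<epsilon> / ((real K + 2)\<^sup>2 * max 1 Atop)))"

text \<open>The upper bound \<open>nubar\<close> of \<open>\<nu>\<close> serves to define constants that do not depend on \<open>\<nu>\<close>.\<close>

locale perturbed_minimax = minimax_bounds P L_F L_c L_p r B \<delta> xf yf
  for P :: "(real^'n, real^'m, real^'q, real^'r) minimax" and L_F L_c L_p r B \<delta> xf yf +
  fixes par :: "(real^'n, real^'m, real^'q, real^'r) params" and \<nu> nubar :: real
  assumes par: "admissible P par" and \<nu>: "0 < \<nu>"
    and Dy_pos: "0 < diameter (edom (hfun P))" and L_M: "0 < L_F + M_p P"
    and nubar: "\<nu> \<le> nubar"
begin

abbreviation "\<beta> \<equiv> beta_y par"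
abbreviation "y0 \<equiv> y_init par"
abbreviation "Pn \<equiv> perturbed P y0 \<nu>"
abbreviation "Dy \<equiv> diameter Y"

lemma params: "0 < Llow par" "1 < gamma_u par" "1 < gamma_d par" "0 < \<beta>" "0 < beta_x0 par" "0 < rho0 par"
    "0 < eta0 par" "sigma par < tau par" "1 < sigma par" "y0 \<in> Y"
  using par by (auto simp: admissible_def)

lemma perturbed_simps [simp]:
  "gfun Pn = gfun P" "hfun Pn = hfun P" "cfun Pn = cfun P" "pfun Pn = pfun P"
  "Ffun Pn (x, y) = Ffun P (x, y) - \<nu> / 2 * (norm (y - y0))\<^sup>2" "M_p Pn = M_p P"
  by (simp_all add: perturbed_def M_p_def)

lemma dist_Y: "y \<in> Y \<Longrightarrow> y' \<in> Y \<Longrightarrow> norm (y - y') \<le> Dy"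
  using diameter_bounded_bound[OF compact_imp_bounded[OF h(3)]] by (simp add: dist_norm)

lemma GDERIV_sq: "GDERIV (\<lambda>y::real^'m. k / 2 * (norm (y - a))\<^sup>2) y :> k *\<^sub>R (y - a)"
  unfolding gderiv_def power2_norm_eq_inner
  by (rule derivative_eq_intros refl | simp)+ (simp add: inner_commute fun_eq_iff)

lemma gradx_perturbed [simp]: "gradx Pn x y = gradx P x y"
proof -
  have "GDERIV (\<lambda>x'. Ffun P (x', y) - \<nu> / 2 * (norm (y - y0))\<^sup>2) x :> gradx P x y - 0"
    unfolding gradx_eq by (intro GDERIV_diff GDERIV_x GDERIV_const)
  then show ?thesis by (subst gradx_def) (simp add: grad_eq)
qed

lemma grady_perturbed [simp]: "grady Pn x y = grady P x y - \<nu> *\<^sub>R (y - y0)"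
proof -
  have "GDERIV (\<lambda>y. Ffun P (x, y) - \<nu> / 2 * (norm (y - y0))\<^sup>2) y :> grady P x y - \<nu> *\<^sub>R (y - y0)"
    unfolding grady_eq by (intro GDERIV_diff GDERIV_y GDERIV_sq)
  then show ?thesis by (subst grady_def) (simp add: grad_eq)
qed

text \<open>\<open>Gy\<close> is the gradient of the smooth part of \<open>- Q(x, \<cdot>, u)\<close> and \<open>fy\<close> the remaining part; the modulus
  \<open>\<nu>\<close> of strong convexity has been moved to \<open>fy\<close>, which leaves only an affine trace of the
  regularisation in \<open>Gy\<close>.\<close>

definition Gy :: "real^'n \<Rightarrow> real^'r \<Rightarrow> real^'m \<Rightarrow> real^'m" where
  "Gy x u y = - grady P x y - \<nu> *\<^sub>R y0 + pc.pen_grad \<beta> u y"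

definition fy :: "real^'m \<Rightarrow> real" where
  "fy y = \<nu> / 2 * (norm y)\<^sup>2 + hr y"

definition LY :: "real \<Rightarrow> real" where
  "LY U = 2 * (L_F + 1) + 2 * (L_p * (\<beta> * B + U) + \<beta> * B\<^sup>2 + 1)"

lemma psi_y_eq:
  "psi_y Pn \<beta> \<nu> x u y = - Ffun P (x, y) + (\<nu> / 2 * (norm (y - y0))\<^sup>2 - \<nu> / 2 * (norm y)\<^sup>2) + pc.pen \<beta> u y"
  unfolding psi_y_def pc.pen_def by simp

lemma sq_diff_affine:
  "\<nu> / 2 * (norm (y - y0))\<^sup>2 - \<nu> / 2 * (norm y)\<^sup>2 = \<nu> / 2 * (norm y0)\<^sup>2 - (\<nu> *\<^sub>R y0) \<bullet> y"
  unfolding power2_norm_eq_inner by (simp add: inner_diff_left inner_diff_right inner_commute algebra_simps)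

lemma GDERIV_psi_y: "GDERIV (psi_y Pn \<beta> \<nu> x u) y :> Gy x u y"
proof -
  have "GDERIV (\<lambda>y. - Ffun P (x, y) + (\<nu> / 2 * (norm (y - y0))\<^sup>2 - \<nu> / 2 * (norm (y - 0))\<^sup>2) + pc.pen \<beta> u y) y
      :> - grady P x y + (\<nu> *\<^sub>R (y - y0) - \<nu> *\<^sub>R (y - 0)) + pc.pen_grad \<beta> u y"
    unfolding grady_eq using params(4)
    by (intro GDERIV_add GDERIV_diff GDERIV_minus GDERIV_y GDERIV_sq pc.GDERIV_pen)
  then show ?thesis unfolding psi_y_eq[abs_def] Gy_def by (simp add: scaleR_diff_right)
qed

lemma psi_y_above_tangent: "psi_y Pn \<beta> \<nu> x u v + Gy x u v \<bullet> (w - v) \<le> psi_y Pn \<beta> \<nu> x u w"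
  using F_concave_y[of x w v] pc.pen_above_tangent[OF params(4), of u v w]
  unfolding psi_y_eq sq_diff_affine Gy_def by (simp add: inner_diff_left inner_add_left inner_diff_right)

lemma phi_y_eq: "phi_y Pn \<nu> y = (if y \<in> Y then ereal (fy y) else \<infinity>)"
  unfolding phi_y_def fy_def using h(1)[of y] by simp

lemma LY_pos: "0 \<le> U \<Longrightarrow> 0 < LY U"
  using L_F_nonneg params lipschitz_on_nonneg[OF pc.lip] pos unfolding LY_def
  by (intro add_pos_pos mult_pos_pos add_nonneg_pos add_nonneg_nonneg mult_nonneg_nonneg) auto

lemma Gy_cocoercive:
  assumes "norm u \<le> U" "v \<in> Y" "w \<in> Y"
  shows "(norm (Gy x u v - Gy x u w))\<^sup>2 \<le> LY U * ((Gy x u v - Gy x u w) \<bullet> (v - w))"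
proof -
  have "(norm (- grady P x v - - grady P x w))\<^sup>2 \<le> 2 * (L_F + 1) * ((- grady P x v - - grady P x w) \<bullet> (v - w))"
  proof (rule cocoercive_of_lipschitz[where S = UNIV and \<psi> = "\<lambda>y. - Ffun P (x, y)"])
    show "norm (- grady P x v - - grady P x w) \<le> (L_F + 1) * norm (v - w)" for v w
      using grad_lipschitz(2)[of x v x w] norm_ge_zero[of "v - w"]
      unfolding distrib_right minus_diff_minus norm_minus_cancel by (simp add: add_increasing2)
  qed (use F_concave_y L_F_nonneg in \<open>auto simp: algebra_simps\<close>)
  moreover have "(norm (pc.pen_grad \<beta> u v - pc.pen_grad \<beta> u w))\<^sup>2
      \<le> 2 * (L_p * (\<beta> * B + U) + \<beta> * B\<^sup>2 + 1) * ((pc.pen_grad \<beta> u v - pc.pen_grad \<beta> u w) \<bullet> (v - w))"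
    by (rule pc.pen_cocoercive[where a = 0 and r = r, OF p_bound(2,1)]) (use assms dom params in auto)
  moreover have "0 \<le> U" using assms(1) norm_ge_zero order_trans by blast
  then have "0 < 2 * (L_p * (\<beta> * B + U) + \<beta> * B\<^sup>2 + 1)"
    using params lipschitz_on_nonneg[OF pc.lip] pos
    by (intro mult_pos_pos add_nonneg_pos add_nonneg_nonneg mult_nonneg_nonneg) auto
  moreover have "Gy x u v - Gy x u w = (- grady P x v - - grady P x w) + (pc.pen_grad \<beta> u v - pc.pen_grad \<beta> u w)"
    by (simp add: Gy_def)
  ultimately show ?thesis unfolding LY_def using L_F_nonneg by (metis cocoercive_add add_nonneg_pos mult_pos_pos zero_less_numeral zero_less_one)
qed

lemma strongly_convex_fy: "strongly_convex_on Y \<nu> fy"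
  using strongly_convex_on_add[OF strongly_convex_on_quadratic[OF convex_Y, of \<nu> 0]
      convex_on_imp_strongly_convex_on[OF h(2)]]
  unfolding fy_def by simp

lemma continuous_fy: "continuous_on Y fy"
  unfolding fy_def[abs_def] using h(5) by (intro continuous_intros) auto

text \<open>The smoothness constant \<open>LY U\<close> grows with the bound \<open>U\<close> on \<open>|u|\<close> but not with \<open>1/\<nu>\<close>.\<close>

lemma inner_composite: "norm u \<le> U \<Longrightarrow> composite_problem (psi_y Pn \<beta> \<nu> x u) fy (Gy x u) Y \<nu> (LY U)"
  using order_trans[OF norm_ge_zero, of u U]
  by unfold_locales (auto simp: h compact_imp_closed strongly_convex_fy continuous_fy psi_y_above_tangent
      Gy_cocoercive \<nu> LY_pos)

definition ystar :: "real^'n \<Rightarrow> real^'r \<Rightarrow> real^'m" where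
  "ystar x u = (SOME y. y \<in> Y \<and>
     (\<forall>w\<in>Y. psi_y Pn \<beta> \<nu> x u y + fy y + \<nu> / 2 * (norm (w - y))\<^sup>2 \<le> psi_y Pn \<beta> \<nu> x u w + fy w) \<and>
     (\<forall>w\<in>Y. fy y + (- Gy x u y) \<bullet> (w - y) + \<nu> / 2 * (norm (w - y))\<^sup>2 \<le> fy w))"

lemma ystar:
  shows "ystar x u \<in> Y"
    and "w \<in> Y \<Longrightarrow> psi_y Pn \<beta> \<nu> x u (ystar x u) + fy (ystar x u) + \<nu> / 2 * (norm (w - ystar x u))\<^sup>2
      \<le> psi_y Pn \<beta> \<nu> x u w + fy w"
    and "w \<in> Y \<Longrightarrow> fy (ystar x u) + (- Gy x u (ystar x u)) \<bullet> (w - ystar x u) + \<nu> / 2 * (norm (w - ystar x u))\<^sup>2 \<le> fy w"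
proof -
  have "\<exists>y. y \<in> Y \<and>
     (\<forall>w\<in>Y. psi_y Pn \<beta> \<nu> x u y + fy y + \<nu> / 2 * (norm (w - y))\<^sup>2 \<le> psi_y Pn \<beta> \<nu> x u w + fy w) \<and>
     (\<forall>w\<in>Y. fy y + (- Gy x u y) \<bullet> (w - y) + \<nu> / 2 * (norm (w - y))\<^sup>2 \<le> fy w)"
    using composite_problem.minimizer_exists[OF inner_composite[OF order_refl, of x u]] by blast
  from someI_ex[OF this, folded ystar_def]
  show "ystar x u \<in> Y"
    "w \<in> Y \<Longrightarrow> psi_y Pn \<beta> \<nu> x u (ystar x u) + fy (ystar x u) + \<nu> / 2 * (norm (w - ystar x u))\<^sup>2
      \<le> psi_y Pn \<beta> \<nu> x u w + fy w"
    "w \<in> Y \<Longrightarrow> fy (ystar x u) + (- Gy x u (ystar x u)) \<bullet> (w - ystar x u) + \<nu> / 2 * (norm (w - ystar x u))\<^sup>2 \<le> fy w"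
    by blast+
qed

lemma ystar_distance:
  assumes "y \<in> Y" "\<forall>w\<in>Y. fy y + sg \<bullet> (w - y) + \<nu> / 2 * (norm (w - y))\<^sup>2 \<le> fy w" "norm (Gy x u y + sg) \<le> \<eta>"
  shows "\<nu> * norm (y - ystar x u) \<le> \<eta>"
  using composite_problem.stationary_distance[OF inner_composite[OF order_refl, of x u] ystar(1) _ assms] ystar(3)
  by blast

definition RY :: "real \<Rightarrow> real" where
  "RY tol = sqrt (Dy\<^sup>2 + 4 * (\<nu> * tol * (8 * Dy + tol / (2 * Llow par))))"

definition LYmax :: "real \<Rightarrow> real \<Rightarrow> real" where
  "LYmax \<kappa> U = max (\<kappa> * Llow par) (gamma_u par * LY U)"

definition inner_cost :: "real \<Rightarrow> real \<Rightarrow> real \<Rightarrow> nat" where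
  "inner_cost \<kappa> U tol = (iter_bound (LYmax \<kappa> U) \<nu> (RY tol) tol + 2) *
     ((trial_bound (gamma_u par) (LY U) (Llow par) + 1) * 3 + 1)"

text \<open>The constant \<open>e\<close> says whether \<open>m\<close> counts calls for \<open>y\<close>. For \<open>e = 0\<close> the factors \<open>\<Lambda>\<close> may be
  unbounded: the run terminates all the same.\<close>

lemma solve_y:
  fixes m :: "calls \<Rightarrow> nat"
  assumes u: "norm u \<le> U" and yt: "yt \<in> Y" and tol: "0 < tol"
    and \<Lambda>': "1 \<le> \<Lambda> (n_iapg s)" "e = 0 \<or> \<Lambda> (n_iapg s) \<le> \<kappa>"
    and m: "\<And>s. m (tick_y s) \<le> m s + e" "\<And>s. m (tick_h s) \<le> m s + e" "m (s\<lparr>n_iapg := n_iapg s + 1\<rparr>) = m s"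
  shows "\<exists>y s'. solve_y \<Lambda> Pn par \<nu> yt x u tol s = Some (y, s') \<and> y \<in> Y \<and>
    (\<exists>sg. (\<forall>w\<in>Y. fy y + sg \<bullet> (w - y) + \<nu> / 2 * (norm (w - y))\<^sup>2 \<le> fy w) \<and> norm (Gy x u y + sg) \<le> tol) \<and>
    m s' \<le> m s + inner_cost \<kappa> U tol * e"
proof -
  define \<kappa>' where "\<kappa>' = (if e = 0 then \<Lambda> (n_iapg s) else \<kappa>)"
  have \<Lambda>: "1 \<le> \<Lambda> (n_iapg s)" "\<Lambda> (n_iapg s) \<le> \<kappa>'" using \<Lambda>' by (auto simp: \<kappa>'_def)
  have U: "0 \<le> U" using u norm_ge_zero order_trans by blast
  have kp: "1 \<le> \<kappa>'" using \<Lambda> by simp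
  have Rpos: "0 < RY tol" "(RY tol)\<^sup>2 = Dy\<^sup>2 + 4 * (\<nu> * tol * (8 * Dy + tol / (2 * Llow par)))"
    unfolding RY_def using Dy_pos \<nu> tol params
    by (simp_all add: add_pos_nonneg add_nonneg_nonneg)
  have Lm: "gamma_u par * LY U \<le> LYmax \<kappa>' U" "Llow par \<le> LYmax \<kappa>' U"
    unfolding LYmax_def using params mult_right_mono[OF kp, of "Llow par"] by (auto intro: max.coboundedI1)
  have "iapg_problem (psi_y Pn \<beta> \<nu> x u) fy (phi_y Pn \<nu>) (Gy x u) Y \<nu> tol (Llow par) (gamma_u par) (gamma_d par)
      (LY U) (exact_gradient (psi_y Pn \<beta> \<nu> x u) tick_y) tick_h (\<lambda>_. 0) 0 0 (RY tol) Dy (ystar x u) yt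
      (RY tol) (LYmax \<kappa>' U) (iter_bound (LYmax \<kappa>' U) \<nu> (RY tol) tol) (trial_bound (gamma_u par) (LY U) (Llow par)) m e e"
  proof (rule iapg_problem.intro, goal_cases)
    case 25
    have "(norm (yt - ystar x u))\<^sup>2 \<le> Dy\<^sup>2" using dist_Y[OF yt ystar(1)] by (intro power_mono) auto
    then show ?case using Rpos by simp
  next
    case (31 v \<omega> s)
    have "0 \<le> \<omega>"
      by (rule order_trans[OF _ 31(3)])
        (use \<nu> tol in \<open>intro min.boundedI divide_nonneg_nonneg mult_nonneg_nonneg, auto\<close>)
    then show ?case using m(1) unfolding exact_gradient_def by (auto simp: grad_eq[OF GDERIV_psi_y])
  qed (use compact_imp_closed[OF h(3)] yt ystar strongly_convex_fy continuous_fy phi_y_eq psi_y_above_tangent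
      Gy_cocoercive[OF u] \<nu> tol params LY_pos[OF U] Rpos Lm dist_Y m iter_bound trial_bound in auto)
  note res = iapg_problem.iapg_terminates[OF this, of \<Lambda> s, OF \<Lambda>(1) _ m(3), folded solve_y_def]
  have "\<Lambda> (n_iapg s) * Llow par \<le> LYmax \<kappa>' U"
    unfolding LYmax_def using params mult_right_mono[OF \<Lambda>(2), of "Llow par"] by (intro max.coboundedI1) auto
  from res[OF this] have "\<exists>y s'. solve_y \<Lambda> Pn par \<nu> yt x u tol s = Some (y, s') \<and> y \<in> Y \<and>
    (\<exists>sg. (\<forall>w\<in>Y. fy y + sg \<bullet> (w - y) + \<nu> / 2 * (norm (w - y))\<^sup>2 \<le> fy w) \<and> norm (Gy x u y + sg) \<le> tol) \<and>
    m s' \<le> m s + inner_cost \<kappa>' U tol * e"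
    unfolding inner_cost_def solve_y_def by (simp add: algebra_simps)
  then show ?thesis by (cases "e = 0") (simp_all add: \<kappa>'_def)
qed

end

section \<open>The outer objective and its approximate gradients\<close>

text \<open>Convexity of \<open>u \<mapsto> u\<^sup>2 - max (a + u) 0\<^sup>2\<close>, the dual part of the augmented Lagrangian, with
  derivative \<open>2 (u - max (a + u) 0)\<close>.\<close>

lemma half_sq_minus_pos_above_tangent:
  "u\<^sup>2 - (max (a + u) 0)\<^sup>2 + 2 * ((u - max (a + u) 0) * (w - u)) \<le> w\<^sup>2 - (max (a + w) 0)\<^sup>2" for u w a :: real
proof -
  have *: "(max s 0)\<^sup>2 \<le> (max r 0)\<^sup>2 + 2 * (max r 0 * (s - r)) + (s - r)\<^sup>2" for r s :: real
  proof -
    consider "0 < r" | "r \<le> 0" "s \<le> 0" | "r \<le> 0" "0 < s" by linarith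
    then show ?thesis
    proof cases
      case 1
      have "(max s 0)\<^sup>2 \<le> s\<^sup>2" by (simp add: max_def)
      also have "\<dots> = (max r 0)\<^sup>2 + 2 * (max r 0 * (s - r)) + (s - r)\<^sup>2"
        using 1 by (simp add: power2_eq_square algebra_simps)
      finally show ?thesis .
    next
      case 3
      then have "s\<^sup>2 \<le> (s - r)\<^sup>2" by (intro power_mono) auto
      then show ?thesis using 3 by (simp add: max_def)
    qed (simp add: max_def)
  qed
  from *[of "a + w" "a + u"] show ?thesis by (simp add: power2_eq_square algebra_simps)
qed

context perturbed_minimax
begin

definition Qr :: "real^'n \<Rightarrow> real^'m \<Rightarrow> real^'r \<Rightarrow> real" where
  "Qr x y u = Ffun P (x, y) - \<nu> / 2 * (norm (y - y0))\<^sup>2 - hr y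
     - 1 / (2 * \<beta>) * ((norm (pos (\<beta> *\<^sub>R pfun P y + u)))\<^sup>2 - (norm u)\<^sup>2)"

lemma Qr_eq: "Qr x y u = 1 / (2 * \<beta>) * (norm u)\<^sup>2 - (psi_y Pn \<beta> \<nu> x u y + fy y)"
  unfolding Qr_def psi_y_eq fy_def pc.pen_def by (simp add: algebra_simps)

lemma Psi_eq: "Psi Pn \<beta> x u = Qr x (ystar x u) u"
proof -
  have Q: "Q_fun Pn \<beta> x y u = (if y \<in> Y then ereal (Qr x y u) else - \<infinity>)" for y
    unfolding Q_fun_def Qr_def using h(1)[of y] by simp
  have "(SUP y. Q_fun Pn \<beta> x y u) = ereal (Qr x (ystar x u) u)"
  proof (rule SUP_eqI)
    show "Q_fun Pn \<beta> x y u \<le> ereal (Qr x (ystar x u) u)" for y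
    proof (cases "y \<in> Y")
      case True
      have "0 \<le> \<nu> / 2 * (norm (y - ystar x u))\<^sup>2" using \<nu> by simp
      then have "Qr x y u \<le> Qr x (ystar x u) u"
        using ystar(2)[OF True, of x u] unfolding Qr_eq by linarith
      then show ?thesis using Q True by simp
    qed (simp add: Q)
    show "ereal (Qr x (ystar x u) u) \<le> z" if "\<And>y. y \<in> UNIV \<Longrightarrow> Q_fun Pn \<beta> x y u \<le> z" for z
      using that[of "ystar x u"] Q ystar(1) by simp
  qed
  then show ?thesis by (simp add: Psi_def)
qed

lemma Qr_above_tangent:
  "Qr x y u + gradx P x y \<bullet> (x' - x) + (1 / \<beta>) *\<^sub>R (u - pos (\<beta> *\<^sub>R pfun P y + u)) \<bullet> (u' - u) \<le> Qr x' y u'"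
proof -
  let ?p = "\<lambda>i. \<beta> * pfun P y $ i"
  have "(\<Sum>i\<in>UNIV. (u $ i)\<^sup>2 - (max (?p i + u $ i) 0)\<^sup>2 + 2 * ((u $ i - max (?p i + u $ i) 0) * (u' $ i - u $ i)))
    \<le> (\<Sum>i\<in>UNIV. (u' $ i)\<^sup>2 - (max (?p i + u' $ i) 0)\<^sup>2)"
    by (intro sum_mono half_sq_minus_pos_above_tangent)
  then have "(norm u)\<^sup>2 - (norm (pos (\<beta> *\<^sub>R pfun P y + u)))\<^sup>2 + 2 * ((u - pos (\<beta> *\<^sub>R pfun P y + u)) \<bullet> (u' - u))
    \<le> (norm u')\<^sup>2 - (norm (pos (\<beta> *\<^sub>R pfun P y + u')))\<^sup>2"
    unfolding norm_sq_cart inner_vec_def by (simp add: sum.distrib sum_distrib_left sum_subtractf)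
  from mult_left_mono[OF this, of "1 / (2 * \<beta>)"] params(4)
  have "1 / (2 * \<beta>) * ((norm u)\<^sup>2 - (norm (pos (\<beta> *\<^sub>R pfun P y + u)))\<^sup>2)
      + (1 / \<beta>) *\<^sub>R (u - pos (\<beta> *\<^sub>R pfun P y + u)) \<bullet> (u' - u)
    \<le> 1 / (2 * \<beta>) * ((norm u')\<^sup>2 - (norm (pos (\<beta> *\<^sub>R pfun P y + u')))\<^sup>2)"
    by (simp add: distrib_left)
  then show ?thesis using F_convex_x[of x y x'] unfolding Qr_def by (simp add: algebra_simps)
qed

definition GPsi :: "real^'n \<Rightarrow> real^'r \<Rightarrow> (real^'n) \<times> (real^'r)" where
  "GPsi x u = (gradx P x (ystar x u), (1 / \<beta>) *\<^sub>R (u - pos (\<beta> *\<^sub>R pfun P (ystar x u) + u)))"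

text \<open>Freezing the maximiser at \<open>(x, u)\<close> gives a lower bound for \<open>\<Psi>\<close> elsewhere, so a tangent of
  \<open>Q(\<cdot>, ystar x u, \<cdot>)\<close> is a subgradient of \<open>\<Psi>\<close>.\<close>

lemma Psi_above_tangent:
  "Psi Pn \<beta> x u + GPsi x u \<bullet> ((x', u') - (x, u)) \<le> Psi Pn \<beta> x' u'"
proof -
  have "Qr x' (ystar x u) u' \<le> Qr x' (ystar x' u') u'"
    using ystar(2)[OF ystar(1)[of x u], of x' u'] \<nu> unfolding Qr_eq
    by (smt (verit) zero_le_power2 mult_nonneg_nonneg divide_nonneg_nonneg)
  then show ?thesis
    using Qr_above_tangent[of x "ystar x u" u x' u'] unfolding Psi_eq GPsi_def by simp
qed

text \<open>\<open>ystar x2 u2\<close> is a nearly stationary point of the inner problem at \<open>(x1, u1)\<close>.\<close>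

lemma ystar_lipschitz:
  "\<nu> * norm (ystar x1 u1 - ystar x2 u2) \<le> L_F * norm (x1 - x2) + B * norm (u1 - u2)"
proof -
  let ?y = "ystar x2 u2"
  have "norm (Gy x1 u1 ?y - Gy x2 u2 ?y) \<le> L_F * norm (x1 - x2) + B * norm (u1 - u2)"
  proof -
    have "Gy x1 u1 ?y - Gy x2 u2 ?y = (grady P x2 ?y - grady P x1 ?y) + (pc.pen_grad \<beta> u1 ?y - pc.pen_grad \<beta> u2 ?y)"
      by (simp add: Gy_def)
    moreover have "norm (grady P x2 ?y - grady P x1 ?y) \<le> L_F * norm (x1 - x2)"
      using grad_lipschitz(2)[of x2 ?y x1 ?y] by (simp add: norm_minus_commute)
    moreover have "norm (pc.pen_grad \<beta> u1 ?y - pc.pen_grad \<beta> u2 ?y) \<le> B * norm (u1 - u2)"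
    proof -
      let ?d = "pos (\<beta> *\<^sub>R pfun P ?y + u1) - pos (\<beta> *\<^sub>R pfun P ?y + u2)"
      have "pc.pen_grad \<beta> u1 ?y - pc.pen_grad \<beta> u2 ?y = transpose (Jac (pfun P) ?y) *v ?d"
        unfolding pc.pen_grad_def by (simp only: matrix_vector_mult_diff_distrib)
      then have "norm (pc.pen_grad \<beta> u1 ?y - pc.pen_grad \<beta> u2 ?y) \<le> norm (Jac (pfun P) ?y) * norm ?d"
        by (simp only: norm_transpose_mult_le)
      also have "\<dots> \<le> B * norm (u1 - u2)"
        using p_bound(2)[OF dom2(2)[OF ystar(1)]] norm_pos_diff_le[of "\<beta> *\<^sub>R pfun P ?y + u1" "\<beta> *\<^sub>R pfun P ?y + u2"] pos
        by (intro mult_mono) auto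
      finally show ?thesis .
    qed
    ultimately show ?thesis using norm_triangle_ineq[of "grady P x2 ?y - grady P x1 ?y"] by (smt (verit))
  qed
  then have "norm (Gy x1 u1 ?y + (- Gy x2 u2 ?y)) \<le> L_F * norm (x1 - x2) + B * norm (u1 - u2)" by simp
  from ystar_distance[OF ystar(1) _ this] ystar(3)
  show ?thesis by (simp add: norm_minus_commute)
qed

definition LPsi :: real where "LPsi = L_F + 2 / \<beta> + (L_F + B)\<^sup>2 / \<nu>"

lemma LPsi_pos: "0 < LPsi"
  unfolding LPsi_def using L_F_nonneg params \<nu> by (intro add_pos_nonneg add_nonneg_pos) auto

lemma GPsi_lipschitz:
  "norm (GPsi x u - GPsi x' u') \<le> LPsi * norm ((x, u) - (x', u'))"
proof -
  let ?y = "ystar x u" and ?y' = "ystar x' u'"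
  define n where "n = norm ((x, u) - (x', u'))"
  define k where "k = norm (?y - ?y')"
  have nx: "norm (x - x') \<le> n" and nu: "norm (u - u') \<le> n"
    unfolding n_def using norm_fst_snd_le[of "(x, u) - (x', u')"] by auto
  have k: "k \<le> (L_F + B) / \<nu> * n"
  proof -
    have "\<nu> * k \<le> L_F * n + B * n"
      using ystar_lipschitz[of x u x' u'] mult_left_mono[OF nx L_F_nonneg] mult_left_mono[OF nu less_imp_le[OF pos(1)]]
      unfolding k_def by linarith
    then show ?thesis using \<nu> by (simp add: field_simps)
  qed
  have a: "norm (gradx P x ?y - gradx P x' ?y') \<le> L_F * (norm (x - x') + k)"
    unfolding k_def by (rule grad_lipschitz)
  define e where "e = (u - pos (\<beta> *\<^sub>R pfun P ?y + u)) - (u' - pos (\<beta> *\<^sub>R pfun P ?y' + u'))"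
  have "norm e \<le> 2 * norm (u - u') + \<beta> * (B * k)"
  proof -
    have "norm (pos (\<beta> *\<^sub>R pfun P ?y' + u') - pos (\<beta> *\<^sub>R pfun P ?y + u))
        \<le> norm ((\<beta> *\<^sub>R pfun P ?y' + u') - (\<beta> *\<^sub>R pfun P ?y + u))" by (rule norm_pos_diff_le)
    also have "(\<beta> *\<^sub>R pfun P ?y' + u') - (\<beta> *\<^sub>R pfun P ?y + u) = (u' - u) + \<beta> *\<^sub>R (pfun P ?y' - pfun P ?y)"
      by (simp add: algebra_simps)
    also have "norm \<dots> \<le> norm (u' - u) + \<beta> * norm (pfun P ?y' - pfun P ?y)"
      using norm_triangle_ineq[of "u' - u" "\<beta> *\<^sub>R (pfun P ?y' - pfun P ?y)"] params(4) by simp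
    also have "\<dots> \<le> norm (u' - u) + \<beta> * (B * k)"
      using p_lipschitz[OF ystar(1) ystar(1), of x' u' x u] params(4)
      unfolding k_def by (simp add: norm_minus_commute)
    finally have "norm (pos (\<beta> *\<^sub>R pfun P ?y' + u') - pos (\<beta> *\<^sub>R pfun P ?y + u)) \<le> norm (u - u') + \<beta> * (B * k)"
      by (simp add: norm_minus_commute)
    moreover have "e = (u - u') + (pos (\<beta> *\<^sub>R pfun P ?y' + u') - pos (\<beta> *\<^sub>R pfun P ?y + u))"
      by (simp add: e_def)
    ultimately show ?thesis using norm_triangle_ineq[of "u - u'"] by (smt (verit))
  qed
  then have b: "norm ((1 / \<beta>) *\<^sub>R e) \<le> 2 / \<beta> * norm (u - u') + B * k"
    using params(4) by (simp add: field_simps)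
  have "GPsi x u - GPsi x' u' = (gradx P x ?y - gradx P x' ?y', (1 / \<beta>) *\<^sub>R e)"
    unfolding GPsi_def e_def by (simp add: scaleR_diff_right)
  then have "norm (GPsi x u - GPsi x' u') \<le> norm (gradx P x ?y - gradx P x' ?y') + norm ((1 / \<beta>) *\<^sub>R e)"
    by (simp only: norm_Pair) (rule sqrt_sum_squares_le_sum, simp_all)
  also have "\<dots> \<le> L_F * (norm (x - x') + k) + (2 / \<beta> * norm (u - u') + B * k)"
    using a b by (rule add_mono)
  also have "\<dots> = L_F * norm (x - x') + 2 / \<beta> * norm (u - u') + (L_F + B) * k" by (simp add: algebra_simps)
  also have "\<dots> \<le> L_F * n + 2 / \<beta> * n + (L_F + B) * ((L_F + B) / \<nu> * n)"
    using nx nu k L_F_nonneg pos params by (intro add_mono mult_left_mono) auto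
  also have "\<dots> = LPsi * n" unfolding LPsi_def by (simp add: power2_eq_square algebra_simps)
  finally show ?thesis unfolding n_def .
qed

lemma GPsi_cocoercive:
  "(norm (GPsi x u - GPsi x' u'))\<^sup>2 \<le> 2 * LPsi * ((GPsi x u - GPsi x' u') \<bullet> ((x, u) - (x', u')))"
proof -
  have "(norm ((\<lambda>(x, u). GPsi x u) (x, u) - (\<lambda>(x, u). GPsi x u) (x', u')))\<^sup>2
    \<le> 2 * LPsi * (((\<lambda>(x, u). GPsi x u) (x, u) - (\<lambda>(x, u). GPsi x u) (x', u')) \<bullet> ((x, u) - (x', u')))"
    by (rule cocoercive_of_lipschitz[where S = UNIV and \<psi> = "\<lambda>(x, u). Psi Pn \<beta> x u"])
      (use Psi_above_tangent GPsi_lipschitz LPsi_pos in auto)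
  then show ?thesis by simp
qed

definition Gxu :: "real \<Rightarrow> real^'q \<Rightarrow> (real^'n) \<times> (real^'r) \<Rightarrow> (real^'n) \<times> (real^'r)" where
  "Gxu \<beta>x z = (\<lambda>(x, u). GPsi x u + (cc.pen_grad \<beta>x z x, 0))"

definition fxu :: "real \<Rightarrow> real^'n \<Rightarrow> real^'r \<Rightarrow> (real^'n) \<times> (real^'r) \<Rightarrow> real" where
  "fxu \<rho> xt ut = (\<lambda>(x, u). gr x + \<rho> / 2 * ((norm (x - xt))\<^sup>2 + (norm (u - ut))\<^sup>2))"

definition LX :: "real \<Rightarrow> real \<Rightarrow> real" where
  "LX \<beta>x Z = 2 * LPsi + 2 * (L_c * (\<beta>x * B + Z) + \<beta>x * B\<^sup>2 + 1)"

lemma psi_xu_eq: "psi_xu Pn \<beta> \<beta>x z (x, u) = Psi Pn \<beta> x u + cc.pen \<beta>x z x"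
  unfolding psi_xu_def cc.pen_def by simp

lemma phi_xu_eq: "phi_xu Pn \<rho> xt ut v = (if v \<in> X \<times> UNIV then ereal (fxu \<rho> xt ut v) else \<infinity>)"
  unfolding phi_xu_def fxu_def using g(1)[of "fst v"] by (cases v) simp

lemma penalty_const_pos: "0 < \<beta>x \<Longrightarrow> 0 \<le> Z \<Longrightarrow> 0 < 2 * (L_c * (\<beta>x * B + Z) + \<beta>x * B\<^sup>2 + 1)"
  using lipschitz_on_nonneg[OF cc.lip] pos
  by (intro mult_pos_pos add_nonneg_pos add_nonneg_nonneg mult_nonneg_nonneg) auto

lemma LX_pos: "0 < \<beta>x \<Longrightarrow> 0 \<le> Z \<Longrightarrow> 0 < LX \<beta>x Z"
  using penalty_const_pos LPsi_pos unfolding LX_def by (intro add_pos_pos) auto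

text \<open>The part from \<open>\<Psi>\<close> is globally cocoercive, in particular for unbounded \<open>u\<close>; only the penalty
  of \<open>c\<close> needs \<open>x\<close> to be bounded.\<close>

lemma Gxu_cocoercive:
  assumes "norm z \<le> Z" "0 < \<beta>x" "v \<in> X \<times> UNIV" "w \<in> X \<times> UNIV"
  shows "(norm (Gxu \<beta>x z v - Gxu \<beta>x z w))\<^sup>2 \<le> LX \<beta>x Z * ((Gxu \<beta>x z v - Gxu \<beta>x z w) \<bullet> (v - w))"
proof -
  obtain x u x' u' where vw: "v = (x, u)" "w = (x', u')" by (cases v, cases w)
  let ?C = "2 * (L_c * (\<beta>x * B + Z) + \<beta>x * B\<^sup>2 + 1)"
  have Z: "0 \<le> Z" using assms(1) norm_ge_zero order_trans by blast
  have "(norm (cc.pen_grad \<beta>x z x - cc.pen_grad \<beta>x z x'))\<^sup>2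
      \<le> ?C * ((cc.pen_grad \<beta>x z x - cc.pen_grad \<beta>x z x') \<bullet> (x - x'))"
    by (rule cc.pen_cocoercive[where a = 0 and r = r, OF c_bound(2,1)]) (use assms dom vw in auto)
  then have "(norm (cc.pen_grad \<beta>x z x - cc.pen_grad \<beta>x z x', 0 :: real^'r))\<^sup>2
      \<le> ?C * ((cc.pen_grad \<beta>x z x - cc.pen_grad \<beta>x z x', 0 :: real^'r) \<bullet> (v - w))"
    unfolding vw by (simp add: norm_Pair)
  moreover have "Gxu \<beta>x z v - Gxu \<beta>x z w
      = (GPsi x u - GPsi x' u') + (cc.pen_grad \<beta>x z x - cc.pen_grad \<beta>x z x', 0)"
    unfolding Gxu_def vw by simp
  moreover have "(norm (GPsi x u - GPsi x' u'))\<^sup>2 \<le> 2 * LPsi * ((GPsi x u - GPsi x' u') \<bullet> (v - w))"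
    unfolding vw by (rule GPsi_cocoercive)
  ultimately show ?thesis
    unfolding LX_def using LPsi_pos penalty_const_pos[OF assms(2) Z] by (simp only: cocoercive_add)
qed

lemma strongly_convex_fxu: "strongly_convex_on (X \<times> UNIV) \<rho> (fxu \<rho> xt ut)"
proof -
  have cvx: "convex (X \<times> (UNIV :: (real^'r) set))" using convex_X by (intro convex_Times) auto
  have "convex_on (X \<times> (UNIV :: (real^'r) set)) (\<lambda>v. gr (fst v))"
    using g(2) cvx unfolding convex_on_def by auto
  from strongly_convex_on_add[OF convex_on_imp_strongly_convex_on[OF this] strongly_convex_on_quadratic[OF cvx, of \<rho> "(xt, ut)"]]
  have "strongly_convex_on (X \<times> UNIV) \<rho> (\<lambda>v. gr (fst v) + \<rho> / 2 * (norm (v - (xt, ut)))\<^sup>2)" by simp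
  moreover have "(\<lambda>v. gr (fst v) + \<rho> / 2 * (norm (v - (xt, ut)))\<^sup>2) = fxu \<rho> xt ut"
    unfolding fxu_def by (auto simp: norm_Pair)
  ultimately show ?thesis by simp
qed

lemma continuous_fxu: "continuous_on (X \<times> UNIV) (fxu \<rho> xt ut)"
proof -
  have "continuous_on (X \<times> (UNIV :: (real^'r) set)) (\<lambda>v. gr (fst v))"
    by (rule continuous_on_compose2[OF g(5)]) (auto intro: continuous_intros)
  then show ?thesis unfolding fxu_def case_prod_unfold by (intro continuous_intros)
qed

lemma Gxu_above_tangent:
  assumes "0 < \<beta>x"
  shows "psi_xu Pn \<beta> \<beta>x z v + Gxu \<beta>x z v \<bullet> (w - v) \<le> psi_xu Pn \<beta> \<beta>x z w"
proof -
  obtain x u x' u' where vw: "v = (x, u)" "w = (x', u')" by (cases v, cases w)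
  show ?thesis
    using Psi_above_tangent[of x u x' u'] cc.pen_above_tangent[OF assms, of z x x']
    unfolding vw psi_xu_eq Gxu_def by (simp add: inner_add_left)
qed

lemma outer_composite:
  assumes "norm z \<le> Z" "0 < \<beta>x" "0 < \<rho>"
  shows "composite_problem (psi_xu Pn \<beta> \<beta>x z) (fxu \<rho> xt ut) (Gxu \<beta>x z) (X \<times> UNIV) \<rho> (LX \<beta>x Z)"
  using assms order_trans[OF norm_ge_zero, of z Z]
  by unfold_locales (auto simp: g closed_Times compact_imp_closed strongly_convex_fxu continuous_fxu
      Gxu_above_tangent LX_pos intro: Gxu_cocoercive[OF assms(1,2)])

text \<open>The radius \<open>RY tol\<close> grows with \<open>tol\<close>, but \<open>RY tol / tol\<close> decreases.\<close>

lemma inner_cost_antimono: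
  assumes "0 < tol" "tol \<le> tol'" "1 \<le> \<kappa>" "0 \<le> U"
  shows "inner_cost \<kappa> U tol' \<le> inner_cost \<kappa> U tol"
proof -
  have RY: "(RY t / t)\<^sup>2 = Dy\<^sup>2 / t\<^sup>2 + 4 * (\<nu> * (8 * Dy / t + 1 / (2 * Llow par)))" if "0 < t" for t
    unfolding RY_def power_divide using that \<nu> Dy_pos params
    by (subst real_sqrt_pow2) (auto simp: power2_eq_square field_simps intro!: add_nonneg_nonneg mult_nonneg_nonneg)
  have "(RY tol' / tol')\<^sup>2 \<le> (RY tol / tol)\<^sup>2"
    using assms \<nu> Dy_pos params unfolding RY[OF assms(1)] RY[OF less_le_trans[OF assms(1,2)]]
    by (intro add_mono mult_left_mono divide_left_mono power_mono) auto
  moreover have "(14 * R * L / t)\<^sup>2 = (14 * L)\<^sup>2 * (R / t)\<^sup>2" for R L t :: real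
    by (simp add: power_mult_distrib power_divide)
  moreover have L: "0 < LYmax \<kappa> U"
    unfolding LYmax_def using params assms(3) by (auto simp: less_max_iff_disj)
  ultimately have "(14 * RY tol' * LYmax \<kappa> U / tol')\<^sup>2 * (LYmax \<kappa> U / (2 * \<nu>))
      \<le> (14 * RY tol * LYmax \<kappa> U / tol)\<^sup>2 * (LYmax \<kappa> U / (2 * \<nu>))"
    using \<nu> by (intro mult_right_mono) (auto intro: mult_left_mono)
  then have "iter_bound (LYmax \<kappa> U) \<nu> (RY tol') tol' \<le> iter_bound (LYmax \<kappa> U) \<nu> (RY tol) tol"
    unfolding iter_bound_def using L \<nu>
    by (intro nat_mono ceiling_mono divide_right_mono ln_mono max.mono) auto
  then show ?thesis unfolding inner_cost_def by (intro mult_right_mono) auto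
qed

text \<open>An inner error of \<open>\<omega> / (LF + M_p P)\<close> in \<open>y\<close> moves the \<open>x\<close>-part by at most \<open>L_F\<close> and the \<open>u\<close>-part by at
  most \<open>M_p P\<close> times as much.\<close>

lemma approx_gradient:
  fixes m :: "calls \<Rightarrow> nat"
  assumes LF: "L_F \<le> LF" and u: "norm u \<le> U" and yt: "yt \<in> Y" and \<omega>: "0 < \<omega>"
    and \<Lambda>: "\<And>i. 1 \<le> \<Lambda> i" "ey = 0 \<or> (\<forall>i. \<Lambda> i \<le> \<kappa>)"
    and m: "\<And>s. m (tick_y s) \<le> m s + ey" "\<And>s. m (tick_h s) \<le> m s + ey" "\<And>s. m (tick_x s) \<le> m s + ex"
      "\<And>s i. m (s\<lparr>n_iapg := i\<rparr>) = m s"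
  shows "\<exists>g s'. approx_gradient_xu \<Lambda> Pn par \<nu> LF \<beta>x z yt (x, u) \<omega> s = Some (g, s') \<and>
    norm (g - Gxu \<beta>x z (x, u)) \<le> \<omega> \<and>
    m s' \<le> m s + (inner_cost \<kappa> U (\<omega> * \<nu> / (LF + M_p P)) * ey + ex)"
proof -
  have LM: "0 < LF + M_p P" "L_F + M_p P \<le> LF + M_p P" using LF L_M by auto
  define tol where "tol = \<omega> * \<nu> / (LF + M_p P)"
  have tol: "0 < tol" using \<omega> \<nu> LM by (simp add: tol_def)
  have "ey = 0 \<or> \<Lambda> (n_iapg s) \<le> \<kappa>" using \<Lambda> by blast
  from solve_y[where m = m and e = ey and \<Lambda> = \<Lambda> and s = s and x = x, OF u yt tol \<Lambda>(1) this m(1,2) m(4)]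
  obtain y s' sg where sy: "solve_y \<Lambda> Pn par \<nu> yt x u tol s = Some (y, s')" "y \<in> Y"
    "\<forall>w\<in>Y. fy y + sg \<bullet> (w - y) + \<nu> / 2 * (norm (w - y))\<^sup>2 \<le> fy w" "norm (Gy x u y + sg) \<le> tol"
    "m s' \<le> m s + inner_cost \<kappa> U tol * ey" by blast
  define k where "k = norm (y - ystar x u)"
  have "\<nu> * k \<le> tol" using ystar_distance[OF sy(2-4)] by (simp add: k_def)
  then have "\<nu> * k \<le> \<nu> * (\<omega> / (LF + M_p P))" by (simp add: tol_def mult.commute)
  then have k: "k \<le> \<omega> / (LF + M_p P)" using mult_le_cancel_left_pos[OF \<nu>] by blast
  let ?g = "(gradx Pn x y + transpose (Jac (cfun Pn) x) *v pos (\<beta>x *\<^sub>R cfun Pn x + z),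
            (1 / \<beta>) *\<^sub>R (u - pos (\<beta> *\<^sub>R pfun Pn y + u)))"
  define dx where "dx = gradx P x y - gradx P x (ystar x u)"
  define du where "du = (1 / \<beta>) *\<^sub>R (pos (\<beta> *\<^sub>R pfun P (ystar x u) + u) - pos (\<beta> *\<^sub>R pfun P y + u))"
  have g: "?g - Gxu \<beta>x z (x, u) = (dx, du)"
    unfolding Gxu_def GPsi_def cc.pen_grad_def dx_def du_def by (simp add: scaleR_diff_right)
  have dx: "norm dx \<le> L_F * k"
    using grad_lipschitz(1)[of x y x "ystar x u"] by (simp add: dx_def k_def)
  have du: "norm du \<le> M_p P * k"
  proof -
    have "norm (pos (\<beta> *\<^sub>R pfun P (ystar x u) + u) - pos (\<beta> *\<^sub>R pfun P y + u))
        \<le> norm ((\<beta> *\<^sub>R pfun P (ystar x u) + u) - (\<beta> *\<^sub>R pfun P y + u))" by (rule norm_pos_diff_le)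
    also have "\<dots> = \<beta> * norm (pfun P (ystar x u) - pfun P y)"
      using params(4) by (simp add: scaleR_diff_right[symmetric])
    also have "\<dots> \<le> \<beta> * (M_p P * k)"
      using M_p(2)[OF ystar(1) sy(2), of x u] params(4) by (simp add: k_def norm_minus_commute)
    finally show ?thesis unfolding du_def norm_scaleR using params(4) by (simp add: divide_le_eq mult_ac)
  qed
  have "norm (?g - Gxu \<beta>x z (x, u)) \<le> norm dx + norm du"
    unfolding g norm_Pair by (rule sqrt_sum_squares_le_sum) simp_all
  also have "\<dots> \<le> (L_F + M_p P) * k" using dx du by (simp add: distrib_right)
  also have "\<dots> \<le> (LF + M_p P) * k" using LM by (intro mult_right_mono) (auto simp: k_def)
  also have "\<dots> \<le> \<omega>" using k LM by (simp add: field_simps)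
  finally have err: "norm (?g - Gxu \<beta>x z (x, u)) \<le> \<omega>" .
  have "approx_gradient_xu \<Lambda> Pn par \<nu> LF \<beta>x z yt (x, u) \<omega> s = Some (?g, tick_x s')"
    unfolding approx_gradient_xu_def using sy(1) by (simp add: tol_def)
  moreover have "m (tick_x s') \<le> m s + (inner_cost \<kappa> U tol * ey + ex)"
    using m(3)[of s'] sy(5) by linarith
  ultimately show ?thesis using err unfolding tol_def by blast
qed

end

section \<open>One proximal augmented Lagrangian step\<close>

text \<open>By convexity \<open>J(d) (xf - d) \<le> c xf - c d \<le> - \<delta> - c d\<close> in every component; multiply by \<open>z \<ge> 0\<close> and sum.\<close>

lemma (in convex_constraint) slater_inequality:
  assumes z: "\<And>i. 0 \<le> z $ i" and xf: "\<And>i. c xf $ i \<le> - \<delta>" and \<delta>: "0 < \<delta>"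
  shows "\<delta> * norm z + z \<bullet> c d \<le> - ((transpose (Jac c d) *v z) \<bullet> (xf - d))"
proof -
  have "norm z \<le> (\<Sum>i\<in>UNIV. z $ i)" using norm_le_l1_cart[of z] z by simp
  then have "\<delta> * norm z \<le> (\<Sum>i\<in>UNIV. \<delta> * z $ i)"
    using \<delta> by (simp add: sum_distrib_left[symmetric])
  moreover have "z $ i * (Jac c d *v (xf - d)) $ i + \<delta> * z $ i + z $ i * c d $ i \<le> 0" for i
  proof -
    have "(Jac c d *v (xf - d)) $ i + \<delta> + c d $ i \<le> 0" using above_tangent[of d i xf] xf[of i] by linarith
    from mult_nonneg_nonpos[OF z this, of i] show ?thesis by (simp add: algebra_simps)
  qed
  then have "(\<Sum>i\<in>UNIV. z $ i * (Jac c d *v (xf - d)) $ i + \<delta> * z $ i + z $ i * c d $ i) \<le> 0"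
    by (intro sum_nonpos) auto
  ultimately show ?thesis unfolding inner_transpose_mult by (simp add: inner_vec_def sum.distrib)
qed

text \<open>In every component either \<open>\<zeta> = 0\<close> or \<open>\<beta> c = \<zeta> - z\<close>. So feasibility and complementarity are controlled
  by the change \<open>\<zeta> - z\<close> of the multiplier.\<close>

lemma multiplier_inner:
  fixes z c :: "real^'k"
  assumes \<beta>: "0 < \<beta>" and \<zeta>: "\<zeta> = pos (\<beta> *\<^sub>R c + z)"
  shows "\<beta> * (\<zeta> \<bullet> c) = \<zeta> \<bullet> (\<zeta> - z)"
    and "norm (pos c) \<le> norm (\<zeta> - z) / \<beta>"
    and "(\<Sum>i\<in>UNIV. \<bar>c $ i * \<zeta> $ i\<bar>) \<le> norm \<zeta> * norm (\<zeta> - z) / \<beta>"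
proof -
  have i: "\<beta> * (c $ i * \<zeta> $ i) = \<zeta> $ i * (\<zeta> - z) $ i" for i
    unfolding \<zeta> by (auto simp: max_def algebra_simps)
  show "\<beta> * (\<zeta> \<bullet> c) = \<zeta> \<bullet> (\<zeta> - z)"
    unfolding inner_vec_def sum_distrib_left using i by (intro sum.cong) (auto simp: mult_ac)
  have "norm (\<beta> *\<^sub>R pos c) \<le> norm (\<zeta> - z)"
  proof (intro norm_le_componentwise_cart)
    fix i
    show "norm ((\<beta> *\<^sub>R pos c) $ i) \<le> norm ((\<zeta> - z) $ i)"
    proof (cases "c $ i \<le> 0")
      case False
      then have "0 < \<beta> * c $ i" using \<beta> by simp
      then show ?thesis using False unfolding \<zeta> by simp
    qed simp
  qed
  then show "norm (pos c) \<le> norm (\<zeta> - z) / \<beta>" using \<beta> by (simp add: field_simps)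
  have "(\<Sum>i\<in>UNIV. \<bar>c $ i * \<zeta> $ i\<bar>) * \<beta> = (\<Sum>i\<in>UNIV. \<bar>\<zeta> $ i * (\<zeta> - z) $ i\<bar>)"
    unfolding sum_distrib_right i[symmetric] using \<beta> by (intro sum.cong) (auto simp: abs_mult mult_ac)
  also have "\<dots> \<le> norm \<zeta> * norm (\<zeta> - z)" by (rule inner_le_pos_mult)
  finally show "(\<Sum>i\<in>UNIV. \<bar>c $ i * \<zeta> $ i\<bar>) \<le> norm \<zeta> * norm (\<zeta> - z) / \<beta>"
    using \<beta> by (simp add: field_simps)
qed

lemma inner_diff_ge: "((norm a)\<^sup>2 - (norm b)\<^sup>2) / 2 \<le> a \<bullet> (a - b)"
proof -
  have "0 \<le> (norm (a - b))\<^sup>2" by simp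
  then show ?thesis unfolding power2_norm_eq_inner by (simp add: inner_diff_left inner_diff_right inner_commute)
qed

lemma query_accuracy_pos:
  assumes "0 < \<mu>" "0 < \<epsilon>"
  shows "0 < query_accuracy Lmin \<mu> \<epsilon> R Lmax K"
  unfolding query_accuracy_def Let_def using assms by (auto simp: min_less_iff_conj intro!: divide_pos_pos mult_pos_pos)

context perturbed_minimax
begin

lemma r_nonneg: "0 \<le> r"
  using dom(2) params(10) by (metis mem_cball zero_le_dist order_trans subsetD)

lemma dist_X: "x \<in> X \<Longrightarrow> x' \<in> X \<Longrightarrow> norm (x - x') \<le> 2 * r"
proof -
  assume "x \<in> X" "x' \<in> X"
  then have "norm x \<le> r" "norm x' \<le> r" using dom(1) by (auto simp: subset_iff)
  then show ?thesis using norm_triangle_ineq4[of x x'] by linarith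
qed

lemma hr_subgradient:
  assumes "\<forall>w\<in>Y. fy y + sg \<bullet> (w - y) + \<nu> / 2 * (norm (w - y))\<^sup>2 \<le> fy w" "w \<in> Y"
  shows "hr y + (sg - \<nu> *\<^sub>R y) \<bullet> (w - y) \<le> hr w"
proof -
  have "\<nu> / 2 * (norm w)\<^sup>2 = \<nu> / 2 * (norm y)\<^sup>2 + (\<nu> *\<^sub>R y) \<bullet> (w - y) + \<nu> / 2 * (norm (w - y))\<^sup>2"
    unfolding power2_norm_eq_inner by (simp add: inner_diff_left inner_diff_right inner_commute algebra_simps)
  then show ?thesis using assms(1)[rule_format, OF assms(2)] 
    unfolding fy_def inner_diff_left by linarith
qed

text \<open>A subgradient of the outer nonsmooth part splits: its \<open>u\<close>-part is the gradient of the proximal term,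
  and removing the proximal term from its \<open>x\<close>-part leaves a subgradient of \<open>g\<close>.\<close>

lemma fxu_subgradient:
  assumes x: "x \<in> X"
    and sg: "\<forall>w\<in>X \<times> UNIV. fxu \<rho> xt ut (x, u) + sg \<bullet> (w - (x, u)) + \<rho> / 2 * (norm (w - (x, u)))\<^sup>2 \<le> fxu \<rho> xt ut w"
  shows "snd sg = \<rho> *\<^sub>R (u - ut)"
    and "w \<in> X \<Longrightarrow> gr x + (fst sg - \<rho> *\<^sub>R (x - xt)) \<bullet> (w - x) \<le> gr w"
proof -
  have quad: "\<rho> / 2 * (norm (a + h - b))\<^sup>2 = \<rho> / 2 * (norm (a - b))\<^sup>2 + (\<rho> *\<^sub>R (a - b)) \<bullet> h + \<rho> / 2 * (norm h)\<^sup>2"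
    for a b h :: "'a::real_inner"
    unfolding power2_norm_eq_inner
    by (simp add: inner_diff_left inner_diff_right inner_add_left inner_add_right inner_commute algebra_simps)
  define k where "k = snd sg - \<rho> *\<^sub>R (u - ut)"
  have "fxu \<rho> xt ut (x, u) + sg \<bullet> ((x, u + k) - (x, u)) + \<rho> / 2 * (norm ((x, u + k) - (x, u)))\<^sup>2 \<le> fxu \<rho> xt ut (x, u + k)"
    using sg x by blast
  then have "snd sg \<bullet> k \<le> (\<rho> *\<^sub>R (u - ut)) \<bullet> k"
    using quad[of u k ut] unfolding fxu_def by (cases sg) (simp add: norm_Pair distrib_left)
  then have "k \<bullet> k \<le> 0" by (simp add: k_def inner_diff_left)
  then have "k = 0" using inner_ge_zero[of k] inner_eq_zero_iff[of k] by linarith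
  then show "snd sg = \<rho> *\<^sub>R (u - ut)" by (simp add: k_def)
  assume w: "w \<in> X"
  have "fxu \<rho> xt ut (x, u) + sg \<bullet> ((w, u) - (x, u)) + \<rho> / 2 * (norm ((w, u) - (x, u)))\<^sup>2 \<le> fxu \<rho> xt ut (w, u)"
    using sg w by blast
  then show "gr x + (fst sg - \<rho> *\<^sub>R (x - xt)) \<bullet> (w - x) \<le> gr w"
    using quad[of x "w - x" xt] unfolding fxu_def inner_diff_left[of "fst sg"]
    by (cases sg) (simp add: norm_Pair distrib_left add_divide_distrib)
qed

definition BU :: real where "BU = 2 * B + (B + nubar * Dy) * Dy"
definition BX :: real where "BX = 2 * B + (B + eta0 par + rho0 par * (2 * r)) * (2 * r)"

text \<open>The optimality condition of the inner maximiser, tested against the Slater point \<open>yf\<close>.\<close>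

lemma slater_u:
  fixes u :: "real^'r"
  assumes x: "x \<in> X"
  defines "ut \<equiv> pos (\<beta> *\<^sub>R pfun P (ystar x u) + u)"
  shows "\<delta> * norm ut + ut \<bullet> pfun P (ystar x u) \<le> BU"
proof -
  let ?y = "ystar x u"
  have sub: "hr ?y + (- Gy x u ?y - \<nu> *\<^sub>R ?y) \<bullet> (yf - ?y) \<le> hr yf"
    using ystar(3) by (intro hr_subgradient slater_y) blast
  have "- ((transpose (Jac (pfun P) ?y) *v ut) \<bullet> (yf - ?y))
      \<le> hr yf - hr ?y - (grady P x ?y - \<nu> *\<^sub>R (?y - y0)) \<bullet> (yf - ?y)"
    using sub unfolding Gy_def pc.pen_grad_def ut_def[symmetric]
    by (simp add: inner_diff_left inner_add_left scaleR_diff_right)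
  also have "\<dots> \<le> 2 * B + (B + nubar * Dy) * Dy"
  proof -
    have "norm (grady P x ?y - \<nu> *\<^sub>R (?y - y0)) \<le> norm (grady P x ?y) + norm (\<nu> *\<^sub>R (?y - y0))"
      by (rule norm_triangle_ineq4)
    also have "\<dots> \<le> B + nubar * Dy"
      using grad_bound(2)[OF x ystar(1), of x u] dist_Y[OF ystar(1) params(10), of x u] \<nu> nubar
      by (auto intro!: add_mono mult_mono)
    finally have "norm (grady P x ?y - \<nu> *\<^sub>R (?y - y0)) * norm (yf - ?y) \<le> (B + nubar * Dy) * Dy"
      using dist_Y[OF slater_y(1) ystar(1), of x u] by (intro mult_mono) (auto intro: order_trans[OF norm_ge_zero])
    moreover have "- ((grady P x ?y - \<nu> *\<^sub>R (?y - y0)) \<bullet> (yf - ?y)) \<le> norm (grady P x ?y - \<nu> *\<^sub>R (?y - y0)) * norm (yf - ?y)"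
      using norm_cauchy_schwarz[of "- (grady P x ?y - \<nu> *\<^sub>R (?y - y0))" "yf - ?y"]
      by (simp only: inner_minus_left norm_minus_cancel)
    ultimately show ?thesis using gh_bound(2)[OF slater_y(1)] gh_bound(2)[OF ystar(1), of x u] by linarith
  qed
  also have "\<delta> * norm ut + ut \<bullet> pfun P ?y \<le> - ((transpose (Jac (pfun P) ?y) *v ut) \<bullet> (yf - ?y))"
    by (rule pc.slater_inequality) (use slater_y pos in \<open>auto simp: ut_def\<close>)
  finally show ?thesis unfolding BU_def .
qed

text \<open>Stationarity in \<open>u\<close> reads \<open>\<zeta> - u = \<beta>\<rho> (u - ut)\<close>. If \<open>|u| > |ut|\<close>, then \<open>\<zeta> \<bullet> p \<ge> 0\<close>, so Slater's condition
  bounds \<open>\<zeta>\<close>, and \<open>u\<close> is a convex combination of \<open>\<zeta>\<close> and \<open>ut\<close>.\<close>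

lemma exact_u_bound:
  assumes x: "x \<in> X" and \<rho>: "0 < \<rho>"
    and stat: "\<forall>w\<in>X \<times> UNIV. fxu \<rho> xt ut (x, u) + (- Gxu \<beta>x z (x, u)) \<bullet> (w - (x, u)) + \<rho> / 2 * (norm (w - (x, u)))\<^sup>2 \<le> fxu \<rho> xt ut w"
  shows "norm u \<le> max (norm ut) (BU / \<delta>)"
proof (rule ccontr)
  assume "\<not> norm u \<le> max (norm ut) (BU / \<delta>)"
  then have big: "norm ut < norm u" "BU / \<delta> < norm u" by auto
  define \<zeta> where "\<zeta> = pos (\<beta> *\<^sub>R pfun P (ystar x u) + u)"
  have "\<rho> *\<^sub>R (u - ut) = - ((1 / \<beta>) *\<^sub>R (u - \<zeta>))"
    using fxu_subgradient(1)[OF x stat] by (simp add: Gxu_def GPsi_def \<zeta>_def)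
  then have "\<beta> *\<^sub>R (\<rho> *\<^sub>R (u - ut)) = \<beta> *\<^sub>R (- ((1 / \<beta>) *\<^sub>R (u - \<zeta>)))" by simp
  then have \<zeta>u: "\<zeta> - u = (\<beta> * \<rho>) *\<^sub>R (u - ut)" using params(4) by simp
  have b\<rho>: "0 < \<beta> * \<rho>" using params(4) \<rho> by simp
  have "\<beta> * (\<zeta> \<bullet> pfun P (ystar x u)) = \<zeta> \<bullet> (\<zeta> - u)"
    by (rule multiplier_inner(1)[OF params(4) \<zeta>_def])
  also have "\<dots> = (\<beta> * \<rho>) * (u \<bullet> (u - ut) + (\<beta> * \<rho>) * ((u - ut) \<bullet> (u - ut)))"
  proof -
    have "\<zeta> = u + (\<beta> * \<rho>) *\<^sub>R (u - ut)" using \<zeta>u by (simp add: algebra_simps)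
    then have "\<zeta> \<bullet> (u - ut) = u \<bullet> (u - ut) + (\<beta> * \<rho>) * ((u - ut) \<bullet> (u - ut))"
      by (simp add: inner_add_left)
    then show ?thesis unfolding \<zeta>u by simp
  qed
  also have "\<dots> \<ge> 0"
  proof -
    have "0 \<le> ((norm u)\<^sup>2 - (norm ut)\<^sup>2) / 2" using big(1) by (simp add: power_mono)
    then have "0 \<le> u \<bullet> (u - ut)" using inner_diff_ge[of u ut] by linarith
    then show ?thesis using params(4) \<rho> by (intro mult_nonneg_nonneg add_nonneg_nonneg) auto
  qed
  finally have "0 \<le> \<zeta> \<bullet> pfun P (ystar x u)" using params(4) by (simp add: zero_le_mult_iff)
  then have "\<delta> * norm \<zeta> \<le> BU" using slater_u[OF x, of u] by (simp add: \<zeta>_def)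
  then have \<zeta>B: "norm \<zeta> \<le> BU / \<delta>" using pos by (simp add: field_simps)
  have "(1 + \<beta> * \<rho>) *\<^sub>R u = \<zeta> + (\<beta> * \<rho>) *\<^sub>R ut" using \<zeta>u by (simp add: algebra_simps)
  then have "norm ((1 + \<beta> * \<rho>) *\<^sub>R u) \<le> norm \<zeta> + norm ((\<beta> * \<rho>) *\<^sub>R ut)" using norm_triangle_ineq by metis
  then have "(1 + \<beta> * \<rho>) * norm u \<le> norm \<zeta> + (\<beta> * \<rho>) * norm ut" using b\<rho> params \<rho> by simp
  moreover have "(\<beta> * \<rho>) * norm ut \<le> (\<beta> * \<rho>) * norm u" using big(1) b\<rho> by (intro mult_left_mono) auto
  ultimately have "norm u \<le> norm \<zeta>" by (simp add: distrib_right)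
  then show False using \<zeta>B big(2) by simp
qed

text \<open>If \<open>|\<zeta>| > |z|\<close> for the new multiplier \<open>\<zeta>\<close>, then \<open>\<zeta> \<bullet> c \<ge> 0\<close>, and Slater's condition bounds \<open>|\<zeta>|\<close>.\<close>

lemma z_bound:
  assumes x: "x \<in> X" "xt \<in> X" and \<rho>: "0 < \<rho>" "\<rho> \<le> rho0 par" and \<eta>: "\<eta> \<le> eta0 par" and \<beta>x: "0 < \<beta>x"
    and sub: "\<And>w. w \<in> X \<Longrightarrow> gr x + (sx - \<rho> *\<^sub>R (x - xt)) \<bullet> (w - x) \<le> gr w"
    and stat: "norm (Gxu \<beta>x z (x, u) + (sx, su)) \<le> \<eta>"
  shows "norm (pos (\<beta>x *\<^sub>R cfun P x + z)) \<le> max (norm z) (BX / \<delta>)"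
proof (rule ccontr)
  define \<zeta> where "\<zeta> = pos (\<beta>x *\<^sub>R cfun P x + z)"
  assume "\<not> norm (pos (\<beta>x *\<^sub>R cfun P x + z)) \<le> max (norm z) (BX / \<delta>)"
  then have big: "norm z < norm \<zeta>" "BX / \<delta> < norm \<zeta>" by (auto simp: \<zeta>_def)
  let ?y = "ystar x u"
  define e where "e = gradx P x ?y + transpose (Jac (cfun P) x) *v \<zeta> + sx"
  have e: "norm e \<le> \<eta>"
    using order_trans[OF norm_fst_snd_le(1) stat] by (simp add: Gxu_def GPsi_def cc.pen_grad_def e_def \<zeta>_def)
  have "- ((transpose (Jac (cfun P) x) *v \<zeta>) \<bullet> (xf - x))
      \<le> gr xf - gr x + (gradx P x ?y - e + \<rho> *\<^sub>R (x - xt)) \<bullet> (xf - x)"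
    using sub[OF slater_x(1)] unfolding e_def by (simp add: inner_diff_left inner_add_left)
  also have "\<dots> \<le> 2 * B + (B + eta0 par + rho0 par * (2 * r)) * (2 * r)"
  proof -
    have "norm (gradx P x ?y - e + \<rho> *\<^sub>R (x - xt)) \<le> norm (gradx P x ?y) + norm e + norm (\<rho> *\<^sub>R (x - xt))"
      using norm_triangle_ineq[of "gradx P x ?y - e" "\<rho> *\<^sub>R (x - xt)"] norm_triangle_ineq4[of "gradx P x ?y" e] by linarith
    also have "norm (\<rho> *\<^sub>R (x - xt)) \<le> rho0 par * (2 * r)"
      using \<rho> dist_X[OF x] by (auto intro!: mult_mono)
    finally have "norm (gradx P x ?y - e + \<rho> *\<^sub>R (x - xt)) \<le> B + eta0 par + rho0 par * (2 * r)"
      using grad_bound(1)[OF x(1) ystar(1), of x u] e \<eta> by linarith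
    then have "norm (gradx P x ?y - e + \<rho> *\<^sub>R (x - xt)) * norm (xf - x) \<le> (B + eta0 par + rho0 par * (2 * r)) * (2 * r)"
      using dist_X[OF slater_x(1) x(1)] by (intro mult_mono) (auto intro: order_trans[OF norm_ge_zero])
    then show ?thesis
      using norm_cauchy_schwarz[of "gradx P x ?y - e + \<rho> *\<^sub>R (x - xt)" "xf - x"]
        gh_bound(1)[OF slater_x(1)] gh_bound(1)[OF x(1)] by linarith
  qed
  also have "\<delta> * norm \<zeta> + \<zeta> \<bullet> cfun P x \<le> - ((transpose (Jac (cfun P) x) *v \<zeta>) \<bullet> (xf - x))"
    by (rule cc.slater_inequality) (use slater_x pos in \<open>auto simp: \<zeta>_def\<close>)
  finally have 1: "\<delta> * norm \<zeta> + \<zeta> \<bullet> cfun P x \<le> BX" unfolding BX_def .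
  have "0 \<le> ((norm \<zeta>)\<^sup>2 - (norm z)\<^sup>2) / 2" using big(1) by (simp add: power_mono)
  then have "0 \<le> \<beta>x * (\<zeta> \<bullet> cfun P x)"
    using inner_diff_ge[of \<zeta> z] multiplier_inner(1)[OF \<beta>x \<zeta>_def] by linarith
  then have "0 \<le> \<zeta> \<bullet> cfun P x" using \<beta>x by (simp add: zero_le_mult_iff)
  then have "norm \<zeta> \<le> BX / \<delta>" using 1 pos by (simp add: field_simps)
  then show False using big(2) by simp
qed

text \<open>The constants for a run of iAPG on the outer problem when the multipliers are bounded by \<open>U\<close>.
  \<open>RU\<close> depends on \<open>XU\<close> through the square root of an affine function, and \<open>XU\<close> has to dominate
  \<open>U + RU U + cU U\<close>; the value of \<open>XU\<close> solves \<open>a + sqrt (b + k X) \<le> X\<close> by means of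
  \<open>sqrt (k X) \<le> (k + X)/2\<close>. None of the constants refers to \<open>\<nu>\<close>, \<open>\<rho>\<close>, \<open>\<eta>\<close> or \<open>Lmin\<close>: the factor \<open>E1\<close> is
  uniform because \<open>\<rho> Lmin = Llow \<sdot> rho0\<close> throughout.\<close>

definition cU :: "real \<Rightarrow> real" where
  "cU U = \<beta> / 2 * (B + eta0 par + rho0 par * U)"

definition E1 :: real where
  "E1 = (1 + 2 / \<beta> / Llow par) * exp (2 / \<beta> * sqrt (2 / (Llow par * rho0 par)))"

definition bU :: "real \<Rightarrow> real" where
  "bU U = (2 * r + 2 * U)\<^sup>2 + 4 * (rho0 par * eta0 par * (16 * r + eta0 par / (2 * Llow par)))"

definition kU :: real where "kU = 64 * (rho0 par * eta0 par * E1)"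

definition XU :: "real \<Rightarrow> real" where "XU U = 2 * (U + cU U) + 2 * sqrt (bU U) + kU"
definition RU :: "real \<Rightarrow> real" where "RU U = sqrt (bU U + kU * XU U)"
definition NU :: "real \<Rightarrow> real" where "NU U = E1 * XU U"

lemma outer_constants:
  assumes "0 \<le> U"
  shows "0 \<le> cU U" "1 \<le> E1" "0 < bU U" "0 < kU" "0 < XU U" "0 < RU U" "0 < NU U"
    "U + cU U \<le> XU U" "U + RU U + cU U \<le> XU U"
    "(RU U)\<^sup>2 = (2 * r + 2 * U)\<^sup>2 + 4 * (rho0 par * eta0 par * (8 * (2 * r + 2 * NU U) + eta0 par / (2 * Llow par)))"
proof -
  show c: "0 \<le> cU U" unfolding cU_def using params pos assms by (auto intro!: mult_nonneg_nonneg add_nonneg_nonneg)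
  have "1 * 1 \<le> (1 + 2 / \<beta> / Llow par) * exp (2 / \<beta> * sqrt (2 / (Llow par * rho0 par)))"
    using params by (intro mult_mono) auto
  then show E: "1 \<le> E1" by (simp add: E1_def)
  have "0 < rho0 par * eta0 par * (16 * r + eta0 par / (2 * Llow par))"
    using params r_nonneg by (intro mult_pos_pos add_nonneg_pos) auto
  then show b: "0 < bU U" unfolding bU_def by (simp add: add_nonneg_pos)
  show k: "0 < kU" unfolding kU_def using params E by (intro mult_pos_pos) auto
  show X: "0 < XU U" unfolding XU_def using assms c b k by (intro add_nonneg_pos add_nonneg_nonneg) auto
  show N: "0 < NU U" unfolding NU_def using E X by simp
  have R2: "0 < bU U + kU * XU U" using b k X by (simp add: add_pos_pos)
  then show R: "0 < RU U" by (simp add: RU_def)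
  have "sqrt (bU U + kU * XU U) \<le> sqrt (bU U) + sqrt (kU * XU U)"
    using b k X by (intro sqrt_add_le_add_sqrt) auto
  also have "sqrt (kU * XU U) \<le> (kU + XU U) / 2"
    using k X by (intro arith_geo_mean_sqrt) auto
  finally have "U + RU U + cU U \<le> U + cU U + sqrt (bU U) + kU / 2 + XU U / 2" by (simp add: RU_def add_divide_distrib)
  also have "\<dots> = XU U" by (simp add: XU_def add_divide_distrib)
  finally show RX: "U + RU U + cU U \<le> XU U" .
  then show "U + cU U \<le> XU U" using R by simp
  have "(RU U)\<^sup>2 = bU U + kU * XU U" using R2 by (simp add: RU_def)
  then show "(RU U)\<^sup>2 = (2 * r + 2 * U)\<^sup>2 + 4 * (rho0 par * eta0 par * (8 * (2 * r + 2 * NU U) + eta0 par / (2 * Llow par)))"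
    unfolding bU_def kU_def NU_def by (simp add: algebra_simps)
qed

definition LXmax :: "real \<Rightarrow> real \<Rightarrow> real \<Rightarrow> real \<Rightarrow> real" where
  "LXmax \<kappa> Lmin \<beta>x Z = max (\<kappa> * Lmin) (gamma_u par * LX \<beta>x Z)"

definition outer_iters :: "real \<Rightarrow> real \<Rightarrow> real \<Rightarrow> real \<Rightarrow> real \<Rightarrow> real \<Rightarrow> real \<Rightarrow> nat" where
  "outer_iters \<kappa> U Z \<rho> \<eta> \<beta>x Lmin = iter_bound (LXmax \<kappa> Lmin \<beta>x Z) \<rho> (RU U) \<eta>"

definition outer_tol :: "real \<Rightarrow> real \<Rightarrow> real \<Rightarrow> real \<Rightarrow> real \<Rightarrow> real \<Rightarrow> real \<Rightarrow> real \<Rightarrow> real" where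
  "outer_tol \<kappa> U Z \<rho> \<eta> \<beta>x Lmin LF =
     query_accuracy Lmin \<rho> \<eta> (RU U) (LXmax \<kappa> Lmin \<beta>x Z) (outer_iters \<kappa> U Z \<rho> \<eta> \<beta>x Lmin) * \<nu> / (LF + M_p P)"

definition outer_cost :: "real \<Rightarrow> real \<Rightarrow> real \<Rightarrow> real \<Rightarrow> real \<Rightarrow> real \<Rightarrow> real \<Rightarrow> real \<Rightarrow> nat \<Rightarrow> nat \<Rightarrow> nat \<Rightarrow> nat" where
  "outer_cost \<kappa> U Z \<rho> \<eta> \<beta>x Lmin LF ey ex eg = (outer_iters \<kappa> U Z \<rho> \<eta> \<beta>x Lmin + 2) *
     ((trial_bound (gamma_u par) (LX \<beta>x Z) Lmin + 1) *
       (2 * (inner_cost \<kappa> (NU U) (outer_tol \<kappa> U Z \<rho> \<eta> \<beta>x Lmin LF) * ey + ex) + eg) + eg)"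

text \<open>The \<open>u\<close>-part of the proximal step is explicit: \<open>(L + \<rho>) d\<^sub>u = L b\<^sub>u - g\<^sub>u + \<rho> u\<^sub>t\<close>, and
  \<open>|g\<^sub>u| \<le> 2/\<beta> |b\<^sub>u| + const\<close>. This is the source of \<open>N_grow\<close>, with a factor that involves
  neither \<open>1/\<nu>\<close> nor the smoothness constant of \<open>\<Psi>\<close>.\<close>

lemma prox_step_u_growth:
  assumes v: "b \<in> X \<times> UNIV" "d \<in> X \<times> UNIV" and L: "0 < L" and U: "norm ut \<le> U" and \<rho>: "0 < \<rho>" "\<rho> \<le> rho0 par"
    and gr: "norm (gv - Gxu \<beta>x z b) \<le> \<eta> / 8" "\<eta> \<le> eta0 par" "0 < \<eta>"
    and sub: "\<And>w. w \<in> X \<times> UNIV \<Longrightarrow> fxu \<rho> xt ut d + (L *\<^sub>R (b - d) - gv) \<bullet> (w - d) + \<rho> / 2 * (norm (w - d))\<^sup>2 \<le> fxu \<rho> xt ut w"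
  shows "norm (snd d) + cU U \<le> (1 + 2 / \<beta> / L) * (norm (snd b) + cU U)"
proof -
  obtain bx bu where b: "b = (bx, bu)" by (cases b)
  obtain dx du where d: "d = (dx, du)" by (cases d)
  have dx: "dx \<in> X" using v d by simp
  have su: "L *\<^sub>R (bu - du) - snd gv = \<rho> *\<^sub>R (du - ut)"
  proof -
    have "\<forall>w\<in>X \<times> UNIV. fxu \<rho> xt ut d + (L *\<^sub>R (b - d) - gv) \<bullet> (w - d) + \<rho> / 2 * (norm (w - d))\<^sup>2 \<le> fxu \<rho> xt ut w"
      using sub by blast
    from fxu_subgradient(1)[OF dx this[unfolded d]] show ?thesis by (simp add: b)
  qed
  then have du: "(L + \<rho>) *\<^sub>R du = L *\<^sub>R bu - snd gv + \<rho> *\<^sub>R ut" by (simp add: algebra_simps)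
  have gnorm: "norm (snd gv) \<le> 2 / \<beta> * norm bu + B + eta0 par"
  proof -
    let ?y = "ystar bx bu"
    have "norm (snd gv - snd (Gxu \<beta>x z b)) \<le> \<eta> / 8"
      using order_trans[OF norm_fst_snd_le(2) gr(1)] by simp
    moreover have "norm (snd (Gxu \<beta>x z b)) \<le> 2 / \<beta> * norm bu + B"
    proof -
      have "norm (bu - pos (\<beta> *\<^sub>R pfun P ?y + bu)) \<le> norm bu + norm (pos (\<beta> *\<^sub>R pfun P ?y + bu))"
        by (rule norm_triangle_ineq4)
      also have "norm (pos (\<beta> *\<^sub>R pfun P ?y + bu)) \<le> norm (\<beta> *\<^sub>R pfun P ?y + bu)" by (rule norm_pos_le)
      also have "\<dots> \<le> \<beta> * norm (pfun P ?y) + norm bu"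
        using norm_triangle_ineq[of "\<beta> *\<^sub>R pfun P ?y" bu] params(4) by simp
      also have "\<beta> * norm (pfun P ?y) \<le> \<beta> * B"
        using p_bound(1)[OF dom2(2)[OF ystar(1)], of bx bu] params(4) by simp
      finally have "norm (bu - pos (\<beta> *\<^sub>R pfun P ?y + bu)) \<le> 2 * norm bu + \<beta> * B" by simp
      then have "1 / \<beta> * norm (bu - pos (\<beta> *\<^sub>R pfun P ?y + bu)) \<le> 1 / \<beta> * (2 * norm bu + \<beta> * B)"
        using params(4) by (intro mult_left_mono) auto
      also have "\<dots> = 2 / \<beta> * norm bu + B" using params(4) by (simp add: field_simps)
      finally show ?thesis unfolding b Gxu_def GPsi_def using params(4) by simp
    qed
    ultimately show ?thesis using gr(2,3) norm_triangle_ineq2[of "snd gv" "snd (Gxu \<beta>x z b)"] by linarith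
  qed
  have "(L + \<rho>) * norm du = norm (L *\<^sub>R bu - snd gv + \<rho> *\<^sub>R ut)"
    unfolding du[symmetric] using L \<rho> by simp
  also have "\<dots> \<le> L * norm bu + norm (snd gv) + \<rho> * norm ut"
    using norm_triangle_ineq[of "L *\<^sub>R bu - snd gv" "\<rho> *\<^sub>R ut"] norm_triangle_ineq4[of "L *\<^sub>R bu" "snd gv"] L \<rho> by simp
  also have "\<rho> * norm ut \<le> rho0 par * U" using \<rho> U by (intro mult_mono) auto
  finally have "(L + \<rho>) * norm du \<le> L * norm bu + (2 / \<beta> * norm bu + B + eta0 par) + rho0 par * U"
    using gnorm by simp
  moreover have "L * norm du \<le> (L + \<rho>) * norm du" using \<rho> by (intro mult_right_mono) auto
  moreover have "B + eta0 par + rho0 par * U = 2 / \<beta> * cU U" unfolding cU_def using params(4) by simp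
  ultimately have "L * norm du \<le> L * norm bu + 2 / \<beta> * (norm bu + cU U)" by (simp add: distrib_left)
  moreover have "L * ((1 + w) * k) = L * k + (L * w) * k" for w k :: real by (simp add: algebra_simps)
  moreover have "L * (2 / \<beta> / L) = 2 / \<beta>" using L by simp
  ultimately have "L * (norm du + cU U) \<le> L * ((1 + 2 / \<beta> / L) * (norm bu + cU U))"
    by (simp add: distrib_left)
  then have "norm du + cU U \<le> (1 + 2 / \<beta> / L) * (norm bu + cU U)"
    using mult_le_cancel_left_pos[OF L] by blast
  then show ?thesis by (simp add: b d)
qed

text \<open>The disjunction on \<open>\<Lambda>\<close> covers both uses: mere termination, where nothing is counted, and the
  complexity bound, where the factors \<open>\<Lambda>\<close> are bounded by \<open>\<kappa>\<close>.\<close>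

lemma outer_solve:
  fixes m :: "calls \<Rightarrow> nat"
  assumes LF: "L_F \<le> LF" and xt: "xt \<in> X" and ut: "norm ut \<le> U" "BU / \<delta> \<le> U" and yt: "yt \<in> Y" and z: "norm z \<le> Z"
    and \<rho>: "0 < \<rho>" "\<rho> \<le> rho0 par" and \<eta>: "0 < \<eta>" "\<eta> \<le> eta0 par" and \<beta>x: "0 < \<beta>x"
    and Lmin: "Llow par \<le> Lmin" "\<rho> * Lmin = Llow par * rho0 par"
    and \<Lambda>: "\<And>i. 1 \<le> \<Lambda> i" "(ey = 0 \<and> ex = 0 \<and> eg = 0) \<or> (\<forall>i. \<Lambda> i \<le> \<kappa>)"
    and m: "\<And>s. m (tick_y s) \<le> m s + ey" "\<And>s. m (tick_h s) \<le> m s + ey" "\<And>s. m (tick_x s) \<le> m s + ex"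
      "\<And>s. m (tick_g s) \<le> m s + eg" "\<And>s i. m (s\<lparr>n_iapg := i\<rparr>) = m s"
  shows "\<exists>x u s'. iapg \<Lambda> (approx_gradient_xu \<Lambda> Pn par \<nu> LF \<beta>x z yt) (psi_xu Pn \<beta> \<beta>x z) (phi_xu Pn \<rho> xt ut) tick_g
      (xt, ut) Lmin \<rho> \<eta> (gamma_u par) (gamma_d par) s = Some ((x, u), s') \<and> x \<in> X \<and>
    norm u \<le> max (norm ut) (BU / \<delta>) + \<eta> / \<rho> \<and>
    (\<exists>sx. (\<forall>w\<in>X. gr x + (sx - \<rho> *\<^sub>R (x - xt)) \<bullet> (w - x) \<le> gr w) \<and>
       norm (Gxu \<beta>x z (x, u) + (sx, \<rho> *\<^sub>R (u - ut))) \<le> \<eta>) \<and>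
    m s' \<le> m s + outer_cost \<kappa> U Z \<rho> \<eta> \<beta>x Lmin LF ey ex eg"
proof -
  have U: "0 \<le> U" using ut(1) norm_ge_zero order_trans by blast
  have Z: "0 \<le> Z" using z norm_ge_zero order_trans by blast
  note oc = outer_constants[OF U]
  have Lminp: "0 < Lmin" using Lmin params by simp
  define \<kappa>' where "\<kappa>' = (if ey = 0 \<and> ex = 0 \<and> eg = 0 then \<Lambda> (n_iapg s) else \<kappa>)"
  have \<kappa>': "\<Lambda> (n_iapg s) \<le> \<kappa>'" "1 \<le> \<kappa>'" "ey = 0 \<or> (\<forall>i. \<Lambda> i \<le> \<kappa>')"
    using \<Lambda> order_trans[OF \<Lambda>(1)] unfolding \<kappa>'_def by auto
  interpret cp: composite_problem "psi_xu Pn \<beta> \<beta>x z" "fxu \<rho> xt ut" "Gxu \<beta>x z" "X \<times> UNIV" \<rho> "LX \<beta>x Z"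
    by (rule outer_composite[OF z \<beta>x \<rho>(1)])
  obtain vs where vs: "vs \<in> X \<times> UNIV"
    "\<forall>w\<in>X \<times> UNIV. psi_xu Pn \<beta> \<beta>x z vs + fxu \<rho> xt ut vs + \<rho> / 2 * (norm (w - vs))\<^sup>2 \<le> psi_xu Pn \<beta> \<beta>x z w + fxu \<rho> xt ut w"
    "\<forall>w\<in>X \<times> UNIV. fxu \<rho> xt ut vs + (- Gxu \<beta>x z vs) \<bullet> (w - vs) + \<rho> / 2 * (norm (w - vs))\<^sup>2 \<le> fxu \<rho> xt ut w"
    using cp.minimizer_exists by blast
  obtain xs us where vs_eq: "vs = (xs, us)" by (cases vs)
  have xs: "xs \<in> X" using vs(1) vs_eq by simp
  have us: "norm us \<le> max (norm ut) (BU / \<delta>)"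
    by (rule exact_u_bound[OF xs \<rho>(1)]) (use vs(3) vs_eq in auto)
  then have usU: "norm us \<le> U" using ut by simp
  define Nm where "Nm = (1 + 2 / \<beta> / Lmin) * (XU U * exp (2 / \<beta> * sqrt (2 / (\<rho> * Lmin))))"
  have Nm: "Nm \<le> NU U"
  proof -
    have "Nm = XU U * ((1 + 2 / \<beta> / Lmin) * exp (2 / \<beta> * sqrt (2 / (Llow par * rho0 par))))"
      unfolding Nm_def Lmin(2) by simp
    also have "\<dots> \<le> XU U * E1"
      unfolding E1_def using oc(5) Lmin(1) params
      by (intro mult_left_mono mult_right_mono add_left_mono divide_left_mono) auto
    finally show ?thesis by (simp add: NU_def mult.commute)
  qed
  let ?R = "RU U" and ?L = "LXmax \<kappa>' Lmin \<beta>x Z" and ?K = "outer_iters \<kappa>' U Z \<rho> \<eta> \<beta>x Lmin"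
  let ?J = "trial_bound (gamma_u par) (LX \<beta>x Z) Lmin"
  let ?q = "query_accuracy Lmin \<rho> \<eta> ?R ?L ?K"
  let ?Nc = "inner_cost \<kappa>' (NU U) (outer_tol \<kappa>' U Z \<rho> \<eta> \<beta>x Lmin LF) * ey + ex"
  have q: "0 < ?q" using \<rho> \<eta> by (intro query_accuracy_pos)
  have LM: "0 < LF + M_p P" using LF L_M by auto
  have Lm: "gamma_u par * LX \<beta>x Z \<le> ?L" "Lmin \<le> ?L" "\<Lambda> (n_iapg s) * Lmin \<le> ?L"
    unfolding LXmax_def using Lminp \<kappa>' mult_right_mono[of 1 \<kappa>' Lmin] mult_right_mono[OF \<kappa>'(1), of Lmin]
    by (auto intro: max.coboundedI1)
  have Lp: "0 < ?L" using Lm(2) Lminp by simp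
  have dist_v: "norm ((a :: (real^'n) \<times> (real^'r)) - b) \<le> 2 * r + norm (snd a) + norm (snd b)"
    if "a \<in> X \<times> UNIV" "b \<in> X \<times> UNIV" for a b
  proof -
    have "norm (a - b) \<le> norm (fst (a - b)) + norm (snd (a - b))"
      by (cases "a - b") (simp add: norm_Pair sqrt_sum_squares_le_sum)
    also have "norm (fst (a - b)) \<le> 2 * r" using dist_X that by (auto simp: mem_Times_iff)
    also have "norm (snd (a - b)) \<le> norm (snd a) + norm (snd b)" by (simp add: norm_triangle_ineq4)
    finally show ?thesis by simp
  qed
  have "iapg_problem (psi_xu Pn \<beta> \<beta>x z) (fxu \<rho> xt ut) (phi_xu Pn \<rho> xt ut) (Gxu \<beta>x z) (X \<times> UNIV) \<rho> \<eta> Lmin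
      (gamma_u par) (gamma_d par) (LX \<beta>x Z) (approx_gradient_xu \<Lambda> Pn par \<nu> LF \<beta>x z yt) tick_g (\<lambda>v. norm (snd v))
      (cU U) (2 / \<beta>) (XU U) (2 * r + 2 * NU U) vs (xt, ut) ?R ?L ?K ?J m ?Nc eg"
  proof (rule iapg_problem.intro, goal_cases)
    case (19 v w t)
    then have "norm (snd ((1 - t) *\<^sub>R v + t *\<^sub>R w)) \<le> (1 - t) * norm (snd v) + t * norm (snd w)"
      using norm_triangle_ineq[of "(1 - t) *\<^sub>R snd v" "t *\<^sub>R snd w"] by simp
    also have "\<dots> \<le> (1 - t) * max (norm (snd v)) (norm (snd w)) + t * max (norm (snd v)) (norm (snd w))"
      using 19 by (intro add_mono mult_left_mono) auto
    finally show ?case by (simp add: algebra_simps)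
  next
    case (20 b d gv L)
    show ?case
      by (rule prox_step_u_growth[OF 20(1,2) _ ut(1) \<rho> 20(4) \<eta>(2,1) 20(5)]) (use 20(3) Lminp in auto)
  next
    case (21 v)
    show ?case using norm_triangle_ineq2[of "snd v" "snd vs"] norm_fst_snd_le(2)[of "v - vs"] by simp
  next
    case (24 v w)
    then have "norm (snd v) \<le> NU U" "norm (snd w) \<le> NU U"
      using Nm oc(1) unfolding Nm_def by linarith+
    then show ?case using dist_v[OF 24(1,2)] by linarith
  next
    case 25
    have "norm ((xt, ut) - vs) \<le> 2 * r + 2 * U"
      using dist_v[of "(xt, ut)" vs] xt vs(1) ut(1) usU by (simp add: vs_eq)
    then have 1: "(norm ((xt, ut) - vs))\<^sup>2 \<le> (2 * r + 2 * U)\<^sup>2" by (intro power_mono) auto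
    have "\<rho> * \<eta> * (8 * (2 * r + 2 * NU U) + \<eta> / (2 * Lmin))
      \<le> rho0 par * eta0 par * (8 * (2 * r + 2 * NU U) + eta0 par / (2 * Llow par))"
      using \<rho> \<eta> Lmin(1) Lminp params r_nonneg oc(7) by (intro mult_mono add_left_mono frac_le) auto
    then show ?case using 1 unfolding oc(10) by linarith
  next
    case (31 v \<omega> s)
    obtain vx vu where v: "v = (vx, vu)" by (cases v)
    have "norm vu \<le> NU U" using 31(2) Nm oc(1) unfolding Nm_def v by simp
    moreover have \<omega>: "?q \<le> \<omega>" using 31(3) unfolding query_accuracy_def Let_def .
    then have \<omega>p: "0 < \<omega>" using q by linarith
    ultimately obtain gv s' where *: "approx_gradient_xu \<Lambda> Pn par \<nu> LF \<beta>x z yt (vx, vu) \<omega> s = Some (gv, s')"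
      "norm (gv - Gxu \<beta>x z (vx, vu)) \<le> \<omega>"
      "m s' \<le> m s + (inner_cost \<kappa>' (NU U) (\<omega> * \<nu> / (LF + M_p P)) * ey + ex)"
      using approx_gradient[where m = m and \<kappa> = \<kappa>' and s = s, OF LF _ yt \<omega>p \<Lambda>(1) \<kappa>'(3) m(1-3,5)] by blast
    have "inner_cost \<kappa>' (NU U) (\<omega> * \<nu> / (LF + M_p P)) \<le> inner_cost \<kappa>' (NU U) (outer_tol \<kappa>' U Z \<rho> \<eta> \<beta>x Lmin LF)"
      unfolding outer_tol_def using q \<omega> \<nu> LM oc(7) \<kappa>'(2)
      by (intro inner_cost_antimono divide_pos_pos mult_pos_pos divide_right_mono mult_right_mono) auto
    from mult_right_mono[OF this, of ey]
    have "m s' \<le> m s + ?Nc" using *(3) by linarith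
    then show ?case using * v by blast
  qed (use compact_imp_closed[OF g(3)] xt vs strongly_convex_fxu continuous_fxu phi_xu_eq Gxu_above_tangent[OF \<beta>x]
      Gxu_cocoercive[OF z \<beta>x] \<rho> \<eta> params Lminp LX_pos[OF \<beta>x Z] oc Lm Lp m ut usU
      iter_bound[OF Lp \<rho>(1), folded outer_iters_def] trial_bound in \<open>auto simp: vs_eq outer_iters_def closed_Times\<close>)
  from iapg_problem.iapg_terminates[OF this, of \<Lambda> s, OF \<Lambda>(1) Lm(3) m(5)]
  obtain d s' sg where res: "iapg \<Lambda> (approx_gradient_xu \<Lambda> Pn par \<nu> LF \<beta>x z yt) (psi_xu Pn \<beta> \<beta>x z) (phi_xu Pn \<rho> xt ut) tick_g
      (xt, ut) Lmin \<rho> \<eta> (gamma_u par) (gamma_d par) s = Some (d, s')" "d \<in> X \<times> UNIV"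
    "\<forall>w\<in>X \<times> UNIV. fxu \<rho> xt ut d + sg \<bullet> (w - d) + \<rho> / 2 * (norm (w - d))\<^sup>2 \<le> fxu \<rho> xt ut w"
    "norm (Gxu \<beta>x z d + sg) \<le> \<eta>"
    "m s' \<le> m s + (?K + 2) * ((?J + 1) * (2 * ?Nc + eg) + eg)" by blast
  obtain x u where d: "d = (x, u)" by (cases d)
  have x: "x \<in> X" using res(2) d by simp
  have "m s' \<le> m s + outer_cost \<kappa>' U Z \<rho> \<eta> \<beta>x Lmin LF ey ex eg" using res(5) by (simp add: outer_cost_def)
  then have cost: "m s' \<le> m s + outer_cost \<kappa> U Z \<rho> \<eta> \<beta>x Lmin LF ey ex eg"
    by (auto simp: \<kappa>'_def outer_cost_def split: if_splits)
  have su: "sg = (fst sg, \<rho> *\<^sub>R (u - ut))"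
    using fxu_subgradient(1)[OF x res(3)[unfolded d]] by (cases sg) simp
  have "\<rho> * norm (d - vs) \<le> \<eta>" by (rule cp.stationary_distance[OF vs(1,3) res(2-4)])
  then have "norm (d - vs) \<le> \<eta> / \<rho>" using \<rho>(1) by (simp add: field_simps)
  then have "norm (u - us) \<le> \<eta> / \<rho>" using norm_fst_snd_le(2)[of "d - vs"] by (simp add: d vs_eq)
  then have "norm u \<le> max (norm ut) (BU / \<delta>) + \<eta> / \<rho>" using us norm_triangle_ineq2[of u us] by linarith
  moreover have "\<forall>w\<in>X. gr x + (fst sg - \<rho> *\<^sub>R (x - xt)) \<bullet> (w - x) \<le> gr w"
    using fxu_subgradient(2)[OF x res(3)[unfolded d]] by blast
  moreover have "norm (Gxu \<beta>x z (x, u) + (fst sg, \<rho> *\<^sub>R (u - ut))) \<le> \<eta>" using res(4) d su by simp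
  ultimately show ?thesis using res(1) x cost d by blast
qed

end

section \<open>Convergence of the outer loop\<close>

lemma dist0_le:
  assumes "v \<in> S" "norm v \<le> e"
  shows "dist0 S \<le> ereal e"
  unfolding dist0_def by (rule INF_lower2[OF assms(1)]) (use assms(2) in simp)

context perturbed_minimax
begin

lemma subdiff_g: "x \<in> X \<Longrightarrow> (\<And>w. w \<in> X \<Longrightarrow> gr x + s \<bullet> (w - x) \<le> gr w) \<Longrightarrow> s \<in> subdiff (gfun P) x"
  unfolding subdiff_def using g(1) by (auto split: if_splits)

lemma subdiff_h: "y \<in> Y \<Longrightarrow> (\<And>w. w \<in> Y \<Longrightarrow> hr y + s \<bullet> (w - y) \<le> hr w) \<Longrightarrow> s \<in> subdiff (hfun P) y"
  unfolding subdiff_def using h(1) by (auto split: if_splits)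

text \<open>\<open>Ub\<close> and \<open>Zb\<close> bound the multipliers along the whole run, \<open>Ub\<close> including the geometric series of
  the errors \<open>\<eta>\<^sub>t/\<rho>\<^sub>t\<close>; \<open>CK / \<sigma>\<^sup>t\<close> bounds all KKT residuals after outer iteration \<open>t\<close>.\<close>

definition U0 :: real where "U0 = max (norm (u_init par)) (BU / \<delta>)"
definition Ub :: real where "Ub = U0 + eta0 par / rho0 par / (1 - sigma par / tau par)"
definition Zb :: real where "Zb = max (norm (z_init par)) (BX / \<delta>)"
definition W :: real where "W = (B + 1) * eta0 par + 2 * Ub * rho0 par"
definition CK :: real where
  "CK = (L_F + 1) * eta0 par + 2 * r * rho0 par + 2 * Zb / beta_x0 par + 2 * Zb * Zb / beta_x0 par
     + eta0 par * nubar + W + (Ub + \<beta> * W) * W"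

definition \<rho>t :: "nat \<Rightarrow> real" where "\<rho>t t = rho0 par / sigma par ^ t"
definition \<eta>t :: "nat \<Rightarrow> real" where "\<eta>t t = eta0 par / tau par ^ t"
definition \<beta>t :: "nat \<Rightarrow> real" where "\<beta>t t = beta_x0 par * sigma par ^ t"

definition ubound :: "nat \<Rightarrow> real" where
  "ubound t = U0 + eta0 par / rho0 par * ((1 - (sigma par / tau par) ^ t) / (1 - sigma par / tau par))"

lemma ratio: "0 < sigma par / tau par" "sigma par / tau par < 1"
  using params by auto

lemma U0: "0 \<le> U0" "BU / \<delta> \<le> U0" "norm (u_init par) \<le> U0"
  unfolding U0_def by (auto simp: le_max_iff_disj)

lemma Zb: "0 \<le> Zb" "BX / \<delta> \<le> Zb" "norm (z_init par) \<le> Zb"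
  unfolding Zb_def by (auto simp: le_max_iff_disj)

lemma ubound: "ubound t \<le> Ub" "U0 \<le> ubound t" "ubound t + \<eta>t t / \<rho>t t = ubound (t + 1)"
proof -
  let ?q = "sigma par / tau par"
  have q: "0 < 1 - ?q" "0 \<le> ?q ^ t" "?q ^ t \<le> 1" using ratio by (auto intro: power_le_one)
  have e: "0 < eta0 par / rho0 par" using params by simp
  have "(1 - ?q ^ t) / (1 - ?q) \<le> 1 / (1 - ?q)" using q by (intro divide_right_mono) auto
  from mult_left_mono[OF this less_imp_le[OF e]] show "ubound t \<le> Ub" unfolding ubound_def Ub_def by simp
  have "0 \<le> (1 - ?q ^ t) / (1 - ?q)" using q by (intro divide_nonneg_nonneg) auto
  from mult_nonneg_nonneg[OF less_imp_le[OF e] this] show "U0 \<le> ubound t" unfolding ubound_def by linarith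
  have "\<eta>t t / \<rho>t t = eta0 par / rho0 par * ?q ^ t"
    unfolding \<eta>t_def \<rho>t_def by (simp add: power_divide)
  moreover have "(1 - ?q ^ t) / (1 - ?q) + ?q ^ t = (1 - ?q ^ (t + 1)) / (1 - ?q)"
  proof -
    have "(1 - b) / (1 - a) + b = (1 - a * b) / (1 - a)" if "0 < 1 - a" for a b :: real
      using that by (simp add: field_simps)
    from this[OF q(1), of "?q ^ t"] show ?thesis by simp
  qed
  ultimately show "ubound t + \<eta>t t / \<rho>t t = ubound (t + 1)"
    unfolding ubound_def by (simp only: distrib_left[symmetric] add.assoc)
qed

lemma schedule:
  shows "0 < \<rho>t t" "\<rho>t t \<le> rho0 par" "0 < \<eta>t t" "\<eta>t t \<le> eta0 par" "0 < \<beta>t t"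
    "\<eta>t t \<le> eta0 par / sigma par ^ t" "1 \<le> sigma par ^ t"
    "\<rho>t t * (Llow par * sigma par ^ t) = Llow par * rho0 par" "Llow par \<le> Llow par * sigma par ^ t"
proof -
  show s: "1 \<le> sigma par ^ t" using params by simp
  have st: "sigma par ^ t \<le> tau par ^ t" using params by (intro power_mono) auto
  show "0 < \<rho>t t" "0 < \<eta>t t" "0 < \<beta>t t" unfolding \<rho>t_def \<eta>t_def \<beta>t_def using params by auto
  show "\<rho>t t \<le> rho0 par" unfolding \<rho>t_def using s params by (simp add: divide_le_eq)
  show e: "\<eta>t t \<le> eta0 par / sigma par ^ t" unfolding \<eta>t_def using s st params by (intro divide_left_mono) auto
  also have "\<dots> \<le> eta0 par" using s params by (simp add: divide_le_eq)
  finally show "\<eta>t t \<le> eta0 par" .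
  show "\<rho>t t * (Llow par * sigma par ^ t) = Llow par * rho0 par" unfolding \<rho>t_def using params by simp
  show "Llow par \<le> Llow par * sigma par ^ t" using s params by simp
qed

lemma Ub_nonneg: "0 \<le> Ub" using ubound[of 0] U0 by linarith

lemma W_pos: "0 < W"
  unfolding W_def using params pos Ub_nonneg by (intro add_pos_nonneg mult_pos_pos mult_nonneg_nonneg) auto

text \<open>The residuals are the proximal terms, of size \<open>\<rho>\<^sub>t\<close> times a diameter, the changes of the multipliers
  divided by \<open>\<beta>\<^sub>x\<^sub>,\<^sub>t\<close> and \<open>\<beta>\<close>, and the tolerances of the two subproblems. The change of the multiplier of \<open>p\<close> is
  small because stationarity in \<open>u\<close> makes it proportional to \<open>\<rho>\<^sub>t (u - ut)\<close>.\<close>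

lemma kkt_residual:
  fixes t :: nat
  defines "s \<equiv> 1 / sigma par ^ t"
  assumes x: "x \<in> X" "xt \<in> X" and u: "norm u \<le> Ub" "norm ut \<le> Ub" and y: "y \<in> Y" and e: "0 < e"
    and z: "norm z \<le> Zb" "norm z' \<le> Zb" "z' = pos (\<beta>t t *\<^sub>R cfun P x + z)"
    and subx: "\<And>w. w \<in> X \<Longrightarrow> gr x + (sx - \<rho>t t *\<^sub>R (x - xt)) \<bullet> (w - x) \<le> gr w"
    and statx: "norm (Gxu (\<beta>t t) z (x, u) + (sx, \<rho>t t *\<^sub>R (u - ut))) \<le> \<eta>t t"
    and suby: "\<forall>w\<in>Y. fy y + sy \<bullet> (w - y) + \<nu> / 2 * (norm (w - y))\<^sup>2 \<le> fy w"
    and staty: "norm (Gy x u y + sy) \<le> min e (\<eta>t t) * \<nu>"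
    and u': "u' = pos (\<beta> *\<^sub>R pfun P y + u)"
    and small: "CK * s \<le> e"
  shows "eps_KKT_mult e Pn x y z' u'"
proof -
  let ?ys = "ystar x u"
  define \<eta> where "\<eta> = \<eta>t t"
  have sp: "0 < s" "s \<le> 1" using schedule(7)[of t] by (auto simp: s_def divide_le_eq)
  have \<eta>s: "\<eta> \<le> eta0 par * s" "0 < \<eta>" using schedule(3,6)[of t] by (auto simp: s_def \<eta>_def)
  have \<rho>s: "\<rho>t t = rho0 par * s" by (simp add: \<rho>t_def s_def)
  have \<beta>s: "a / \<beta>t t = a / beta_x0 par * s" for a by (simp add: \<beta>t_def s_def)
  have terms: "0 \<le> (L_F + 1) * eta0 par + 2 * r * rho0 par" "0 \<le> 2 * Zb / beta_x0 par" "0 \<le> 2 * Zb * Zb / beta_x0 par"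
    "0 \<le> eta0 par * nubar" "0 \<le> W" "0 \<le> (Ub + \<beta> * W) * W"
    using L_F_nonneg params r_nonneg Zb W_pos Ub_nonneg \<nu> nubar by (auto intro!: add_nonneg_nonneg mult_nonneg_nonneg)
  have bnd: "a * s \<le> e" if "a \<le> CK" for a
    using mult_right_mono[OF that, of s] sp small by linarith
  have "\<nu> * norm (y - ?ys) \<le> min e \<eta> * \<nu>"
    using ystar_distance[OF y suby staty] by (simp add: \<eta>_def)
  then have "\<nu> * norm (y - ?ys) \<le> \<nu> * \<eta>" using \<nu> by (smt (verit) min.cobounded2 mult.commute mult_left_mono)
  then have ydist: "norm (y - ?ys) \<le> \<eta>" using mult_le_cancel_left_pos[OF \<nu>] by blast
  have 1: "dist0 {gradx Pn x y + s + transpose (Jac (cfun Pn) x) *v z' | s. s \<in> subdiff (gfun Pn) x} \<le> ereal e"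
  proof (rule dist0_le)
    let ?s = "sx - \<rho>t t *\<^sub>R (x - xt)"
    let ?v = "gradx Pn x y + ?s + transpose (Jac (cfun Pn) x) *v z'"
    show "?v \<in> {gradx Pn x y + s + transpose (Jac (cfun Pn) x) *v z' | s. s \<in> subdiff (gfun Pn) x}"
      using subdiff_g[OF x(1) subx] unfolding perturbed_simps by blast
    define e1 where "e1 = fst (Gxu (\<beta>t t) z (x, u) + (sx, \<rho>t t *\<^sub>R (u - ut)))"
    have e1: "e1 = gradx P x ?ys + transpose (Jac (cfun P) x) *v z' + sx"
      by (simp add: e1_def Gxu_def GPsi_def cc.pen_grad_def z(3))
    have "norm e1 \<le> \<eta>" using order_trans[OF norm_fst_snd_le(1) statx] by (simp add: e1_def \<eta>_def)
    moreover have v: "?v = (gradx P x y - gradx P x ?ys) + e1 - \<rho>t t *\<^sub>R (x - xt)" unfolding e1 by simp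
    moreover have "norm (gradx P x y - gradx P x ?ys) \<le> L_F * \<eta>"
      using grad_lipschitz(1)[of x y x ?ys] mult_left_mono[OF ydist L_F_nonneg] by simp
    moreover have "norm (\<rho>t t *\<^sub>R (x - xt)) \<le> \<rho>t t * (2 * r)"
      using dist_X[OF x] schedule(1)[of t] by simp
    ultimately have "norm ?v \<le> L_F * \<eta> + \<eta> + \<rho>t t * (2 * r)"
      using norm_triangle_ineq4[of "(gradx P x y - gradx P x ?ys) + e1" "\<rho>t t *\<^sub>R (x - xt)"]
        norm_triangle_ineq[of "gradx P x y - gradx P x ?ys" e1] unfolding v by linarith
    also have "\<dots> = (L_F + 1) * \<eta> + \<rho>t t * (2 * r)" by (simp add: distrib_right)
    also have "\<dots> \<le> (L_F + 1) * (eta0 par * s) + (rho0 par * s) * (2 * r)"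
      using \<eta>s L_F_nonneg r_nonneg params sp unfolding \<rho>s by (intro add_mono mult_left_mono) auto
    also have "\<dots> = ((L_F + 1) * eta0 par + 2 * r * rho0 par) * s" by (simp add: algebra_simps)
    also have "\<dots> \<le> e" by (rule bnd) (use terms in \<open>simp add: CK_def\<close>)
    finally show "norm ?v \<le> e" .
  qed
  have dz: "norm (z' - z) \<le> 2 * Zb" using norm_triangle_ineq4[of z' z] z by linarith
  have \<beta>tp: "0 < \<beta>t t" by (rule schedule)
  have 2: "norm (pos (cfun Pn x)) \<le> e"
  proof -
    have "norm (pos (cfun P x)) \<le> norm (z' - z) / \<beta>t t" by (rule multiplier_inner(2)[OF \<beta>tp z(3)])
    also have "\<dots> \<le> 2 * Zb / \<beta>t t" using dz \<beta>tp by (intro divide_right_mono) auto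
    also have "\<dots> \<le> e" unfolding \<beta>s by (rule bnd) (use terms in \<open>simp add: CK_def\<close>)
    finally show ?thesis by simp
  qed
  have 3: "(\<Sum>i\<in>UNIV. \<bar>cfun Pn x $ i * z' $ i\<bar>) \<le> e"
  proof -
    have "(\<Sum>i\<in>UNIV. \<bar>cfun P x $ i * z' $ i\<bar>) \<le> norm z' * norm (z' - z) / \<beta>t t"
      by (rule multiplier_inner(3)[OF \<beta>tp z(3)])
    also have "\<dots> \<le> Zb * (2 * Zb) / \<beta>t t" using dz z \<beta>tp Zb by (intro divide_right_mono mult_mono) auto
    also have "\<dots> = 2 * Zb * Zb / \<beta>t t" by simp
    also have "\<dots> \<le> e" unfolding \<beta>s by (rule bnd) (use terms in \<open>simp add: CK_def\<close>)
    finally show ?thesis by simp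
  qed
  have 4: "dist0 {grady Pn x y - s - transpose (Jac (pfun Pn) y) *v u' | s. s \<in> subdiff (hfun Pn) y} \<le> ereal e"
  proof (rule dist0_le)
    let ?s = "sy - \<nu> *\<^sub>R y"
    let ?v = "grady Pn x y - ?s - transpose (Jac (pfun Pn) y) *v u'"
    show "?v \<in> {grady Pn x y - s - transpose (Jac (pfun Pn) y) *v u' | s. s \<in> subdiff (hfun Pn) y}"
      using subdiff_h[OF y hr_subgradient[OF suby]] unfolding perturbed_simps by blast
    have "?v = - (Gy x u y + sy)" unfolding Gy_def pc.pen_grad_def u' by (simp add: scaleR_diff_right)
    then have "norm ?v \<le> min e \<eta> * \<nu>" using staty unfolding \<eta>_def by (metis norm_minus_cancel)
    also have "\<dots> \<le> (eta0 par * s) * nubar" using \<eta>s e \<nu> nubar by (intro mult_mono) auto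
    also have "\<dots> = (eta0 par * nubar) * s" by simp
    also have "\<dots> \<le> e" by (rule bnd) (use terms in \<open>simp add: CK_def\<close>)
    finally show "norm ?v \<le> e" .
  qed
  \<comment> \<open>Stationarity in \<open>u\<close> holds with the exact maximiser \<open>?ys\<close>, whereas \<open>u'\<close> is formed with \<open>y\<close>.\<close>
  have du: "norm (u' - u) / \<beta> \<le> W * s"
  proof -
    define us where "us = pos (\<beta> *\<^sub>R pfun P ?ys + u)"
    have "norm ((1 / \<beta>) *\<^sub>R (u - us) + \<rho>t t *\<^sub>R (u - ut)) \<le> \<eta>"
      using order_trans[OF norm_fst_snd_le(2) statx] by (simp add: Gxu_def GPsi_def us_def \<eta>_def)
    then have "norm ((1 / \<beta>) *\<^sub>R (u - us)) \<le> \<eta> + norm (\<rho>t t *\<^sub>R (u - ut))"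
      using norm_triangle_ineq4[of "(1 / \<beta>) *\<^sub>R (u - us) + \<rho>t t *\<^sub>R (u - ut)" "\<rho>t t *\<^sub>R (u - ut)"] by simp
    also have "norm (\<rho>t t *\<^sub>R (u - ut)) \<le> \<rho>t t * (2 * Ub)"
      using norm_triangle_ineq4[of u ut] u schedule(1)[of t] by simp
    finally have a: "norm (u - us) / \<beta> \<le> \<eta> + \<rho>t t * (2 * Ub)" using params(4) by simp
    have "norm (u' - us) \<le> norm ((\<beta> *\<^sub>R pfun P y + u) - (\<beta> *\<^sub>R pfun P ?ys + u))"
      unfolding u' us_def by (rule norm_pos_diff_le)
    also have "\<dots> = \<beta> * norm (pfun P y - pfun P ?ys)" using params(4) by (simp add: scaleR_diff_right[symmetric])
    also have "\<dots> \<le> \<beta> * (B * \<eta>)"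
      using p_lipschitz[OF y ystar(1), of x u] mult_left_mono[OF ydist less_imp_le[OF pos(1)]] params(4)
      by (intro mult_left_mono) auto
    finally have b: "norm (u' - us) / \<beta> \<le> B * \<eta>" using params(4) by (simp add: field_simps)
    have "norm (u' - u) \<le> norm (u' - us) + norm (u - us)"
      using norm_triangle_ineq4[of "u' - us" "u - us"] by simp
    then have "norm (u' - u) / \<beta> \<le> norm (u' - us) / \<beta> + norm (u - us) / \<beta>"
      using params(4) by (simp add: add_divide_distrib[symmetric] divide_right_mono)
    also have "\<dots> \<le> (B + 1) * \<eta> + \<rho>t t * (2 * Ub)" using a b by (simp add: distrib_right)
    also have "\<dots> \<le> (B + 1) * (eta0 par * s) + (rho0 par * s) * (2 * Ub)"
      using \<eta>s pos Ub_nonneg params sp unfolding \<rho>s by (intro add_mono mult_left_mono) auto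
    also have "\<dots> = W * s" by (simp add: W_def algebra_simps)
    finally show ?thesis .
  qed
  have 5: "norm (pos (pfun Pn y)) \<le> e"
  proof -
    have "norm (pos (pfun P y)) \<le> W * s" using multiplier_inner(2)[OF params(4) u'] du by linarith
    also have "\<dots> \<le> e" by (rule bnd) (use terms in \<open>simp add: CK_def\<close>)
    finally show ?thesis by simp
  qed
  have 6: "(\<Sum>i\<in>UNIV. \<bar>pfun Pn y $ i * u' $ i\<bar>) \<le> e"
  proof -
    have "W * s \<le> W" using sp W_pos by simp
    then have "norm (u' - u) / \<beta> \<le> W" using du by linarith
    then have "norm (u' - u) \<le> \<beta> * W" using params(4) by (simp add: divide_le_eq mult.commute)
    then have "norm u' \<le> Ub + \<beta> * W" using norm_triangle_ineq2[of u' u] u by linarith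
    have "(\<Sum>i\<in>UNIV. \<bar>pfun P y $ i * u' $ i\<bar>) \<le> norm u' * norm (u' - u) / \<beta>"
      by (rule multiplier_inner(3)[OF params(4) u'])
    also have "\<dots> = norm u' * (norm (u' - u) / \<beta>)" by simp
    also have "\<dots> \<le> (Ub + \<beta> * W) * (W * s)"
      using \<open>norm u' \<le> Ub + \<beta> * W\<close> du params(4) Ub_nonneg W_pos by (intro mult_mono) auto
    also have "\<dots> = ((Ub + \<beta> * W) * W) * s" by simp
    also have "\<dots> \<le> e" by (rule bnd) (use terms in \<open>simp add: CK_def\<close>)
    finally show ?thesis by simp
  qed
  have nonneg: "0 \<le> z' $ i" "0 \<le> u' $ j" for i j by (simp_all add: z(3) u')
  show ?thesis unfolding eps_KKT_mult_def using nonneg 1 2 3 4 5 6 by blast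
qed

definition step_cost :: "real \<Rightarrow> real \<Rightarrow> real \<Rightarrow> nat \<Rightarrow> nat \<Rightarrow> nat \<Rightarrow> nat \<Rightarrow> nat" where
  "step_cost \<kappa> LF e ey ex eg t =
     outer_cost \<kappa> Ub Zb (\<rho>t t) (\<eta>t t) (\<beta>t t) (Llow par * sigma par ^ t) LF ey ex eg
     + inner_cost \<kappa> Ub (min e (\<eta>t t) * \<nu>) * ey + ey + ex"

lemma alg_step:
  fixes m :: "calls \<Rightarrow> nat"
  assumes LF: "L_F \<le> LF" and e: "0 < e"
    and \<Lambda>: "\<And>i. 1 \<le> \<Lambda> i" "(ey = 0 \<and> ex = 0 \<and> eg = 0) \<or> (\<forall>i. \<Lambda> i \<le> \<kappa>)"
    and m: "\<And>s. m (tick_y s) \<le> m s + ey" "\<And>s. m (tick_h s) \<le> m s + ey" "\<And>s. m (tick_x s) \<le> m s + ex"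
      "\<And>s. m (tick_g s) \<le> m s + eg" "\<And>s i. m (s\<lparr>n_iapg := i\<rparr>) = m s"
    and xy: "x \<in> X" "y \<in> Y" and zu: "norm z \<le> Zb" "norm u \<le> ubound t"
  obtains x' y' z' u' u'' s' where
    "alg_loop \<Lambda> Pn par \<nu> LF e t x y z u s = (if eps_KKT_mult e Pn x' y' z' u'' then Some ((x', y', z', u''), s')
       else alg_loop \<Lambda> Pn par \<nu> LF e (t + 1) x' y' z' u' s')"
    "x' \<in> X" "y' \<in> Y" "norm z' \<le> Zb" "norm u' \<le> ubound (t + 1)"
    "CK / sigma par ^ t \<le> e \<longrightarrow> eps_KKT_mult e Pn x' y' z' u''"
    "m s' \<le> m s + step_cost \<kappa> LF e ey ex eg t"
proof -
  note sch = schedule[of t]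
  have uUb: "norm u \<le> Ub" "BU / \<delta> \<le> Ub" using zu(2) ubound(1,2)[of t] U0 by linarith+
  from outer_solve[where m = m and s = s and \<kappa> = \<kappa>, OF LF xy(1) uUb xy(2) zu(1) sch(1-5) sch(9,8) \<Lambda> m]
  obtain x' u' s1 sx where 1: "iapg \<Lambda> (approx_gradient_xu \<Lambda> Pn par \<nu> LF (\<beta>t t) z y) (psi_xu Pn \<beta> (\<beta>t t) z)
      (phi_xu Pn (\<rho>t t) x u) tick_g (x, u) (Llow par * sigma par ^ t) (\<rho>t t) (\<eta>t t) (gamma_u par) (gamma_d par) s
      = Some ((x', u'), s1)" "x' \<in> X"
    "norm u' \<le> max (norm u) (BU / \<delta>) + \<eta>t t / \<rho>t t"
    "\<forall>w\<in>X. gr x' + (sx - \<rho>t t *\<^sub>R (x' - x)) \<bullet> (w - x') \<le> gr w"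
    "norm (Gxu (\<beta>t t) z (x', u') + (sx, \<rho>t t *\<^sub>R (u' - u))) \<le> \<eta>t t"
    "m s1 \<le> m s + outer_cost \<kappa> Ub Zb (\<rho>t t) (\<eta>t t) (\<beta>t t) (Llow par * sigma par ^ t) LF ey ex eg"
    by blast
  have u'b: "norm u' \<le> ubound (t + 1)" using 1(3) zu(2) ubound(2,3)[of t] U0 by linarith
  then have u'Ub: "norm u' \<le> Ub" using ubound(1)[of "t + 1"] by linarith
  have tol: "0 < min e (\<eta>t t) * \<nu>" using e sch \<nu> by simp
  have "ey = 0 \<or> \<Lambda> (n_iapg s1) \<le> \<kappa>" using \<Lambda> by blast
  from solve_y[where m = m and s = s1 and x = x' and \<Lambda> = \<Lambda> and e = ey, OF u'Ub xy(2) tol \<Lambda>(1) this m(1,2,5)]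
  obtain y' s2 sy where 2: "solve_y \<Lambda> Pn par \<nu> y x' u' (min e (\<eta>t t) * \<nu>) s1 = Some (y', s2)" "y' \<in> Y"
    "\<forall>w\<in>Y. fy y' + sy \<bullet> (w - y') + \<nu> / 2 * (norm (w - y'))\<^sup>2 \<le> fy w"
    "norm (Gy x' u' y' + sy) \<le> min e (\<eta>t t) * \<nu>"
    "m s2 \<le> m s1 + inner_cost \<kappa> Ub (min e (\<eta>t t) * \<nu>) * ey"
    by blast
  define z' where "z' = pos (\<beta>t t *\<^sub>R cfun P x' + z)"
  define u'' where "u'' = pos (\<beta> *\<^sub>R pfun P y' + u')"
  have z'b: "norm z' \<le> Zb"
    using z_bound[OF 1(2) xy(1) sch(1,2,4,5) _ 1(5)] 1(4) zu(1) Zb(2) unfolding z'_def by fastforce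
  show thesis
  proof (rule that[of x' y' z' u'' "tick_x (tick_y s2)" u'])
    show "alg_loop \<Lambda> Pn par \<nu> LF e t x y z u s =
      (if eps_KKT_mult e Pn x' y' z' u'' then Some ((x', y', z', u''), tick_x (tick_y s2))
       else alg_loop \<Lambda> Pn par \<nu> LF e (t + 1) x' y' z' u' (tick_x (tick_y s2)))"
      by (subst alg_loop.simps)
        (simp add: Let_def \<beta>t_def[symmetric] \<rho>t_def[symmetric] \<eta>t_def[symmetric] 1(1) 2(1) z'_def[symmetric] u''_def[symmetric])
    show "CK / sigma par ^ t \<le> e \<longrightarrow> eps_KKT_mult e Pn x' y' z' u''"
      using kkt_residual[OF 1(2) xy(1) u'Ub uUb(1) 2(2) e zu(1) z'b z'_def _ 1(5) 2(3,4) u''_def] 1(4) by simp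
    show "m (tick_x (tick_y s2)) \<le> m s + step_cost \<kappa> LF e ey ex eg t"
      using 1(6) 2(5) m(1)[of s2] m(3)[of "tick_y s2"] unfolding step_cost_def by linarith
  qed (use 1(2) 2(2) z'b u'b in auto)
qed

lemma alg_loop_terminates:
  fixes m :: "calls \<Rightarrow> nat"
  assumes LF: "L_F \<le> LF" and e: "0 < e"
    and \<Lambda>: "\<And>i. 1 \<le> \<Lambda> i" "(ey = 0 \<and> ex = 0 \<and> eg = 0) \<or> (\<forall>i. \<Lambda> i \<le> \<kappa>)"
    and m: "\<And>s. m (tick_y s) \<le> m s + ey" "\<And>s. m (tick_h s) \<le> m s + ey" "\<And>s. m (tick_x s) \<le> m s + ex"
      "\<And>s. m (tick_g s) \<le> m s + eg" "\<And>s i. m (s\<lparr>n_iapg := i\<rparr>) = m s"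
    and T: "CK / sigma par ^ T \<le> e" and S: "\<And>t. t \<le> T \<Longrightarrow> step_cost \<kappa> LF e ey ex eg t \<le> S"
  shows "t + j = T \<Longrightarrow> x \<in> X \<Longrightarrow> y \<in> Y \<Longrightarrow> norm z \<le> Zb \<Longrightarrow> norm u \<le> ubound t \<Longrightarrow>
    \<exists>x' y' z' u' s'. alg_loop \<Lambda> Pn par \<nu> LF e t x y z u s = Some ((x', y', z', u'), s') \<and>
      eps_KKT_mult e Pn x' y' z' u' \<and> m s' \<le> m s + (j + 1) * S"
proof (induction j arbitrary: t x y z u s)
  case (0 t x y z u s)
  obtain x' y' z' u' u'' s' where st:
    "alg_loop \<Lambda> Pn par \<nu> LF e t x y z u s = (if eps_KKT_mult e Pn x' y' z' u'' then Some ((x', y', z', u''), s')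
       else alg_loop \<Lambda> Pn par \<nu> LF e (t + 1) x' y' z' u' s')"
    "CK / sigma par ^ t \<le> e \<longrightarrow> eps_KKT_mult e Pn x' y' z' u''"
    "m s' \<le> m s + step_cost \<kappa> LF e ey ex eg t"
    by (rule alg_step[where m = m and s = s and t = t, OF LF e \<Lambda> m 0(2-5)])
  have "t = T" using 0 by simp
  then show ?case using st T S[of t] by auto
next
  case (Suc j t x y z u s)
  obtain x' y' z' u' u'' s' where st:
    "alg_loop \<Lambda> Pn par \<nu> LF e t x y z u s = (if eps_KKT_mult e Pn x' y' z' u'' then Some ((x', y', z', u''), s')
       else alg_loop \<Lambda> Pn par \<nu> LF e (t + 1) x' y' z' u' s')"
    "x' \<in> X" "y' \<in> Y" "norm z' \<le> Zb" "norm u' \<le> ubound (t + 1)"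
    "m s' \<le> m s + step_cost \<kappa> LF e ey ex eg t"
    by (rule alg_step[where m = m and s = s and t = t, OF LF e \<Lambda> m Suc.prems(2-5)])
  have cost: "m s' \<le> m s + S" using st(6) S[of t] Suc.prems(1) by simp
  show ?case
  proof (cases "eps_KKT_mult e Pn x' y' z' u''")
    case True
    have "m s' \<le> m s + (Suc j + 1) * S" using cost by simp
    then show ?thesis using st(1) True by auto
  next
    case False
    have "t + 1 + j = T" using Suc.prems(1) by simp
    from Suc.IH[OF this st(2-5), of s'] obtain x1 y1 z1 u1 s1 where
      *: "alg_loop \<Lambda> Pn par \<nu> LF e (t + 1) x' y' z' u' s' = Some ((x1, y1, z1, u1), s1)"
      "eps_KKT_mult e Pn x1 y1 z1 u1" "m s1 \<le> m s' + (j + 1) * S" by blast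
    have "m s1 \<le> m s + (Suc j + 1) * S" using *(3) cost by simp
    then show ?thesis using st(1) False * by auto
  qed
qed

lemma algorithm_A_terminates:
  fixes m :: "calls \<Rightarrow> nat"
  assumes LF: "L_F \<le> LF" and e: "0 < e"
    and \<Lambda>: "\<And>i. 1 \<le> \<Lambda> i" "(ey = 0 \<and> ex = 0 \<and> eg = 0) \<or> (\<forall>i. \<Lambda> i \<le> \<kappa>)"
    and m: "\<And>s. m (tick_y s) \<le> m s + ey" "\<And>s. m (tick_h s) \<le> m s + ey" "\<And>s. m (tick_x s) \<le> m s + ex"
      "\<And>s. m (tick_g s) \<le> m s + eg" "\<And>s i. m (s\<lparr>n_iapg := i\<rparr>) = m s" "m no_calls = 0"
    and T: "CK / sigma par ^ T \<le> e" and S: "\<And>t. t \<le> T \<Longrightarrow> step_cost \<kappa> LF e ey ex eg t \<le> S"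
  shows "\<exists>x y z u s. algorithm_A \<Lambda> Pn par \<nu> LF e = Some ((x, y, z, u), s) \<and>
      eps_KKT_mult e Pn x y z u \<and> m s \<le> (T + 1) * S"
proof -
  have "norm (u_init par) \<le> ubound 0" using U0(3) by (simp add: ubound_def)
  moreover have "x_init par \<in> X" using par by (simp add: admissible_def)
  ultimately show ?thesis
    using alg_loop_terminates[where m = m and S = S and s = no_calls and t = 0 and j = T, OF LF e \<Lambda> m(1-5) T S _ _ params(10) Zb(3)]
    unfolding algorithm_A_def m(6) by simp
qed

end

text \<open>The regularisation contributes \<open>\<nu> |y - y0| \<le> \<nu> Dy\<close> to the gradient. As an infimum, \<open>dist0\<close> is compared
  by means of subgradients that almost attain it.\<close>

lemma (in perturbed_minimax) eps_KKT_unperturbed: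
  assumes kkt: "eps_KKT e Pn x y" and e: "e + \<nu> * Dy \<le> e'"
  shows "eps_KKT e' P x y"
proof -
  from kkt obtain z u where k: "eps_KKT_mult e Pn x y z u" unfolding eps_KKT_def by blast
  have e0: "e \<le> e'" using e \<nu> Dy_pos by (smt (verit) mult_pos_pos)
  let ?A = "{grady Pn x y - s - transpose (Jac (pfun P) y) *v u | s. s \<in> subdiff (hfun P) y}"
  let ?B = "{grady P x y - s - transpose (Jac (pfun P) y) *v u | s. s \<in> subdiff (hfun P) y}"
  have A: "dist0 ?A \<le> ereal e" using k unfolding eps_KKT_mult_def by simp
  have "dist0 ?B \<le> ereal (d + \<nu> * Dy)" if "e < d" for d
  proof -
    have "dist0 ?A < ereal d" using A that by (simp add: le_less_trans)
    then obtain v where "v \<in> ?A" "norm v < d" unfolding dist0_def INF_less_iff by auto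
    then obtain s where s: "s \<in> subdiff (hfun P) y"
      "norm (grady Pn x y - s - transpose (Jac (pfun P) y) *v u) < d" by blast
    have y: "y \<in> Y" using s(1) by (simp add: subdiff_def)
    have eq: "grady P x y - s - transpose (Jac (pfun P) y) *v u
        = (grady Pn x y - s - transpose (Jac (pfun P) y) *v u) + \<nu> *\<^sub>R (y - y0)" by simp
    have "norm (\<nu> *\<^sub>R (y - y0)) \<le> \<nu> * Dy" using dist_Y[OF y params(10)] \<nu> by simp
    then have "norm (grady P x y - s - transpose (Jac (pfun P) y) *v u) \<le> d + \<nu> * Dy"
      using s(2) norm_triangle_ineq[of "grady Pn x y - s - transpose (Jac (pfun P) y) *v u" "\<nu> *\<^sub>R (y - y0)"]
      unfolding eq by linarith
    then show ?thesis using s(1) by (intro dist0_le[of "grady P x y - s - transpose (Jac (pfun P) y) *v u"]) auto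
  qed
  then have *: "dist0 ?B \<le> ereal (e + d + \<nu> * Dy)" if "0 < d" for d using that by simp
  have **: "dist0 ?B \<le> ereal e' + ereal d" if "0 < d" for d
    by (rule order_trans[OF *[OF that]]) (use e in simp)
  have B: "dist0 ?B \<le> ereal e'" by (rule ereal_le_epsilon2) (rule **)
  have mono: "r \<le> ereal e \<Longrightarrow> r \<le> ereal e'" "c \<le> e \<Longrightarrow> c \<le> e'" for r :: ereal and c :: real
    using e0 by (meson ereal_less_eq(3) order_trans, linarith)
  have "eps_KKT_mult e' P x y z u"
    using k B unfolding eps_KKT_mult_def perturbed_simps gradx_perturbed by (blast intro: mono)
  then show ?thesis unfolding eps_KKT_def by blast
qed

section \<open>Cost of one outer iteration in terms of the accuracy\<close>

lemma mult_le_power_add: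
  fixes Z :: real
  shows "0 \<le> a \<Longrightarrow> 0 \<le> b \<Longrightarrow> 1 \<le> Z \<Longrightarrow> a \<le> Z ^ i \<Longrightarrow> b \<le> Z ^ j \<Longrightarrow> a * b \<le> Z ^ (i + j)"
  by (simp add: power_add mult_mono)

lemma add_le_power_Suc:
  fixes Z :: real
  assumes "2 \<le> Z" "a \<le> Z ^ i" "b \<le> Z ^ i"
  shows "a + b \<le> Z ^ (i + 1)"
proof -
  have "Z ^ i * 2 \<le> Z ^ i * Z" using assms(1) by (intro mult_left_mono) auto
  then show ?thesis using assms(2,3) unfolding power_add power_one_right by linarith
qed

lemma iter_bound_le:
  assumes "0 < L" "0 < \<mu>" "1 \<le> Z" "(14 * R * L / \<epsilon>)\<^sup>2 * (L / (2 * \<mu>)) \<le> Z ^ p" "sqrt (L / (2 * \<mu>)) \<le> w"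
  shows "real (iter_bound L \<mu> R \<epsilon>) \<le> 1 + (1 + w) * (real p * ln Z)"
proof -
  define q where "q = sqrt (2 * \<mu> / L)"
  have q: "0 < q" using assms by (simp add: q_def)
  have inv: "1 / q = sqrt (L / (2 * \<mu>))" by (simp add: q_def real_sqrt_divide)
  have w: "0 \<le> w" by (rule order_trans[OF _ assms(5)]) (use assms in simp)
  let ?X = "max 1 ((14 * R * L / \<epsilon>)\<^sup>2 * (L / (2 * \<mu>)))"
  have "1 \<le> Z ^ p" using assms(3) by simp
  then have "ln ?X \<le> ln (Z ^ p)" using assms(3,4) by (subst ln_le_cancel_iff) auto
  then have X: "ln ?X \<le> real p * ln Z" "0 \<le> ln ?X" using assms(3) by (simp_all add: ln_realpow)
  have "ln (1 / (1 + q)) \<le> 1 / (1 + q) - 1" using q by (intro ln_le_minus_one) simp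
  then have "q / (1 + q) \<le> ln (1 + q)" using q by (simp add: ln_div field_simps)
  then have "ln ?X / ln (1 + q) \<le> ln ?X / (q / (1 + q))"
    using q X by (intro divide_left_mono mult_pos_pos) auto
  also have "\<dots> = (1 + 1 / q) * ln ?X" using q by (simp add: field_simps)
  also have "\<dots> \<le> (1 + w) * (real p * ln Z)"
    using X q assms(5) w by (intro mult_mono) (auto simp: inv)
  finally have 1: "ln ?X / ln (1 + q) \<le> (1 + w) * (real p * ln Z)" .
  moreover have "0 \<le> ln ?X / ln (1 + q)" using X q by (intro divide_nonneg_nonneg) auto
  ultimately show ?thesis unfolding iter_bound_def q_def[symmetric] by linarith
qed

lemma trial_bound_le:
  assumes "1 < \<gamma>" "1 \<le> Z" "Lbar / Lmin \<le> Z ^ p"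
  shows "real (trial_bound \<gamma> Lbar Lmin) \<le> 1 + real p * ln Z / ln \<gamma>"
proof -
  have "1 \<le> Z ^ p" using assms(2) by simp
  then have "ln (max 1 (Lbar / Lmin)) \<le> ln (Z ^ p)" using assms(2,3) by (subst ln_le_cancel_iff) auto
  then have "ln (max 1 (Lbar / Lmin)) \<le> real p * ln Z" using assms(2) by (simp add: ln_realpow)
  then have "ln (max 1 (Lbar / Lmin)) / ln \<gamma> \<le> real p * ln Z / ln \<gamma>" using assms(1) by (intro divide_right_mono) auto
  moreover have "0 \<le> ln (max 1 (Lbar / Lmin)) / ln \<gamma>" using assms(1) by (intro divide_nonneg_nonneg) auto
  ultimately show ?thesis unfolding trial_bound_def by linarith
qed

text \<open>With \<open>Z\<close> of order \<open>1/\<epsilon>\<close>, the inner tolerances are only polynomially small, so they enter the cost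
  through a logarithm.\<close>

lemma query_accuracy_ge:
  assumes Z: "8 \<le> Z" and X0: "(14 * R * L / \<eta>)\<^sup>2 \<le> Z ^ a"
    and \<rho>: "0 < \<rho>" "1 / \<rho> \<le> Z" "\<rho> \<le> Z" and Lmin: "0 < Lmin" "4 / Lmin \<le> Z"
    and \<eta>: "0 < \<eta>" "1 / \<eta> \<le> Z ^ b" and K: "real K + 2 \<le> Z ^ 3"
  shows "1 / query_accuracy Lmin \<rho> \<eta> R L K \<le> Z ^ (a + b + 14)"
proof -
  define X where "X = (14 * R * L / \<eta>)\<^sup>2"
  define A1 where "A1 = 2 * X / \<rho> + 4 * (1 + X) / Lmin"
  define At where "At = 2 * A1 + 4 * (1 + \<rho> * A1) / Lmin"
  have Z1: "1 \<le> Z" "2 \<le> Z" using Z by auto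
  have one: "1 \<le> Z ^ i" for i using Z1 by simp
  have X: "0 \<le> X" "X \<le> Z ^ a" using X0 by (auto simp: X_def)
  have r2: "2 * (1 / \<rho>) \<le> Z ^ (1 + 1)" using \<rho> Z1 by - (rule mult_le_power_add, auto)
  have "X * (2 * (1 / \<rho>)) \<le> Z ^ (a + (1 + 1))"
    using X \<rho> Z1 r2 by - (rule mult_le_power_add, auto)
  then have a1: "2 * X / \<rho> \<le> Z ^ (a + 2)" by (simp add: mult_ac)
  have "1 + X \<le> Z ^ (a + 1)" by (rule add_le_power_Suc[OF Z1(2) one X(2)])
  then have "(1 + X) * (4 / Lmin) \<le> Z ^ ((a + 1) + 1)"
    using X Lmin Z1 by - (rule mult_le_power_add, auto)
  then have "4 * (1 + X) / Lmin \<le> Z ^ (a + 2)" by (simp add: mult_ac)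
  from add_le_power_Suc[OF Z1(2) a1 this] have A1: "A1 \<le> Z ^ (a + 3)" by (simp add: A1_def numeral_3_eq_3)
  have A1n: "0 \<le> A1" unfolding A1_def using X \<rho> Lmin by (intro add_nonneg_nonneg divide_nonneg_nonneg) auto
  have "\<rho> * A1 \<le> Z ^ (1 + (a + 3))" using A1 A1n \<rho> Z1 by - (rule mult_le_power_add, auto)
  from add_le_power_Suc[OF Z1(2) one this]
  have "(1 + \<rho> * A1) * (4 / Lmin) \<le> Z ^ ((1 + (a + 3) + 1) + 1)"
    using A1n \<rho> Lmin Z1 by - (rule mult_le_power_add, auto)
  then have b1: "4 * (1 + \<rho> * A1) / Lmin \<le> Z ^ (a + 6)" by (simp add: mult_ac add_ac)
  have "2 * A1 \<le> Z ^ (1 + (a + 3))" using A1 A1n Z1 by - (rule mult_le_power_add, auto)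
  also have "\<dots> \<le> Z ^ (a + 6)" using Z1 by (intro power_increasing) auto
  finally have "2 * A1 \<le> Z ^ (a + 6)" .
  from add_le_power_Suc[OF Z1(2) this b1] have At: "At \<le> Z ^ (a + 7)" by (simp add: At_def add_ac)
  let ?D = "(real K + 2)\<^sup>2 * max 1 At"
  have "(real K + 2)\<^sup>2 \<le> (Z ^ 3)\<^sup>2" using K by (intro power_mono) auto
  then have D: "?D \<le> Z ^ (6 + (a + 7))" using At one Z1
    by (intro mult_le_power_add) (auto simp: power_mult[symmetric])
  have D0: "0 < ?D" by (intro mult_pos_pos) auto
  have r3: "(1 / \<rho>) * (1 / \<eta>) \<le> Z ^ (1 + b)" using \<rho> \<eta> Z1 by - (rule mult_le_power_add, auto)
  have "?D * ((1 / \<rho>) * (1 / \<eta>)) \<le> Z ^ ((6 + (a + 7)) + (1 + b))"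
    using D D0 \<rho> \<eta> Z1 r3 by - (rule mult_le_power_add, auto)
  then have c1: "1 / (\<rho> * \<eta> / ?D) \<le> Z ^ (a + b + 14)" by (simp add: mult_ac add_ac)
  have "8 * (1 / \<eta>) \<le> Z ^ (1 + b)" using \<eta> Z Z1 by - (rule mult_le_power_add, auto)
  also have "\<dots> \<le> Z ^ (a + b + 14)" using Z1 by (intro power_increasing) auto
  finally have c2: "1 / (\<eta> / 8) \<le> Z ^ (a + b + 14)" by simp
  have "query_accuracy Lmin \<rho> \<eta> R L K = min (\<eta> / 8) (\<rho> * \<eta> / ?D)"
    unfolding query_accuracy_def Let_def At_def A1_def X_def ..
  then show ?thesis using c1 c2 by (simp add: min_def)
qed

context perturbed_minimax
begin

text \<open>\<open>\<tau>\<^sup>t\<close> is a power of \<open>\<sigma>\<^sup>t\<close> up to a constant, hence polynomial in \<open>1/\<epsilon>\<close> as long as \<open>\<sigma>\<^sup>t\<close> is.\<close>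

definition p0 :: nat where "p0 = (SOME p. tau par \<le> sigma par ^ p)"

text \<open>\<open>G0/\<epsilon>\<close> bounds \<open>\<sigma>\<^sup>t\<close>, \<open>G1/\<epsilon>\<close> bounds the outer smoothness constant, \<open>tb\<close> the inner tolerances and
  \<open>RB\<close> the inner radii.\<close>

definition G0 :: real where "G0 = sigma par * (1 + 2 * CK)"
definition tb :: real where
  "tb = max (eta0 par / 8 * nubar / (L_F + M_p P)) (eta0 par * nubar)"
definition RB :: real where
  "RB = sqrt (Dy\<^sup>2 + 4 * (nubar * tb * (8 * Dy + tb / (2 * Llow par))))"
definition G1 :: real where
  "G1 = 2 * (L_F + 2 / \<beta> + (L_F + B)\<^sup>2 * (2 * Dy)) + 2 * (L_c * (beta_x0 par * G0 * B + Zb) + beta_x0 par * G0 * B\<^sup>2 + 1)"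

text \<open>An upper bound for all constants of the complexity estimate that are independent of \<open>\<nu>\<close>. As a sum of
  nonnegative terms it dominates each of them.\<close>

definition Gam :: "real \<Rightarrow> real" where
  "Gam \<kappa> = 14 + (4 * real p0 + 23) + 2 * Dy + LYmax \<kappa> (NU Ub) + LYmax \<kappa> Ub + RB
    + real (trial_bound (gamma_u par) (LY (NU Ub)) (Llow par)) + real (trial_bound (gamma_u par) (LY Ub) (Llow par))
    + (\<kappa> * Llow par * G0 + gamma_u par * G1) + 4 / Llow par + G0 / rho0 par + rho0 par + G0 + 1 / eta0 par + RU Ub
    + (L_F + nubar + M_p P) + 1 / ln (gamma_u par) + 1 / ln (sigma par) + (1 + 2 * CK)"

lemma p0: "tau par \<le> sigma par ^ p0"
proof -
  obtain n where "tau par < sigma par ^ n" using real_arch_pow[OF params(9)] by blast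
  then have "tau par \<le> sigma par ^ n" by simp
  then show ?thesis unfolding p0_def by (rule someI)
qed

lemma CK_nonneg: "0 \<le> CK"
  unfolding CK_def using L_F_nonneg params r_nonneg Zb W_pos Ub_nonneg \<nu> nubar
  by (intro add_nonneg_nonneg mult_nonneg_nonneg divide_nonneg_nonneg) auto

lemma LYmax_pos: "1 \<le> \<kappa> \<Longrightarrow> 0 < LYmax \<kappa> U"
  unfolding LYmax_def using params by (auto simp: less_max_iff_disj)

lemma RB_bound: "tol \<le> tb \<Longrightarrow> 0 < tol \<Longrightarrow> RY tol \<le> RB"
  unfolding RY_def RB_def using \<nu> nubar Dy_pos params
  by (intro real_sqrt_le_mono add_left_mono mult_left_mono mult_mono divide_right_mono) auto

lemma Gam_bounds:
  assumes \<kappa>: "1 \<le> \<kappa>"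
  shows "37 \<le> Gam \<kappa>" "4 * real p0 + 23 \<le> Gam \<kappa>" "2 * Dy \<le> Gam \<kappa>" "LYmax \<kappa> (NU Ub) \<le> Gam \<kappa>" "LYmax \<kappa> Ub \<le> Gam \<kappa>"
    "RB \<le> Gam \<kappa>" "real (trial_bound (gamma_u par) (LY (NU Ub)) (Llow par)) \<le> Gam \<kappa>"
    "real (trial_bound (gamma_u par) (LY Ub) (Llow par)) \<le> Gam \<kappa>"
    "\<kappa> * Llow par * G0 + gamma_u par * G1 \<le> Gam \<kappa>" "4 / Llow par \<le> Gam \<kappa>" "G0 / rho0 par \<le> Gam \<kappa>" "rho0 par \<le> Gam \<kappa>"
    "G0 \<le> Gam \<kappa>" "1 / eta0 par \<le> Gam \<kappa>" "RU Ub \<le> Gam \<kappa>" "L_F + nubar + M_p P \<le> Gam \<kappa>" "1 / ln (gamma_u par) \<le> Gam \<kappa>"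
    "1 / ln (sigma par) \<le> Gam \<kappa>" "1 + 2 * CK \<le> Gam \<kappa>"
    and "0 \<le> G0" "0 \<le> G1"
proof -
  have nubar0: "0 \<le> nubar" using \<nu> nubar by simp
  show G0: "0 \<le> G0" unfolding G0_def using params CK_nonneg by (intro mult_nonneg_nonneg) auto
  show G1: "0 \<le> G1"
  proof -
    have 1: "0 \<le> L_F + 2 / \<beta> + (L_F + B)\<^sup>2 * (2 * Dy)" using L_F_nonneg params(4) Dy_pos by simp
    have 2: "0 \<le> beta_x0 par * G0" using params(5) G0 by simp
    then have "0 \<le> L_c * (beta_x0 par * G0 * B + Zb) + beta_x0 par * G0 * B\<^sup>2 + 1"
      using pos(1) Zb(1) lipschitz_on_nonneg[OF cc.lip] by simp
    with 1 show ?thesis unfolding G1_def by (intro add_nonneg_nonneg[OF mult_nonneg_nonneg mult_nonneg_nonneg]) simp_all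
  qed
  have tb: "0 \<le> tb" unfolding tb_def using params nubar0 by (intro max.coboundedI2) auto
  have *: "0 \<le> RB" "0 \<le> LYmax \<kappa> (NU Ub)" "0 \<le> LYmax \<kappa> Ub" "0 \<le> \<kappa> * Llow par * G0 + gamma_u par * G1"
    "0 \<le> 4 / Llow par" "0 \<le> G0 / rho0 par" "0 \<le> rho0 par" "0 \<le> 1 / eta0 par" "0 \<le> RU Ub" "0 \<le> L_F + nubar + M_p P"
    "0 \<le> 1 / ln (gamma_u par)" "0 \<le> 1 / ln (sigma par)" "0 \<le> 1 + 2 * CK" "0 \<le> Dy" "0 \<le> real p0"
    "0 \<le> real (trial_bound (gamma_u par) (LY (NU Ub)) (Llow par))" "0 \<le> real (trial_bound (gamma_u par) (LY Ub) (Llow par))"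
  proof -
    show "0 \<le> RB" unfolding RB_def using tb nubar0 Dy_pos params
      by (intro real_sqrt_ge_zero add_nonneg_nonneg mult_nonneg_nonneg divide_nonneg_nonneg) auto
    show "0 \<le> LYmax \<kappa> (NU Ub)" "0 \<le> LYmax \<kappa> Ub" using LYmax_pos[OF \<kappa>] by (auto intro: less_imp_le)
    show "0 \<le> \<kappa> * Llow par * G0 + gamma_u par * G1" using \<kappa> params G0 G1
      by (intro add_nonneg_nonneg mult_nonneg_nonneg) auto
    show "0 \<le> RU Ub" using outer_constants(6)[OF Ub_nonneg] by simp
  qed (use params G0 L_M nubar0 CK_nonneg Dy_pos in auto)
  note * = * G0
  show "37 \<le> Gam \<kappa>" "4 * real p0 + 23 \<le> Gam \<kappa>" "2 * Dy \<le> Gam \<kappa>" "LYmax \<kappa> (NU Ub) \<le> Gam \<kappa>" "LYmax \<kappa> Ub \<le> Gam \<kappa>"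
    "RB \<le> Gam \<kappa>" "real (trial_bound (gamma_u par) (LY (NU Ub)) (Llow par)) \<le> Gam \<kappa>"
    "real (trial_bound (gamma_u par) (LY Ub) (Llow par)) \<le> Gam \<kappa>"
    "\<kappa> * Llow par * G0 + gamma_u par * G1 \<le> Gam \<kappa>" "4 / Llow par \<le> Gam \<kappa>" "G0 / rho0 par \<le> Gam \<kappa>" "rho0 par \<le> Gam \<kappa>"
    "G0 \<le> Gam \<kappa>" "1 / eta0 par \<le> Gam \<kappa>" "RU Ub \<le> Gam \<kappa>" "L_F + nubar + M_p P \<le> Gam \<kappa>" "1 / ln (gamma_u par) \<le> Gam \<kappa>"
    "1 / ln (sigma par) \<le> Gam \<kappa>" "1 + 2 * CK \<le> Gam \<kappa>"
    unfolding Gam_def using * by linarith+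
qed

end

text \<open>The regime of the complexity bound. \<open>\<epsilon> \<le> 1/3\<close> ensures \<open>ln (1/\<epsilon>) \<ge> 1\<close>. Every quantity is compared with a
  power of \<open>Z = \<Gamma>/\<epsilon>\<close>, where \<open>\<Gamma>\<close> is independent of \<open>\<epsilon>\<close>.\<close>

locale small_perturbation = perturbed_minimax P L_F L_c L_p r B \<delta> xf yf par \<nu> nubar
  for P :: "(real^'n, real^'m, real^'q, real^'r) minimax" and L_F L_c L_p r B \<delta> xf yf par \<nu> nubar +
  fixes \<epsilon> \<kappa> LF :: real
  assumes \<epsilon>: "0 < \<epsilon>" "\<epsilon> \<le> 1 / 3" and \<nu>_eq: "\<nu> = \<epsilon> / (2 * diameter (edom (hfun P)))"
    and \<kappa>: "1 \<le> \<kappa>" and LF: "L_F \<le> LF" "LF \<le> L_F + \<nu>"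
begin

definition \<Gamma> :: real where "\<Gamma> = Gam \<kappa>"
definition E :: real where "E = 1 / \<epsilon>"
definition Z :: real where "Z = \<Gamma> * E"
abbreviation "l \<equiv> ln Z"

lemmas \<Gamma> = Gam_bounds[OF \<kappa>, folded \<Gamma>_def]

lemma E: "3 \<le> E" using \<epsilon> by (simp add: E_def field_simps)

lemma Z: "\<Gamma> \<le> Z" "E \<le> Z" "37 \<le> Z" "1 \<le> Z" "1 \<le> l" "l \<le> Z"
proof -
  have G1: "1 \<le> \<Gamma>" "0 \<le> \<Gamma>" using \<Gamma>(1) by simp_all
  have "\<Gamma> * 1 \<le> Z" unfolding Z_def using E G1 by (intro mult_left_mono) linarith+
  then show 1: "\<Gamma> \<le> Z" by simp
  have "1 * E \<le> Z" unfolding Z_def using E G1 by (intro mult_right_mono) linarith+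
  then show "E \<le> Z" by simp
  show 37: "37 \<le> Z" using 1 \<Gamma>(1) by linarith
  then show "1 \<le> Z" by linarith
  have "exp 1 \<le> Z" using exp_le 37 by linarith
  then show "1 \<le> l" using 37 by (subst ln_ge_iff) auto
  have "ln Z \<le> Z - 1" using 37 by (intro ln_le_minus_one) linarith
  then show "l \<le> Z" by linarith
qed

text \<open>Turns logarithms of \<open>Z\<close> into logarithms of \<open>1/\<epsilon>\<close>.\<close>

lemma l_le: "l \<le> \<Gamma> * ln E"
proof -
  have "exp 1 \<le> E" using exp_le E by linarith
  then have E1: "1 \<le> ln E" using E by (subst ln_ge_iff) auto
  have G: "0 < \<Gamma>" using \<Gamma>(1) by simp
  have "l = ln \<Gamma> + ln E" unfolding Z_def using G E by (subst ln_mult_pos) auto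
  also have "ln \<Gamma> \<le> \<Gamma> - 1" using G by (rule ln_le_minus_one)
  also have "(\<Gamma> - 1) + ln E \<le> (\<Gamma> - 1) * ln E + ln E"
    using mult_left_mono[OF E1, of "\<Gamma> - 1"] \<Gamma>(1) by simp
  finally show ?thesis by (simp add: algebra_simps)
qed

lemma inv_\<nu>: "1 / \<nu> \<le> Z" "1 / (2 * \<nu>) \<le> Z" "1 / (2 * \<nu>) \<le> \<Gamma> * E" "1 / \<nu> = 2 * Dy * E"
proof -
  show eq: "1 / \<nu> = 2 * Dy * E" using \<epsilon> Dy_pos by (simp add: \<nu>_eq E_def)
  show 1: "1 / \<nu> \<le> Z" unfolding eq Z_def using \<Gamma>(3) E by (intro mult_right_mono) linarith+
  have "1 / (2 * \<nu>) \<le> 1 / \<nu>" using \<nu> by (intro divide_left_mono) auto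
  then show "1 / (2 * \<nu>) \<le> Z" "1 / (2 * \<nu>) \<le> \<Gamma> * E" using 1 unfolding Z_def by linarith+
qed

text \<open>\<open>sqrt (LYmax/(2\<nu>)) \<le> \<Gamma> sqrt (1/\<epsilon>)\<close> is the condition number of the inner problem.\<close>

lemma inner_cost_le:
  assumes L: "LYmax \<kappa> U \<le> \<Gamma>" and J: "real (trial_bound (gamma_u par) (LY U) (Llow par)) \<le> \<Gamma>"
    and tol: "0 < tol" "tol \<le> tb" "1 / tol \<le> Z ^ p"
  shows "real (inner_cost \<kappa> U tol) \<le> 7 * (4 * real p + 19) * \<Gamma>\<^sup>2 * sqrt E * l"
proof -
  let ?L = "LYmax \<kappa> U" and ?R = "RY tol"
  have Lp: "0 < ?L" by (rule LYmax_pos[OF \<kappa>])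
  have R: "0 \<le> ?R" "?R \<le> Z" using RB_bound[OF tol(2,1)] \<Gamma>(6) Z(1) \<nu> Dy_pos tol params
    by (auto simp: RY_def intro!: add_nonneg_nonneg mult_nonneg_nonneg)
  have LZ: "?L \<le> Z" using L Z(1) by linarith
  have "14 * ?R \<le> Z ^ (1 + 1)" using R Z by - (rule mult_le_power_add, auto)
  then have "14 * ?R * ?L \<le> Z ^ ((1 + 1) + 1)" using R Lp LZ Z by - (rule mult_le_power_add, auto)
  then have "14 * ?R * ?L * (1 / tol) \<le> Z ^ (((1 + 1) + 1) + p)"
    using R Lp tol Z by - (rule mult_le_power_add, auto)
  then have "(14 * ?R * ?L / tol)\<^sup>2 \<le> (Z ^ (3 + p))\<^sup>2"
    using R Lp tol by (intro power_mono) (auto simp: numeral_3_eq_3 add_ac)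
  then have "(14 * ?R * ?L / tol)\<^sup>2 \<le> Z ^ (2 * p + 6)" by (simp add: power_mult[symmetric] algebra_simps)
  moreover have "?L * (1 / (2 * \<nu>)) \<le> Z ^ (1 + 1)"
    using Lp LZ inv_\<nu>(2) \<nu> Z by - (rule mult_le_power_add, auto)
  ultimately have "(14 * ?R * ?L / tol)\<^sup>2 * (?L * (1 / (2 * \<nu>))) \<le> Z ^ ((2 * p + 6) + (1 + 1))"
    using Lp \<nu> Z by - (rule mult_le_power_add, auto)
  then have X: "(14 * ?R * ?L / tol)\<^sup>2 * (?L / (2 * \<nu>)) \<le> Z ^ (2 * p + 8)" by (simp add: add_ac)
  have "?L * (1 / (2 * \<nu>)) \<le> \<Gamma> * (\<Gamma> * E)"
    using L Lp inv_\<nu>(3) \<nu> \<Gamma>(1) by (intro mult_mono) auto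
  then have "sqrt (?L / (2 * \<nu>)) \<le> sqrt (\<Gamma>\<^sup>2 * E)"
    by (intro real_sqrt_le_mono) (simp add: power2_eq_square)
  also have "\<dots> = \<Gamma> * sqrt E" using \<Gamma>(1) by (simp add: real_sqrt_mult)
  finally have w: "sqrt (?L / (2 * \<nu>)) \<le> \<Gamma> * sqrt E" .
  define s where "s = \<Gamma> * sqrt E"
  have "1 * 1 \<le> \<Gamma> * sqrt E" using \<Gamma>(1) E by (intro mult_mono) (auto simp: real_le_rsqrt)
  then have s: "1 \<le> s" by (simp add: s_def)
  have sl: "1 \<le> s * l" "l \<le> s * l" using mult_mono[OF s Z(5)] mult_right_mono[OF s, of l] s Z(5) by auto
  let ?K = "iter_bound ?L \<nu> ?R tol"
  have "real ?K \<le> 1 + (1 + s) * (real (2 * p + 8) * l)"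
    using iter_bound_le[OF Lp \<nu> Z(4) X w] by (simp add: s_def)
  also have "\<dots> = 1 + (2 * real p + 8) * (l + s * l)" by (simp add: algebra_simps)
  also have "\<dots> \<le> 1 + (2 * real p + 8) * (s * l + s * l)" using sl by (intro add_left_mono mult_left_mono) auto
  also have "\<dots> = 1 + (4 * real p + 16) * (s * l)" by (simp add: algebra_simps)
  finally have "real ?K + 2 \<le> (4 * real p + 19) * (s * l)" using sl(1) by (simp add: distrib_right)
  moreover have "(real (trial_bound (gamma_u par) (LY U) (Llow par)) + 1) * 3 + 1 \<le> 7 * \<Gamma>"
    using J \<Gamma>(1) by simp
  ultimately have "(real ?K + 2) * ((real (trial_bound (gamma_u par) (LY U) (Llow par)) + 1) * 3 + 1)
      \<le> ((4 * real p + 19) * (s * l)) * (7 * \<Gamma>)"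
    using sl by (intro mult_mono) auto
  also have "\<dots> = 7 * (4 * real p + 19) * \<Gamma>\<^sup>2 * sqrt E * l" by (simp add: s_def power2_eq_square mult_ac)
  finally show ?thesis
    unfolding inner_cost_def by (simp only: of_nat_mult of_nat_add of_nat_numeral of_nat_1)
qed

context
  fixes t :: nat
  assumes t: "sigma par ^ t \<le> G0 * E"
begin

lemma inv_\<eta>: "1 / \<eta>t t \<le> Z ^ (p0 + 1)"
proof -
  have "tau par ^ t \<le> (sigma par ^ p0) ^ t" using p0 params by (intro power_mono) auto
  also have "\<dots> = (sigma par ^ t) ^ p0" by (simp add: power_mult[symmetric] mult.commute)
  also have "\<dots> \<le> Z ^ p0"
  proof (rule power_mono)
    have "G0 * E \<le> Z" unfolding Z_def using \<Gamma>(13) E by (intro mult_right_mono) linarith+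
    then show "sigma par ^ t \<le> Z" using t by linarith
  qed (use params in simp)
  finally have "tau par ^ t * (1 / eta0 par) \<le> Z ^ (p0 + 1)"
    using params \<Gamma>(14) Z by - (rule mult_le_power_add, auto)
  then show ?thesis by (simp add: \<eta>t_def)
qed

abbreviation "Lx \<equiv> LXmax \<kappa> (Llow par * sigma par ^ t) (\<beta>t t) Zb"
abbreviation "Kx \<equiv> outer_iters \<kappa> Ub Zb (\<rho>t t) (\<eta>t t) (\<beta>t t) (Llow par * sigma par ^ t)"

lemma Lx: "0 < Lx" "Lx \<le> Z" "LX (\<beta>t t) Zb \<le> Z"
proof -
  have LX: "LX (\<beta>t t) Zb \<le> G1 * E"
  proof -
    have a1: "LPsi \<le> (L_F + 2 / \<beta> + (L_F + B)\<^sup>2 * (2 * Dy)) * E"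
    proof -
      have "LPsi = (L_F + 2 / \<beta>) * 1 + (L_F + B)\<^sup>2 * (1 / \<nu>)" by (simp add: LPsi_def)
      also have "\<dots> \<le> (L_F + 2 / \<beta>) * E + (L_F + B)\<^sup>2 * (2 * Dy * E)"
        unfolding inv_\<nu>(4) using L_F_nonneg params E Dy_pos by (intro add_mono mult_left_mono) auto
      finally show ?thesis by (simp add: algebra_simps)
    qed
    have a2: "L_c * (\<beta>t t * B + Zb) + \<beta>t t * B\<^sup>2 + 1 \<le> (L_c * (beta_x0 par * G0 * B + Zb) + beta_x0 par * G0 * B\<^sup>2 + 1) * E"
    proof -
      have b: "\<beta>t t \<le> beta_x0 par * G0 * E" unfolding \<beta>t_def using t params by (simp add: mult.assoc)
      have "Zb * 1 \<le> Zb * E" using Zb E by (intro mult_left_mono) linarith+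
      then have "\<beta>t t * B + Zb \<le> (beta_x0 par * G0 * E) * B + Zb * E"
        using b pos by (intro add_mono mult_right_mono) auto
      then have "L_c * (\<beta>t t * B + Zb) \<le> L_c * ((beta_x0 par * G0 * E) * B + Zb * E)"
        by (rule mult_left_mono) (rule lipschitz_on_nonneg[OF cc.lip])
      moreover have "\<beta>t t * B\<^sup>2 \<le> (beta_x0 par * G0 * E) * B\<^sup>2" using b by (intro mult_right_mono) auto
      ultimately have "L_c * (\<beta>t t * B + Zb) + \<beta>t t * B\<^sup>2 + 1
          \<le> L_c * ((beta_x0 par * G0 * E) * B + Zb * E) + (beta_x0 par * G0 * E) * B\<^sup>2 + E"
        using E by linarith
      also have "\<dots> = (L_c * (beta_x0 par * G0 * B + Zb) + beta_x0 par * G0 * B\<^sup>2 + 1) * E"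
        by (simp add: algebra_simps add_divide_distrib)
      finally show ?thesis .
    qed
    have "LX (\<beta>t t) Zb \<le> 2 * ((L_F + 2 / \<beta> + (L_F + B)\<^sup>2 * (2 * Dy)) * E)
        + 2 * ((L_c * (beta_x0 par * G0 * B + Zb) + beta_x0 par * G0 * B\<^sup>2 + 1) * E)"
      unfolding LX_def by (rule add_mono[OF mult_left_mono[OF a1] mult_left_mono[OF a2]]) simp_all
    also have "\<dots> = G1 * E" unfolding G1_def by (simp only: distrib_right mult.assoc)
    finally show ?thesis .
  qed
  have "0 \<le> gamma_u par * G1" "0 \<le> \<kappa> * Llow par * G0" using params \<Gamma>(20,21) \<kappa> by auto
  then have G: "\<kappa> * Llow par * G0 \<le> \<Gamma>" "gamma_u par * G1 \<le> \<Gamma>" using \<Gamma>(9) by linarith+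
  have E0: "0 \<le> E" using E by linarith
  have "\<kappa> * (Llow par * sigma par ^ t) \<le> \<kappa> * (Llow par * (G0 * E))"
    using t params \<kappa> by (intro mult_left_mono) auto
  also have "\<dots> = (\<kappa> * Llow par * G0) * E" by simp
  also have "\<dots> \<le> Z" unfolding Z_def using G(1) E0 by (rule mult_right_mono)
  finally have 1: "\<kappa> * (Llow par * sigma par ^ t) \<le> Z" .
  have "gamma_u par * LX (\<beta>t t) Zb \<le> gamma_u par * (G1 * E)" using LX params by (intro mult_left_mono) auto
  also have "\<dots> = (gamma_u par * G1) * E" by simp
  also have "\<dots> \<le> Z" unfolding Z_def using G(2) E0 by (rule mult_right_mono)
  finally have 2: "gamma_u par * LX (\<beta>t t) Zb \<le> Z" .
  show "Lx \<le> Z" unfolding LXmax_def using 1 2 by simp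
  have pos: "0 < LX (\<beta>t t) Zb" using LX_pos[OF schedule(5) Zb(1)] .
  then have "LX (\<beta>t t) Zb \<le> gamma_u par * LX (\<beta>t t) Zb" using params by simp
  then show "LX (\<beta>t t) Zb \<le> Z" using 2 by linarith
  show "0 < Lx" using pos params unfolding LXmax_def by (auto simp: less_max_iff_disj)
qed

lemma inv_\<rho>: "1 / \<rho>t t \<le> Z" "\<rho>t t \<le> Z"
proof -
  have "1 / \<rho>t t = sigma par ^ t / rho0 par" by (simp add: \<rho>t_def)
  also have "\<dots> \<le> (G0 * E) / rho0 par" using t params by (intro divide_right_mono) auto
  also have "\<dots> = (G0 / rho0 par) * E" by simp
  also have "\<dots> \<le> Z" unfolding Z_def using \<Gamma>(11) E by (intro mult_right_mono) linarith+
  finally show "1 / \<rho>t t \<le> Z" .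
  show "\<rho>t t \<le> Z" using schedule(2)[of t] \<Gamma>(12) Z(1) by linarith
qed

text \<open>Both \<open>Lx\<close> and \<open>1/\<rho>\<^sub>t\<close> are \<open>O(1/\<epsilon>)\<close>, so the condition number \<open>sqrt (Lx/(2\<rho>\<^sub>t))\<close> is \<open>O(1/\<epsilon>)\<close>.\<close>

lemma Kx: "(14 * RU Ub * Lx / \<eta>t t)\<^sup>2 \<le> Z ^ (2 * p0 + 8)"
  "real Kx + 2 \<le> (4 * real p0 + 23) * Z * l" "real Kx + 2 \<le> Z ^ 3"
proof -
  have R: "0 \<le> RU Ub" "RU Ub \<le> Z" using outer_constants(6)[OF Ub_nonneg] \<Gamma>(15) Z(1) by linarith+
  note \<rho> = schedule(1)[of t] and \<eta> = schedule(3)[of t]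
  have "14 * RU Ub \<le> Z ^ (1 + 1)" using R Z by - (rule mult_le_power_add, auto)
  then have "14 * RU Ub * Lx \<le> Z ^ ((1 + 1) + 1)" using R Lx Z by - (rule mult_le_power_add, auto)
  then have "14 * RU Ub * Lx * (1 / \<eta>t t) \<le> Z ^ (((1 + 1) + 1) + (p0 + 1))"
    using R Lx \<eta> inv_\<eta> Z by - (rule mult_le_power_add, auto)
  then have "(14 * RU Ub * Lx / \<eta>t t)\<^sup>2 \<le> (Z ^ (p0 + 4))\<^sup>2"
    using R Lx \<eta> by (intro power_mono) (auto simp: numeral_eq_Suc mult_ac)
  then show X0: "(14 * RU Ub * Lx / \<eta>t t)\<^sup>2 \<le> Z ^ (2 * p0 + 8)"
    by (simp add: power_mult[symmetric] algebra_simps)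
  have half: "1 / (2 * \<rho>t t) \<le> Z"
  proof -
    have "1 / (2 * \<rho>t t) \<le> 1 / \<rho>t t" using \<rho> by (intro divide_left_mono) auto
    then show ?thesis using inv_\<rho>(1) by linarith
  qed
  have LR: "Lx * (1 / (2 * \<rho>t t)) \<le> Z ^ (1 + 1)"
    using Lx half \<rho> Z by - (rule mult_le_power_add, auto)
  have X: "(14 * RU Ub * Lx / \<eta>t t)\<^sup>2 * (Lx / (2 * \<rho>t t)) \<le> Z ^ (2 * p0 + 10)"
  proof -
    have "(14 * RU Ub * Lx / \<eta>t t)\<^sup>2 * (Lx * (1 / (2 * \<rho>t t))) \<le> Z ^ ((2 * p0 + 8) + (1 + 1))"
      using X0 LR Lx \<rho> Z by - (rule mult_le_power_add, auto)
    then show ?thesis by (simp add: add_ac)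
  qed
  have "sqrt (Lx / (2 * \<rho>t t)) \<le> sqrt (Z\<^sup>2)" using LR by (intro real_sqrt_le_mono) (simp add: power2_eq_square)
  then have w: "sqrt (Lx / (2 * \<rho>t t)) \<le> Z" using Z by simp
  have Zl: "1 \<le> Z * l" "l \<le> Z * l" using mult_mono[OF Z(4,5)] mult_right_mono[OF Z(4), of l] Z by auto
  have "real Kx \<le> 1 + (1 + Z) * (real (2 * p0 + 10) * l)"
    unfolding outer_iters_def by (rule iter_bound_le[OF Lx(1) \<rho> Z(4) X w])
  also have "\<dots> = 1 + (2 * real p0 + 10) * (l + Z * l)" by (simp add: algebra_simps)
  also have "\<dots> \<le> 1 + (2 * real p0 + 10) * (Z * l + Z * l)" using Zl by (intro add_left_mono mult_left_mono) auto
  also have "\<dots> = 1 + (4 * real p0 + 20) * (Z * l)" by (simp add: algebra_simps)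
  finally show K: "real Kx + 2 \<le> (4 * real p0 + 23) * Z * l" using Zl(1) by (simp add: distrib_right mult.assoc)
  also have "\<dots> \<le> Z * Z * Z" using \<Gamma>(2) Z by (intro mult_mono) auto
  finally show "real Kx + 2 \<le> Z ^ 3" by (simp add: power3_eq_cube)
qed

lemma outer_tol_bounds:
  "0 < outer_tol \<kappa> Ub Zb (\<rho>t t) (\<eta>t t) (\<beta>t t) (Llow par * sigma par ^ t) LF"
  "outer_tol \<kappa> Ub Zb (\<rho>t t) (\<eta>t t) (\<beta>t t) (Llow par * sigma par ^ t) LF \<le> tb"
  "1 / outer_tol \<kappa> Ub Zb (\<rho>t t) (\<eta>t t) (\<beta>t t) (Llow par * sigma par ^ t) LF \<le> Z ^ (3 * p0 + 25)"
proof -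
  let ?q = "query_accuracy (Llow par * sigma par ^ t) (\<rho>t t) (\<eta>t t) (RU Ub) Lx Kx"
  note \<rho> = schedule(1)[of t] and \<eta> = schedule(3)[of t]
  have q: "0 < ?q" by (rule query_accuracy_pos[OF \<rho> \<eta>])
  have LM: "0 < LF + M_p P" "L_F + M_p P \<le> LF + M_p P" "LF + M_p P \<le> Z"
    using LF L_M \<Gamma>(16) Z(1) nubar by linarith+
  have tol: "outer_tol \<kappa> Ub Zb (\<rho>t t) (\<eta>t t) (\<beta>t t) (Llow par * sigma par ^ t) LF = ?q * \<nu> / (LF + M_p P)"
    by (simp add: outer_tol_def)
  show "0 < outer_tol \<kappa> Ub Zb (\<rho>t t) (\<eta>t t) (\<beta>t t) (Llow par * sigma par ^ t) LF"
    unfolding tol using q \<nu> LM by simp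
  have "?q \<le> \<eta>t t / 8" unfolding query_accuracy_def Let_def by (rule min.cobounded1)
  then have "?q \<le> eta0 par / 8" using schedule(4)[of t] by linarith
  then have "?q * \<nu> / (LF + M_p P) \<le> eta0 par / 8 * nubar / (L_F + M_p P)"
    using q \<nu> nubar LM L_M params by (intro frac_le mult_mono mult_nonneg_nonneg) auto
  then show "outer_tol \<kappa> Ub Zb (\<rho>t t) (\<eta>t t) (\<beta>t t) (Llow par * sigma par ^ t) LF \<le> tb"
    unfolding tol tb_def by simp
  have "4 / (Llow par * sigma par ^ t) \<le> 4 / Llow par"
    using schedule(9)[of t] params by (intro divide_left_mono) auto
  then have "4 / (Llow par * sigma par ^ t) \<le> Z" using \<Gamma>(10) Z(1) by linarith
  then have "1 / ?q \<le> Z ^ ((2 * p0 + 8) + (p0 + 1) + 14)"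
    using Kx(1,3) inv_\<rho> inv_\<eta> \<rho> \<eta> params Z by (intro query_accuracy_ge) auto
  then have "(1 / ?q) * (1 / \<nu>) \<le> Z ^ (((2 * p0 + 8) + (p0 + 1) + 14) + 1)"
    using q \<nu> inv_\<nu>(1) Z by - (rule mult_le_power_add, auto)
  then have "((1 / ?q) * (1 / \<nu>)) * (LF + M_p P) \<le> Z ^ ((((2 * p0 + 8) + (p0 + 1) + 14) + 1) + 1)"
    using q \<nu> LM Z by - (rule mult_le_power_add, auto)
  moreover have "(((2 * p0 + 8) + (p0 + 1) + 14) + 1) + 1 = 3 * p0 + 25" by simp
  ultimately show "1 / outer_tol \<kappa> Ub Zb (\<rho>t t) (\<eta>t t) (\<beta>t t) (Llow par * sigma par ^ t) LF \<le> Z ^ (3 * p0 + 25)"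
    unfolding tol by (simp add: mult_ac add_ac)
qed

lemma trial_bound_outer:
  "real (trial_bound (gamma_u par) (LX (\<beta>t t) Zb) (Llow par * sigma par ^ t)) + 1 \<le> 4 * \<Gamma> * l"
proof -
  have LX0: "0 \<le> LX (\<beta>t t) Zb" using LX_pos[OF schedule(5) Zb(1)] less_imp_le by blast
  have i: "1 / (Llow par * sigma par ^ t) \<le> Z"
  proof -
    have "1 / (Llow par * sigma par ^ t) \<le> 4 / Llow par"
      using schedule(9)[of t] params by (intro frac_le) auto
    then show ?thesis using \<Gamma>(10) Z(1) by linarith
  qed
  have "LX (\<beta>t t) Zb * (1 / (Llow par * sigma par ^ t)) \<le> Z ^ (1 + 1)"
    using Lx(3) LX0 i params Z by - (rule mult_le_power_add, auto)
  then have "real (trial_bound (gamma_u par) (LX (\<beta>t t) Zb) (Llow par * sigma par ^ t)) \<le> 1 + real 2 * l / ln (gamma_u par)"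
    using params Z by (intro trial_bound_le) (auto simp: power2_eq_square)
  also have "real 2 * l / ln (gamma_u par) = 2 * l * (1 / ln (gamma_u par))" by simp
  also have "\<dots> \<le> 2 * l * \<Gamma>" using \<Gamma>(17) Z by (intro mult_left_mono) auto
  finally have "real (trial_bound (gamma_u par) (LX (\<beta>t t) Zb) (Llow par * sigma par ^ t)) + 1 \<le> 2 + 2 * (\<Gamma> * l)"
    by (simp add: mult_ac)
  moreover have "1 * 1 \<le> \<Gamma> * l" using \<Gamma>(1) Z by (intro mult_mono) auto
  ultimately show ?thesis by simp
qed

end

end

section \<open>Total cost\<close>

context small_perturbation
begin

text \<open>The number of outer iterations after which \<open>CK/\<sigma>\<^sup>T \<le> \<epsilon>/2\<close>.\<close>

definition T :: nat where
  "T = nat \<lceil>ln (max 1 (CK / (\<epsilon> / 2))) / ln (sigma par)\<rceil>"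

lemma T: "CK / sigma par ^ T \<le> \<epsilon> / 2" "t \<le> T \<Longrightarrow> sigma par ^ t \<le> G0 * E" "real T + 1 \<le> 3 * \<Gamma> * l"
proof -
  let ?M = "max 1 (CK / (\<epsilon> / 2))"
  have s: "1 < sigma par" "0 < ln (sigma par)" using params by auto
  have "?M \<le> sigma par ^ T" unfolding T_def by (rule le_power_nat_ceiling) (use s in auto)
  then have "CK / (\<epsilon> / 2) \<le> sigma par ^ T" by simp
  then show "CK / sigma par ^ T \<le> \<epsilon> / 2" using s \<epsilon> by (simp add: field_simps)
  have ME: "?M \<le> (1 + 2 * CK) * E"
  proof -
    have "0 \<le> CK * E" using CK_nonneg E by (intro mult_nonneg_nonneg) linarith+
    moreover have "CK / (\<epsilon> / 2) = 2 * (CK * E)" by (simp add: E_def)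
    moreover have "(1 + 2 * CK) * E = E + 2 * (CK * E)" by (simp add: distrib_right)
    ultimately show ?thesis using E by simp
  qed
  have Tle: "real T \<le> 1 + ln ?M / ln (sigma par)"
  proof -
    have "0 \<le> ln ?M / ln (sigma par)" using s by (intro divide_nonneg_nonneg) auto
    then show ?thesis unfolding T_def by linarith
  qed
  have sT: "sigma par ^ T \<le> G0 * E"
  proof -
    have "real T * ln (sigma par) \<le> ln (sigma par) + ln ?M"
      using mult_right_mono[OF Tle, of "ln (sigma par)"] s by (simp add: distrib_right)
    also have "\<dots> = ln (sigma par * ?M)" using s by (subst ln_mult_pos) auto
    finally have "ln (sigma par ^ T) \<le> ln (sigma par * ?M)" using s by (simp add: ln_realpow)
    then have "sigma par ^ T \<le> sigma par * ?M" using s by (subst (asm) ln_le_cancel_iff) auto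
    also have "\<dots> \<le> sigma par * ((1 + 2 * CK) * E)" using ME s by (intro mult_left_mono) auto
    finally show ?thesis by (simp add: G0_def mult.assoc)
  qed
  show "sigma par ^ t \<le> G0 * E" if "t \<le> T"
    using power_increasing[OF that, of "sigma par"] s sT by linarith
  have "(1 + 2 * CK) * E \<le> Z" unfolding Z_def using \<Gamma>(19) E by (intro mult_right_mono) linarith+
  then have "ln ?M \<le> l" using ME Z by (subst ln_le_cancel_iff) auto
  then have "ln ?M * (1 / ln (sigma par)) \<le> l * \<Gamma>" using \<Gamma>(18) s Z by (intro mult_mono) auto
  then have "ln ?M / ln (sigma par) \<le> \<Gamma> * l" by (simp add: mult.commute)
  moreover have "1 * 1 \<le> \<Gamma> * l" using \<Gamma>(1) Z by (intro mult_mono) auto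
  ultimately have "real T + 1 \<le> 3 * (\<Gamma> * l)" using Tle by linarith
  then show "real T + 1 \<le> 3 * \<Gamma> * l" by (simp only: mult.assoc)
qed

lemma final_tol:
  assumes "sigma par ^ t \<le> G0 * E"
  shows "0 < min (\<epsilon> / 2) (\<eta>t t) * \<nu>" "min (\<epsilon> / 2) (\<eta>t t) * \<nu> \<le> tb"
    "1 / (min (\<epsilon> / 2) (\<eta>t t) * \<nu>) \<le> Z ^ (3 * p0 + 25)"
proof -
  note \<eta> = schedule(3)[of t]
  have m: "0 < min (\<epsilon> / 2) (\<eta>t t)" using \<epsilon> \<eta> by simp
  show "0 < min (\<epsilon> / 2) (\<eta>t t) * \<nu>" using m \<nu> by simp
  have "min (\<epsilon> / 2) (\<eta>t t) * \<nu> \<le> eta0 par * nubar"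
    using m \<nu> nubar schedule(4)[of t] by (intro mult_mono) auto
  then show "min (\<epsilon> / 2) (\<eta>t t) * \<nu> \<le> tb" unfolding tb_def by simp
  have "2 * E \<le> Z" unfolding Z_def using \<Gamma>(1) E by (intro mult_right_mono) linarith+
  then have "1 / (\<epsilon> / 2) \<le> Z ^ 1" by (simp add: E_def)
  also have "\<dots> \<le> Z ^ (p0 + 1)" using Z by (intro power_increasing) auto
  finally have "1 / min (\<epsilon> / 2) (\<eta>t t) \<le> Z ^ (p0 + 1)" using inv_\<eta>[OF assms] by (simp add: min_def)
  then have "(1 / min (\<epsilon> / 2) (\<eta>t t)) * (1 / \<nu>) \<le> Z ^ ((p0 + 1) + 1)"
    using m \<nu> inv_\<nu>(1) Z by - (rule mult_le_power_add, auto)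
  also have "\<dots> \<le> Z ^ (3 * p0 + 25)" using Z by (intro power_increasing) auto
  finally show "1 / (min (\<epsilon> / 2) (\<eta>t t) * \<nu>) \<le> Z ^ (3 * p0 + 25)" by simp
qed

lemma scale_ge_one: "1 \<le> \<Gamma>" "1 \<le> sqrt E" "1 \<le> ln E"
proof -
  show "1 \<le> \<Gamma>" using \<Gamma>(1) by simp
  show "1 \<le> sqrt E" using E by (simp add: real_le_rsqrt)
  have "exp 1 \<le> E" using exp_le E by linarith
  then show "1 \<le> ln E" using E by (subst ln_ge_iff) auto
qed

lemma inner_cost_bound:
  assumes "LYmax \<kappa> U \<le> \<Gamma>" "real (trial_bound (gamma_u par) (LY U) (Llow par)) \<le> \<Gamma>"
    and "0 < tol" "tol \<le> tb" "1 / tol \<le> Z ^ (3 * p0 + 25)"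
  shows "real (inner_cost \<kappa> U tol) \<le> 42 * \<Gamma> ^ 3 * sqrt E * l"
proof -
  have "real (inner_cost \<kappa> U tol) \<le> 7 * (4 * real (3 * p0 + 25) + 19) * \<Gamma>\<^sup>2 * sqrt E * l"
    by (rule inner_cost_le[OF assms])
  also have "\<dots> \<le> 7 * (6 * \<Gamma>) * \<Gamma>\<^sup>2 * sqrt E * l"
    using \<Gamma>(2) scale_ge_one Z by (intro mult_right_mono mult_left_mono) auto
  also have "\<dots> = 42 * \<Gamma> ^ 3 * sqrt E * l" by (simp add: power3_eq_cube power2_eq_square)
  finally show ?thesis .
qed

lemma step_cost_y:
  assumes t: "t \<le> T"
  shows "real (step_cost \<kappa> LF (\<epsilon> / 2) 1 0 0 t) \<le> 400 * \<Gamma> ^ 6 * (E * sqrt E) * l ^ 3"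
proof -
  note st = T(2)[OF t]
  let ?i = "inner_cost \<kappa> (NU Ub) (outer_tol \<kappa> Ub Zb (\<rho>t t) (\<eta>t t) (\<beta>t t) (Llow par * sigma par ^ t) LF)"
  let ?j = "inner_cost \<kappa> Ub (min (\<epsilon> / 2) (\<eta>t t) * \<nu>)"
  let ?J = "trial_bound (gamma_u par) (LX (\<beta>t t) Zb) (Llow par * sigma par ^ t)"
  let ?I = "42 * \<Gamma> ^ 3 * sqrt E * l"
  have i: "real ?i \<le> ?I" by (rule inner_cost_bound[OF \<Gamma>(4,7) outer_tol_bounds[OF st]])
  have j: "real ?j \<le> ?I" by (rule inner_cost_bound[OF \<Gamma>(5,8) final_tol[OF st]])
  have K: "real (Kx t) + 2 \<le> \<Gamma> * Z * l"
  proof -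
    have "(4 * real p0 + 23) * Z * l \<le> \<Gamma> * Z * l" using \<Gamma>(2) Z by (intro mult_right_mono) auto
    then show ?thesis using Kx(2)[OF st] by linarith
  qed
  have J: "real ?J + 1 \<le> 4 * \<Gamma> * l" by (rule trial_bound_outer[OF st])
  have pos: "0 \<le> \<Gamma>" "0 \<le> l" "0 \<le> Z" "0 \<le> sqrt E" using scale_ge_one Z by auto
  have "(real (Kx t) + 2) * ((real ?J + 1) * (2 * real ?i)) \<le> (\<Gamma> * Z * l) * ((4 * \<Gamma> * l) * (2 * ?I))"
    using K J i pos by (intro mult_mono) auto
  also have "\<dots> = 336 * (\<Gamma> ^ 6 * (E * sqrt E) * l ^ 3)"
    unfolding Z_def by (simp add: numeral_eq_Suc)
  finally have 1: "(real (Kx t) + 2) * ((real ?J + 1) * (2 * real ?i)) \<le> 336 * (\<Gamma> ^ 6 * (E * sqrt E) * l ^ 3)" .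
  have big: "1 * (1 * 1) * 1 \<le> \<Gamma> ^ 6 * (E * sqrt E) * l ^ 3"
    using scale_ge_one Z E by (intro mult_mono one_le_power) auto
  have "?I = 42 * (\<Gamma> ^ 3 * (1 * sqrt E) * l ^ 1)" by simp
  also have "\<dots> \<le> 42 * (\<Gamma> ^ 6 * (E * sqrt E) * l ^ 3)"
    using scale_ge_one Z E by (intro mult_left_mono mult_mono power_increasing) auto
  finally have 2: "real ?j \<le> 42 * (\<Gamma> ^ 6 * (E * sqrt E) * l ^ 3)" using j by linarith
  have "real (step_cost \<kappa> LF (\<epsilon> / 2) 1 0 0 t)
      = (real (Kx t) + 2) * ((real ?J + 1) * (2 * real ?i)) + real ?j + 1"
    unfolding step_cost_def outer_cost_def by (simp add: algebra_simps)
  also have "\<dots> \<le> 379 * (\<Gamma> ^ 6 * (E * sqrt E) * l ^ 3)" using 1 2 big by linarith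
  finally show ?thesis using big by linarith
qed

lemma step_cost_x:
  assumes t: "t \<le> T"
  shows "real (step_cost \<kappa> LF (\<epsilon> / 2) 0 1 1 t) \<le> 14 * \<Gamma> ^ 3 * E * l\<^sup>2"
proof -
  note st = T(2)[OF t]
  let ?J = "trial_bound (gamma_u par) (LX (\<beta>t t) Zb) (Llow par * sigma par ^ t)"
  have K: "real (Kx t) + 2 \<le> \<Gamma> * Z * l"
  proof -
    have "(4 * real p0 + 23) * Z * l \<le> \<Gamma> * Z * l" using \<Gamma>(2) Z by (intro mult_right_mono) auto
    then show ?thesis using Kx(2)[OF st] by linarith
  qed
  have Gl: "1 * 1 \<le> \<Gamma> * l" using scale_ge_one Z by (intro mult_mono) auto
  have J: "(real ?J + 1) * 3 + 1 \<le> 13 * (\<Gamma> * l)" using trial_bound_outer[OF st] Gl by simp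
  have "(real (Kx t) + 2) * ((real ?J + 1) * 3 + 1) \<le> (\<Gamma> * Z * l) * (13 * (\<Gamma> * l))"
    using K J scale_ge_one Z by (intro mult_mono) auto
  also have "\<dots> = 13 * (\<Gamma> ^ 3 * E * l\<^sup>2)" unfolding Z_def by (simp add: numeral_eq_Suc)
  finally have 1: "(real (Kx t) + 2) * ((real ?J + 1) * 3 + 1) \<le> 13 * (\<Gamma> ^ 3 * E * l\<^sup>2)" .
  have big: "1 * 1 * 1 \<le> \<Gamma> ^ 3 * E * l\<^sup>2" using scale_ge_one Z E by (intro mult_mono one_le_power) auto
  have "real (step_cost \<kappa> LF (\<epsilon> / 2) 0 1 1 t) = (real (Kx t) + 2) * ((real ?J + 1) * 3 + 1) + 1"
    unfolding step_cost_def outer_cost_def by (simp add: algebra_simps)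
  also have "\<dots> \<le> 14 * (\<Gamma> ^ 3 * E * l\<^sup>2)" using 1 big by linarith
  finally show ?thesis by linarith
qed

lemma total_y: "(real T + 1) * (400 * \<Gamma> ^ 6 * (E * sqrt E) * l ^ 3) \<le> 1200 * \<Gamma> ^ 11 * (E * sqrt E) * ln E ^ 4"
proof -
  have "(real T + 1) * (400 * \<Gamma> ^ 6 * (E * sqrt E) * l ^ 3) \<le> (3 * \<Gamma> * l) * (400 * \<Gamma> ^ 6 * (E * sqrt E) * l ^ 3)"
    using T(3) scale_ge_one Z E by (intro mult_right_mono) auto
  also have "\<dots> = 1200 * \<Gamma> ^ 7 * (E * sqrt E) * l ^ 4" by (simp add: numeral_eq_Suc)
  also have "\<dots> \<le> 1200 * \<Gamma> ^ 7 * (E * sqrt E) * (\<Gamma> * ln E) ^ 4"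
    using l_le scale_ge_one Z E by (intro mult_left_mono power_mono) auto
  also have "\<dots> = 1200 * \<Gamma> ^ 11 * (E * sqrt E) * ln E ^ 4" by (simp add: power_mult_distrib numeral_eq_Suc)
  finally show ?thesis .
qed

lemma total_x: "(real T + 1) * (14 * \<Gamma> ^ 3 * E * l\<^sup>2) \<le> 1200 * \<Gamma> ^ 11 * E * ln E ^ 4"
proof -
  have "(real T + 1) * (14 * \<Gamma> ^ 3 * E * l\<^sup>2) \<le> (3 * \<Gamma> * l) * (14 * \<Gamma> ^ 3 * E * l\<^sup>2)"
    using T(3) scale_ge_one Z E by (intro mult_right_mono) auto
  also have "\<dots> = 42 * \<Gamma> ^ 4 * E * l ^ 3" by (simp add: numeral_eq_Suc)
  also have "\<dots> \<le> 42 * \<Gamma> ^ 4 * E * (\<Gamma> * ln E) ^ 3"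
    using l_le scale_ge_one Z E by (intro mult_left_mono power_mono) auto
  also have "\<dots> = 42 * \<Gamma> ^ 7 * E * ln E ^ 3" by (simp add: power_mult_distrib numeral_eq_Suc)
  also have "\<dots> \<le> 1200 * \<Gamma> ^ 11 * E * ln E ^ 4"
    using scale_ge_one E by (intro mult_mono power_increasing) auto
  finally show ?thesis .
qed

lemma le_nat_floor_bound:
  assumes "0 \<le> b" "n \<le> (k + 1) * nat \<lfloor>b\<rfloor>"
  shows "real n \<le> (real k + 1) * b"
proof -
  have "real n \<le> real ((k + 1) * nat \<lfloor>b\<rfloor>)" using assms(2) by (simp only: of_nat_le_iff)
  also have "\<dots> = (real k + 1) * real (nat \<lfloor>b\<rfloor>)" by (simp add: algebra_simps)
  also have "\<dots> \<le> (real k + 1) * b" using assms(1) by (intro mult_left_mono) auto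
  finally show ?thesis .
qed

lemma complexity:
  assumes \<Lambda>: "\<forall>i. 1 \<le> \<Lambda> i \<and> \<Lambda> i \<le> \<kappa>"
  shows "\<exists>out s. algorithm_A \<Lambda> Pn par \<nu> LF (\<epsilon> / 2) = Some (out, s) \<and>
    (\<forall>N \<in> {n_gradx s, n_Jc s, n_proxg s}. real N \<le> 1200 * \<Gamma> ^ 11 * E * ln E ^ 4) \<and>
    (\<forall>N \<in> {n_grady s, n_Jp s, n_proxh s}. real N \<le> 1200 * \<Gamma> ^ 11 * (E * sqrt E) * ln E ^ 4)"
proof -
  have e: "0 < \<epsilon> / 2" using \<epsilon> by simp
  have \<Lambda>1: "1 \<le> \<Lambda> i" for i using \<Lambda> by blast
  have \<Lambda>2: "(a \<and> b \<and> c) \<or> (\<forall>i. \<Lambda> i \<le> \<kappa>)" for a b c using \<Lambda> by blast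
  define Sx where "Sx = nat \<lfloor>14 * \<Gamma> ^ 3 * E * l\<^sup>2\<rfloor>"
  define Sy where "Sy = nat \<lfloor>400 * \<Gamma> ^ 6 * (E * sqrt E) * l ^ 3\<rfloor>"
  have Sx: "step_cost \<kappa> LF (\<epsilon> / 2) 0 1 1 t \<le> Sx" if "t \<le> T" for t
    unfolding Sx_def using step_cost_x[OF that] by (rule le_nat_floor)
  have Sy: "step_cost \<kappa> LF (\<epsilon> / 2) 1 0 0 t \<le> Sy" if "t \<le> T" for t
    unfolding Sy_def using step_cost_y[OF that] by (rule le_nat_floor)
  have X: "\<exists>x y z u s. algorithm_A \<Lambda> Pn par \<nu> LF (\<epsilon> / 2) = Some ((x, y, z, u), s) \<and>
      eps_KKT_mult (\<epsilon> / 2) Pn x y z u \<and> m s \<le> (T + 1) * Sx"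
    if "\<And>s. m (tick_y s) \<le> m s + 0" "\<And>s. m (tick_h s) \<le> m s + 0" "\<And>s. m (tick_x s) \<le> m s + 1"
      "\<And>s. m (tick_g s) \<le> m s + 1" "\<And>s i. m (s\<lparr>n_iapg := i\<rparr>) = m s" "m no_calls = 0" for m
    by (rule algorithm_A_terminates[where m = m, OF LF(1) e \<Lambda>1 \<Lambda>2 that T(1) Sx])
  have Y: "\<exists>x y z u s. algorithm_A \<Lambda> Pn par \<nu> LF (\<epsilon> / 2) = Some ((x, y, z, u), s) \<and>
      eps_KKT_mult (\<epsilon> / 2) Pn x y z u \<and> m s \<le> (T + 1) * Sy"
    if "\<And>s. m (tick_y s) \<le> m s + 1" "\<And>s. m (tick_h s) \<le> m s + 1" "\<And>s. m (tick_x s) \<le> m s + 0"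
      "\<And>s. m (tick_g s) \<le> m s + 0" "\<And>s i. m (s\<lparr>n_iapg := i\<rparr>) = m s" "m no_calls = 0" for m
    by (rule algorithm_A_terminates[where m = m, OF LF(1) e \<Lambda>1 \<Lambda>2 that T(1) Sy])
  note ticks = tick_x_def tick_y_def tick_g_def tick_h_def no_calls_def
  obtain out s where run: "algorithm_A \<Lambda> Pn par \<nu> LF (\<epsilon> / 2) = Some (out, s)"
    using X[of n_gradx] by (auto simp: ticks)
  have "n_gradx s \<le> (T + 1) * Sx" "n_Jc s \<le> (T + 1) * Sx" "n_proxg s \<le> (T + 1) * Sx"
    using X[of n_gradx] X[of n_Jc] X[of n_proxg] by (auto simp: ticks run)
  moreover have "n_grady s \<le> (T + 1) * Sy" "n_Jp s \<le> (T + 1) * Sy" "n_proxh s \<le> (T + 1) * Sy"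
    using Y[of n_grady] Y[of n_Jp] Y[of n_proxh] by (auto simp: ticks run)
  moreover have "real n \<le> 1200 * \<Gamma> ^ 11 * E * ln E ^ 4" if "n \<le> (T + 1) * Sx" for n
    by (rule order_trans[OF le_nat_floor_bound[OF _ that[unfolded Sx_def]] total_x]) (use scale_ge_one Z E in auto)
  moreover have "real n \<le> 1200 * \<Gamma> ^ 11 * (E * sqrt E) * ln E ^ 4" if "n \<le> (T + 1) * Sy" for n
    by (rule order_trans[OF le_nat_floor_bound[OF _ that[unfolded Sy_def]] total_y]) (use scale_ge_one Z E in auto)
  ultimately show ?thesis using run by blast
qed

end

theorem theorem3p10:
  fixes P :: "(real^'n, real^'m, real^'q, real^'r) minimax"
    and par :: "(real^'n, real^'m, real^'q, real^'r) params"
    and L_F L_c L_p :: real and D_y :: real and \<nu> :: "real \<Rightarrow> real"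
    and P\<nu> :: "real \<Rightarrow> (real^'n, real^'m, real^'q, real^'r) minimax"
  assumes A1: "assumption_A1 P L_F L_c L_p"
    and A2: "assumption_A2 P"
    and par: "admissible P par"
    and D_y: "D_y = diameter (edom (hfun P))"
    and \<nu>: "\<And>\<epsilon>. \<nu> \<epsilon> = \<epsilon> / (2 * D_y)"
    and P\<nu>: "\<And>\<epsilon>. P\<nu> \<epsilon> = perturbed P (y_init par) (\<nu> \<epsilon>)"
    and nonzero_denominators: "D_y \<noteq> 0" "L_F + M_p P \<noteq> 0"
  shows
    "(\<forall>\<epsilon> LF \<Lambda>. \<epsilon> > 0 \<and> L_F \<le> LF \<and> LF \<le> L_F + \<nu> \<epsilon> \<and> (\<forall>i. 1 \<le> \<Lambda> i) \<longrightarrow>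
        (\<exists>x y z u s. algorithm_A \<Lambda> (P\<nu> \<epsilon>) par (\<nu> \<epsilon>) LF (\<epsilon> / 2) = Some ((x, y, z, u), s) \<and>
           eps_KKT (\<epsilon> / 2) (P\<nu> \<epsilon>) x y \<and> eps_KKT \<epsilon> P x y)) \<and>
     (\<forall>\<kappa>. \<exists>C k. \<forall>\<^sub>F \<epsilon> in at_right 0. \<forall>LF \<Lambda>.
        L_F \<le> LF \<and> LF \<le> L_F + \<nu> \<epsilon> \<and> (\<forall>i. 1 \<le> \<Lambda> i \<and> \<Lambda> i \<le> \<kappa>) \<longrightarrow>
        (\<exists>out s. algorithm_A \<Lambda> (P\<nu> \<epsilon>) par (\<nu> \<epsilon>) LF (\<epsilon> / 2) = Some (out, s) \<and>
           (\<forall>N \<in> {n_gradx s, n_Jc s, n_proxg s}. real N \<le> C * \<epsilon> powr (-1) * ln (1 / \<epsilon>) ^ k) \<and>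
           (\<forall>N \<in> {n_grady s, n_Jp s, n_proxh s}. real N \<le> C * \<epsilon> powr (-3/2) * ln (1 / \<epsilon>) ^ k)))"
proof -
  interpret minimax P L_F L_c L_p by unfold_locales (rule A1)
  obtain r B \<delta> xf yf where bounds: "minimax_bounds P L_F L_c L_p r B \<delta> xf yf"
    using bounds_exist[OF A2] .
  interpret minimax_bounds P L_F L_c L_p r B \<delta> xf yf by (rule bounds)
  have Dy: "0 < diameter (edom (hfun P))"
    using diameter_ge_0[OF compact_imp_bounded[OF h(3)]] nonzero_denominators(1) D_y by simp
  have LM: "0 < L_F + M_p P" using L_F_nonneg M_p(1) nonzero_denominators(2) by linarith
  have perturbed: "perturbed_minimax P L_F L_c L_p r B \<delta> xf yf par \<nu>' nubar" if "0 < \<nu>'" "\<nu>' \<le> nubar" for \<nu>' nubar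
    by unfold_locales (use par Dy LM that in auto)
  have \<nu>_pos: "0 < \<nu> \<epsilon>" if "0 < \<epsilon>" for \<epsilon> using that Dy by (simp add: \<nu> D_y)
  show ?thesis
  proof (intro conjI allI impI)
    fix \<epsilon> LF :: real and \<Lambda> :: "nat \<Rightarrow> real"
    assume H: "\<epsilon> > 0 \<and> L_F \<le> LF \<and> LF \<le> L_F + \<nu> \<epsilon> \<and> (\<forall>i. 1 \<le> \<Lambda> i)"
    interpret pm: perturbed_minimax P L_F L_c L_p r B \<delta> xf yf par "\<nu> \<epsilon>" "\<nu> \<epsilon>"
      by (rule perturbed) (use H \<nu>_pos in auto)
    have e: "0 < \<epsilon> / 2" using H by simp
    obtain T where "pm.CK / (\<epsilon> / 2) < sigma par ^ T" using real_arch_pow[OF pm.params(9)] by blast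
    then have T: "pm.CK / sigma par ^ T \<le> \<epsilon> / 2" using e pm.params(9) by (simp add: field_simps)
    have "\<exists>x y z u s. algorithm_A \<Lambda> (perturbed P (y_init par) (\<nu> \<epsilon>)) par (\<nu> \<epsilon>) LF (\<epsilon> / 2) = Some ((x, y, z, u), s) \<and>
      eps_KKT_mult (\<epsilon> / 2) (perturbed P (y_init par) (\<nu> \<epsilon>)) x y z u \<and> (0::nat) \<le> (T + 1) * 0"
      by (rule pm.algorithm_A_terminates[where m = "\<lambda>_. 0" and ey = 0 and ex = 0 and eg = 0 and S = 0, OF _ e _ _ _ _ _ _ _ _ T])
        (use H in \<open>auto simp: pm.step_cost_def pm.outer_cost_def\<close>)
    then obtain x y z u s where
      run: "algorithm_A \<Lambda> (P\<nu> \<epsilon>) par (\<nu> \<epsilon>) LF (\<epsilon> / 2) = Some ((x, y, z, u), s)"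
      and kkt: "eps_KKT (\<epsilon> / 2) (P\<nu> \<epsilon>) x y"
      unfolding P\<nu> eps_KKT_def by blast
    have "eps_KKT \<epsilon> P x y"
      by (rule pm.eps_KKT_unperturbed[OF kkt[unfolded P\<nu>]]) (use Dy in \<open>simp add: \<nu> D_y\<close>)
    with run kkt show "\<exists>x y z u s. algorithm_A \<Lambda> (P\<nu> \<epsilon>) par (\<nu> \<epsilon>) LF (\<epsilon> / 2) = Some ((x, y, z, u), s) \<and>
           eps_KKT (\<epsilon> / 2) (P\<nu> \<epsilon>) x y \<and> eps_KKT \<epsilon> P x y" by blast
  next
    fix \<kappa> :: real
    define \<kappa>' where "\<kappa>' = max 1 \<kappa>"
    define nubar where "nubar = \<nu> 1"
    interpret pm: perturbed_minimax P L_F L_c L_p r B \<delta> xf yf par nubar nubar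
      by (rule perturbed) (use \<nu>_pos[of 1] in \<open>auto simp: nubar_def\<close>)
    define C where "C = 1200 * pm.Gam \<kappa>' ^ 11"
    show "\<exists>C k. \<forall>\<^sub>F \<epsilon> in at_right 0. \<forall>LF \<Lambda>.
        L_F \<le> LF \<and> LF \<le> L_F + \<nu> \<epsilon> \<and> (\<forall>i. 1 \<le> \<Lambda> i \<and> \<Lambda> i \<le> \<kappa>) \<longrightarrow>
        (\<exists>out s. algorithm_A \<Lambda> (P\<nu> \<epsilon>) par (\<nu> \<epsilon>) LF (\<epsilon> / 2) = Some (out, s) \<and>
           (\<forall>N \<in> {n_gradx s, n_Jc s, n_proxg s}. real N \<le> C * \<epsilon> powr (-1) * ln (1 / \<epsilon>) ^ k) \<and>
           (\<forall>N \<in> {n_grady s, n_Jp s, n_proxh s}. real N \<le> C * \<epsilon> powr (-3/2) * ln (1 / \<epsilon>) ^ k))"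
    proof (intro exI[of _ C] exI[of _ 4] eventually_mono[OF eventually_at_right_real[of 0 "1/3"]] allI impI)
      fix \<epsilon> LF :: real and \<Lambda> :: "nat \<Rightarrow> real"
      assume \<epsilon>: "\<epsilon> \<in> {0<..<1/3}"
        and H: "L_F \<le> LF \<and> LF \<le> L_F + \<nu> \<epsilon> \<and> (\<forall>i. 1 \<le> \<Lambda> i \<and> \<Lambda> i \<le> \<kappa>)"
      have "\<nu> \<epsilon> \<le> nubar" using \<epsilon> Dy by (simp add: nubar_def \<nu> D_y divide_right_mono)
      then have "perturbed_minimax P L_F L_c L_p r B \<delta> xf yf par (\<nu> \<epsilon>) nubar"
        using perturbed \<nu>_pos \<epsilon> by simp
      then interpret sp: small_perturbation P L_F L_c L_p r B \<delta> xf yf par "\<nu> \<epsilon>" nubar \<epsilon> \<kappa>' LF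
        unfolding small_perturbation_def small_perturbation_axioms_def
        using \<epsilon> H by (auto simp: \<kappa>'_def \<nu> D_y)
      have E1: "\<epsilon> powr (-1) = sp.E" using \<epsilon> by (simp add: sp.E_def powr_minus_divide)
      have "\<epsilon> powr (-3/2) = sp.E powr (3/2)" using \<epsilon> by (simp add: sp.E_def powr_minus_divide powr_divide)
      also have "\<dots> = sp.E powr (1 + 1/2)" by simp
      also have "\<dots> = sp.E * sqrt sp.E" using sp.E unfolding powr_add by (simp add: powr_half_sqrt)
      finally have E2: "\<epsilon> powr (-3/2) = sp.E * sqrt sp.E" .
      have "\<forall>i. 1 \<le> \<Lambda> i \<and> \<Lambda> i \<le> \<kappa>'" using H by (auto simp: \<kappa>'_def le_max_iff_disj)
      from sp.complexity[OF this]
      show "\<exists>out s. algorithm_A \<Lambda> (P\<nu> \<epsilon>) par (\<nu> \<epsilon>) LF (\<epsilon> / 2) = Some (out, s) \<and>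
           (\<forall>N \<in> {n_gradx s, n_Jc s, n_proxg s}. real N \<le> C * \<epsilon> powr (-1) * ln (1 / \<epsilon>) ^ 4) \<and>
           (\<forall>N \<in> {n_grady s, n_Jp s, n_proxh s}. real N \<le> C * \<epsilon> powr (-3/2) * ln (1 / \<epsilon>) ^ 4)"
        unfolding P\<nu> E1 E2 C_def sp.\<Gamma>_def sp.E_def[symmetric] .
    qed simp
  qed
qed

end
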